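(* Let $k$ be an algebraically closed field of characteristic $p>0$, let $\mathfrak g$ be a finite dimensional restricted $p$-Lie algebra over $k$, and let $\Gamma$ be the finite group scheme over $k$ with $\mathcal{O}(\Gamma)=u(\mathfrak g)^*$. Then: (1) $H^0(\Gamma,\mathbb{G}_m)=k^\times$ and $H^1(\Gamma,\mathbb{G}_m)=\mathrm{Hom}(\Gamma,\mathbb{G}_m)$. (2) For every $n\ge2$, the assignment $E: Z^n(\Gamma,\mathbb{G}_a)\to Z^n(\Gamma,\mathbb{G}_m)$, $\phi\mapsto E(\phi)$, is a group isomorphism, whose inverse is given by $L:Z^n(\Gamma,\mathbb{G}_m)\to Z^n(\Gamma,\mathbb{G}_a)$, $\Phi\mapsto L(\Phi)$. (3) For every $n\ge3$, the assignment $\mathbf{E}:H^n(\Gamma,\mathbb{G}_a)\to H^n(\Gamma,\mathbb{G}_m)$, $[\phi]\mapsto[E(\phi)]$, is a well defined group isomorphism, whose inverse is given by $\mathbf{L}:H^n(\Gamma,\mathbb{G}_m)\to H^n(\Gamma,\mathbb{G}_a)$, $[\Phi]\mapsto[L(\Phi)]$.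
   Context: $u(\mathfrak g)$ is the restricted enveloping algebra, so $u(\mathfrak g)=k\Gamma$. $\mathcal{O}(\Gamma)$ is a finite dimensional local commutative algebra whose augmentation ideal $I$ satisfies $x^p=0$ for all $x\in I$. $H^n(\Gamma,\mathbb{G}_a)$ is the Hochschild cohomology of $\Gamma$ with trivial coefficients $k$, and $H^n(\Gamma,\mathbb{G}_m)=H^n_{\mathrm{Sw}}(u(\mathfrak g))$ is the Sweedler cohomology of the cocommutative Hopf algebra $u(\mathfrak g)$ with coefficients in the trivial module algebra $k$: $n$-cochains are respectively all elements and the invertible elements of $\mathcal{O}(\Gamma)^{\otimes n}$, with the standard bar differentials built from $\Delta$ (additive, resp. multiplicative). $Z^n$ denotes $n$-cocycles. In positive degrees only normalized cochains are used (applying the counit to any tensor factor gives $0$, resp. $1$), so that $Z^n(\Gamma,\mathbb{G}_a)\subset I^{\otimes n}$ and $Z^n(\Gamma,\mathbb{G}_m)\subset 1+I^{\otimes n}$. For $n\ge2$, $E:(I^{\otimes n},+)\to(1+I^{\otimes n},\times)$ is the unique homomorphism of unipotent algebraic groups with $E(T)=\sum_{j=0}^{p-1}T^j/j!$ for every decomposable $T=a_1\otimes\cdots\otimes a_n$, $a_i\in I$; it is an isomorphism, and $L:=E^{-1}$. *)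

theory Defs
  imports
    "HOL-Computational_Algebra.Computational_Algebra"
    "HOL-Library.Poly_Mapping"
    "HOL-Library.Function_Algebras"
    "HOL-Algebra.Algebra"
begin

section \<open>Restricted Lie algebras\<close>

text \<open>\<open>jacobson_coeff br x y m j\<close> is the coefficient of \<open>t ^ j\<close> in \<open>ad (t x + y) ^ m (x)\<close>.\<close>

primrec jacobson_coeff :: "('g \<Rightarrow> 'g \<Rightarrow> 'g::ab_group_add) \<Rightarrow> 'g \<Rightarrow> 'g \<Rightarrow> nat \<Rightarrow> nat \<Rightarrow> 'g" where
  "jacobson_coeff br x y 0 j = (if j = 0 then x else 0)"
| "jacobson_coeff br x y (Suc m) j =
     (if j = 0 then 0 else br x (jacobson_coeff br x y m (j - 1)))
     + br y (jacobson_coeff br x y m j)"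

text \<open>The sum in \<open>pmap_add\<close> is that of Jacobson's \<open>s\<^sub>i(x, y)\<close>, where \<open>i s\<^sub>i(x, y)\<close> is the
  coefficient of \<open>t ^ (i - 1)\<close> in \<open>ad (t x + y) ^ (p - 1) (x)\<close>.\<close>

locale restricted_lie_algebra = vector_space scale
  for scale :: "'k::field \<Rightarrow> 'g::ab_group_add \<Rightarrow> 'g" +
  fixes br :: "'g \<Rightarrow> 'g \<Rightarrow> 'g" and pmap :: "'g \<Rightarrow> 'g"
  assumes br_add_left: "br (x + y) z = br x z + br y z"
    and br_add_right: "br x (y + z) = br x y + br x z"
    and br_scale_left: "br (scale c x) y = scale c (br x y)"
    and br_scale_right: "br x (scale c y) = scale c (br x y)"
    and br_self: "br x x = 0"
    and jacobi: "br x (br y z) + br y (br z x) + br z (br x y) = 0"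
    and br_pmap: "br (pmap x) y = (br x ^^ CHAR('k)) y"
    and pmap_scale: "pmap (scale c x) = scale (c ^ CHAR('k)) (pmap x)"
    and pmap_add: "pmap (x + y) = pmap x + pmap y
          + (\<Sum>i = 1..<CHAR('k). scale (inverse (of_nat i))
               (jacobson_coeff br x y (CHAR('k) - 1) (i - 1)))"

definition fin_dim :: "('k::field \<Rightarrow> 'g::ab_group_add \<Rightarrow> 'g) \<Rightarrow> bool" where
  "fin_dim scale \<longleftrightarrow> (\<exists>B. finite B \<and> module.span scale B = UNIV)"

section \<open>The restricted enveloping algebra\<close>

text \<open>The free associative algebra on the set \<open>'g\<close> is the monoid algebra \<open>'g fmon \<Rightarrow>\<^sub>0 'k\<close> of the
  free monoid, written additively as \<^typ>\<open>('a, 'b) poly_mapping\<close> requires.\<close>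

datatype 'g fmon = Word (letters: "'g list")

instantiation fmon :: (type) monoid_add
begin

definition zero_fmon :: "'a fmon" where "0 = Word []"

definition plus_fmon :: "'a fmon \<Rightarrow> 'a fmon \<Rightarrow> 'a fmon" where
  "u + v = Word (letters u @ letters v)"

instance
  by standard (auto simp: zero_fmon_def plus_fmon_def)

end

type_synonym ('g, 'k) free_alg = "'g fmon \<Rightarrow>\<^sub>0 'k"

definition word_elem :: "'g list \<Rightarrow> ('g, 'k::field) free_alg" where
  "word_elem w = Poly_Mapping.single (Word w) 1"

definition scalar :: "'k::field \<Rightarrow> ('g, 'k) free_alg" where
  "scalar c = Poly_Mapping.single 0 c"

abbreviation gen :: "'g \<Rightarrow> ('g, 'k::field) free_alg" where
  "gen x \<equiv> word_elem [x]"

inductive_set two_sided_ideal :: "'a::ring_1 set \<Rightarrow> 'a set" for S where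
  zero: "0 \<in> two_sided_ideal S"
| gens: "s \<in> S \<Longrightarrow> a * s * b \<in> two_sided_ideal S"
| add: "a \<in> two_sided_ideal S \<Longrightarrow> b \<in> two_sided_ideal S \<Longrightarrow> a + b \<in> two_sided_ideal S"

definition u_relations ::
  "('k::field \<Rightarrow> 'g::ab_group_add \<Rightarrow> 'g) \<Rightarrow> ('g \<Rightarrow> 'g \<Rightarrow> 'g) \<Rightarrow> ('g \<Rightarrow> 'g) \<Rightarrow> ('g, 'k) free_alg set" where
  "u_relations scale br pmap =
     {gen (x + y) - gen x - gen y | x y. True}
     \<union> {gen (scale c x) - scalar c * gen x | c x. True}
     \<union> {gen x * gen y - gen y * gen x - gen (br x y) | x y. True}
     \<union> {gen x ^ CHAR('k) - gen (pmap x) | x. True}"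

text \<open>The elements of \<open>u(\<gg>)\<close> are the cosets \<open>u_class scale br pmap a\<close>.\<close>

definition u_class ::
  "('k::field \<Rightarrow> 'g::ab_group_add \<Rightarrow> 'g) \<Rightarrow> ('g \<Rightarrow> 'g \<Rightarrow> 'g) \<Rightarrow> ('g \<Rightarrow> 'g)
    \<Rightarrow> ('g, 'k) free_alg \<Rightarrow> ('g, 'k) free_alg set" where
  "u_class scale br pmap a = {b. b - a \<in> two_sided_ideal (u_relations scale br pmap)}"

definition u_dual ::
  "('k::field \<Rightarrow> 'g::ab_group_add \<Rightarrow> 'g) \<Rightarrow> ('g \<Rightarrow> 'g \<Rightarrow> 'g) \<Rightarrow> ('g \<Rightarrow> 'g)
    \<Rightarrow> (('g, 'k) free_alg set \<Rightarrow> 'k) set" where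
  "u_dual scale br pmap =
     {f. (\<forall>a b. f (u_class scale br pmap (a + b))
                = f (u_class scale br pmap a) + f (u_class scale br pmap b))
       \<and> (\<forall>c a. f (u_class scale br pmap (scalar c * a)) = c * f (u_class scale br pmap a))}"

text \<open>A functional \<open>f\<close> on \<open>u(\<gg>)\<close> is recorded by its values \<open>f(x\<^sub>1 \<cdots> x\<^sub>m)\<close> on the monomials in
  elements of \<open>\<gg>\<close>, which span \<open>u(\<gg>)\<close>. This embeds \<open>\<O>(\<Gamma>) = u(\<gg>)\<^sup>*\<close> into \<open>'g list \<Rightarrow> 'k\<close>.\<close>

definition coord_ring ::
  "('k::field \<Rightarrow> 'g::ab_group_add \<Rightarrow> 'g) \<Rightarrow> ('g \<Rightarrow> 'g \<Rightarrow> 'g) \<Rightarrow> ('g \<Rightarrow> 'g) \<Rightarrow> ('g list \<Rightarrow> 'k) set" where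
  "coord_ring scale br pmap = (\<lambda>f w. f (u_class scale br pmap (word_elem w))) ` u_dual scale br pmap"

text \<open>The counit of \<open>\<O>(\<Gamma>)\<close> is evaluation at \<open>1 \<in> u(\<gg>)\<close>, the empty monomial.\<close>

definition aug_ideal :: "('g list \<Rightarrow> 'k::field) set \<Rightarrow> ('g list \<Rightarrow> 'k) set" where
  "aug_ideal A = {a \<in> A. a [] = 0}"

section \<open>Tensor powers\<close>

text \<open>For a space \<open>V\<close> of functions on words, \<open>V\<^sup>\<otimes>\<^sup>n\<close> is realised inside the functions on \<open>n\<close>-tuples
  of words, extended by \<open>0\<close> to lists of other lengths: \<open>a\<^sub>1 \<otimes> \<dots> \<otimes> a\<^sub>n\<close> is the function
  \<open>(w\<^sub>1, \<dots>, w\<^sub>n) \<mapsto> a\<^sub>1(w\<^sub>1) \<cdots> a\<^sub>n(w\<^sub>n)\<close>.\<close>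

type_synonym ('g, 'k) cochain = "'g list list \<Rightarrow> 'k"

definition pure_tensor :: "('g list \<Rightarrow> 'k::field) list \<Rightarrow> ('g, 'k) cochain" where
  "pure_tensor as ws =
     (if length ws = length as then \<Prod>i<length as. (as ! i) (ws ! i) else 0)"

definition tensor_power :: "('g list \<Rightarrow> 'k::field) set \<Rightarrow> nat \<Rightarrow> ('g, 'k) cochain set" where
  "tensor_power V n = module.span (\<lambda>c \<phi> ws. c * \<phi> ws)
     {pure_tensor as | as. length as = n \<and> set as \<subseteq> V}"

text \<open>In \<open>u(\<gg>)\<close> one has \<open>\<Delta>(x\<^sub>1 \<cdots> x\<^sub>m) = (x\<^sub>1 \<otimes> 1 + 1 \<otimes> x\<^sub>1) \<cdots> (x\<^sub>m \<otimes> 1 + 1 \<otimes> x\<^sub>m)\<close>; \<open>splits w\<close> lists the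
  pairs of monomials in the expansion, and \<open>splits_list\<close> does the same in each tensor factor. The
  product of \<open>\<O>(\<Gamma>)\<^sup>\<otimes>\<^sup>n\<close> is dual to this comultiplication.\<close>

fun splits :: "'g list \<Rightarrow> ('g list \<times> 'g list) list" where
  "splits [] = [([], [])]"
| "splits (x # w) = map (\<lambda>(u, v). (x # u, v)) (splits w) @ map (\<lambda>(u, v). (u, x # v)) (splits w)"

fun splits_list :: "'g list list \<Rightarrow> ('g list list \<times> 'g list list) list" where
  "splits_list [] = [([], [])]"
| "splits_list (w # ws) =
     concat (map (\<lambda>(u, v). map (\<lambda>(us, vs). (u # us, v # vs)) (splits_list ws)) (splits w))"

definition conv :: "('g, 'k::field) cochain \<Rightarrow> ('g, 'k) cochain \<Rightarrow> ('g, 'k) cochain" where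
  "conv \<Phi> \<Psi> ws = (\<Sum>(us, vs)\<leftarrow>splits_list ws. \<Phi> us * \<Psi> vs)"

definition unit_cochain :: "nat \<Rightarrow> ('g, 'k::field) cochain" where
  "unit_cochain n ws = (if ws = replicate n [] then 1 else 0)"

definition cochain_ring :: "('g list \<Rightarrow> 'k::field) set \<Rightarrow> nat \<Rightarrow> ('g, 'k) cochain ring" where
  "cochain_ring A n = \<lparr>carrier = tensor_power A n, mult = conv, one = unit_cochain n,
     ring.zero = (\<lambda>_. 0), ring.add = (\<lambda>\<phi> \<psi> ws. \<phi> ws + \<psi> ws)\<rparr>"

section \<open>Cochains, cocycles and cohomology\<close>

text \<open>The comultiplication of \<open>\<O>(\<Gamma>)\<close> is \<open>(\<Delta> a)(u \<otimes> v) = a(u v)\<close>, so \<open>face i n\<close> is \<open>\<phi> \<mapsto> 1 \<otimes> \<phi>\<close> for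
  \<open>i = 0\<close>, \<open>\<phi> \<mapsto> \<phi> \<otimes> 1\<close> for \<open>i = n + 1\<close>, and otherwise \<open>\<Delta>\<close> applied to the \<open>i\<close>-th tensor factor
  (counting from \<open>1\<close>).\<close>

definition face :: "nat \<Rightarrow> nat \<Rightarrow> ('g, 'k::field) cochain \<Rightarrow> ('g, 'k) cochain" where
  "face i n \<phi> ws =
     (if length ws \<noteq> Suc n then 0
      else if i = 0 then (if hd ws = [] then \<phi> (tl ws) else 0)
      else if i = Suc n then (if last ws = [] then \<phi> (butlast ws) else 0)
      else \<phi> (take (i - 1) ws @ [ws ! (i - 1) @ ws ! i] @ drop (i + 1) ws))"

text \<open>The counit applied to the tensor factor number \<open>i\<close> (counting from \<open>0\<close>).\<close>

definition counit_at :: "nat \<Rightarrow> ('g, 'k::field) cochain \<Rightarrow> ('g, 'k) cochain" where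
  "counit_at i \<phi> ws = \<phi> (take i ws @ [[]] @ drop i ws)"

text \<open>In degree \<open>0\<close> the normalisation conditions below are vacuous.\<close>

definition C_add :: "('g list \<Rightarrow> 'k::field) set \<Rightarrow> nat \<Rightarrow> ('g, 'k) cochain set" where
  "C_add A n = {\<phi> \<in> tensor_power A n. \<forall>i<n. counit_at i \<phi> = (\<lambda>_. 0)}"

definition C_mult :: "('g list \<Rightarrow> 'k::field) set \<Rightarrow> nat \<Rightarrow> ('g, 'k) cochain set" where
  "C_mult A n = {\<Phi> \<in> Units (cochain_ring A n). \<forall>i<n. counit_at i \<Phi> = unit_cochain (n - 1)}"

definition d_add :: "nat \<Rightarrow> ('g, 'k::field) cochain \<Rightarrow> ('g, 'k) cochain" where
  "d_add n \<phi> ws = (\<Sum>i\<le>Suc n. (- 1) ^ i * face i n \<phi> ws)"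

definition d_mult ::
  "('g list \<Rightarrow> 'k::field) set \<Rightarrow> nat \<Rightarrow> ('g, 'k) cochain \<Rightarrow> ('g, 'k) cochain" where
  "d_mult A n \<Phi> = finprod (cochain_ring A (Suc n))
     (\<lambda>i. face i n \<Phi> [^]\<^bsub>cochain_ring A (Suc n)\<^esub> ((- 1) ^ i :: int)) {..Suc n}"

definition Z_add :: "('g list \<Rightarrow> 'k::field) set \<Rightarrow> nat \<Rightarrow> ('g, 'k) cochain monoid" where
  "Z_add A n = (add_monoid (cochain_ring A n))
     \<lparr>carrier := {\<phi> \<in> C_add A n. d_add n \<phi> = (\<lambda>_. 0)}\<rparr>"

definition Z_mult :: "('g list \<Rightarrow> 'k::field) set \<Rightarrow> nat \<Rightarrow> ('g, 'k) cochain monoid" where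
  "Z_mult A n = (units_of (cochain_ring A n))
     \<lparr>carrier := {\<Phi> \<in> C_mult A n. d_mult A n \<Phi> = unit_cochain (Suc n)}\<rparr>"

definition B_add :: "('g list \<Rightarrow> 'k::field) set \<Rightarrow> nat \<Rightarrow> ('g, 'k) cochain set" where
  "B_add A n = (case n of 0 \<Rightarrow> {\<lambda>_. 0} | Suc m \<Rightarrow> d_add m ` C_add A m)"

definition B_mult :: "('g list \<Rightarrow> 'k::field) set \<Rightarrow> nat \<Rightarrow> ('g, 'k) cochain set" where
  "B_mult A n = (case n of 0 \<Rightarrow> {unit_cochain 0} | Suc m \<Rightarrow> d_mult A m ` C_mult A m)"

definition H_add :: "('g list \<Rightarrow> 'k::field) set \<Rightarrow> nat \<Rightarrow> ('g, 'k) cochain set monoid" where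
  "H_add A n = Z_add A n Mod B_add A n"

definition H_mult :: "('g list \<Rightarrow> 'k::field) set \<Rightarrow> nat \<Rightarrow> ('g, 'k) cochain set monoid" where
  "H_mult A n = Z_mult A n Mod B_mult A n"

definition cls_add ::
  "('g list \<Rightarrow> 'k::field) set \<Rightarrow> nat \<Rightarrow> ('g, 'k) cochain \<Rightarrow> ('g, 'k) cochain set" where
  "cls_add A n \<phi> = B_add A n #>\<^bsub>Z_add A n\<^esub> \<phi>"

definition cls_mult ::
  "('g list \<Rightarrow> 'k::field) set \<Rightarrow> nat \<Rightarrow> ('g, 'k) cochain \<Rightarrow> ('g, 'k) cochain set" where
  "cls_mult A n \<Phi> = B_mult A n #>\<^bsub>Z_mult A n\<^esub> \<Phi>"

section \<open>The maps \<open>E\<close> and \<open>L\<close>\<close>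

definition one_plus :: "('g list \<Rightarrow> 'k::field) set \<Rightarrow> nat \<Rightarrow> ('g, 'k) cochain set" where
  "one_plus A n = {\<lambda>ws. unit_cochain n ws + \<phi> ws | \<phi>. \<phi> \<in> tensor_power (aug_ideal A) n}"

text \<open>Polynomial functions on a space of functions \<open>'x \<Rightarrow> 'k\<close>. On a finite dimensional subspace the
  evaluations at points span the linear functionals, so that the restrictions of these functions
  are its regular functions.\<close>

inductive_set poly_fun :: "(('x \<Rightarrow> 'k::field) \<Rightarrow> 'k) set" where
  "(\<lambda>_. c) \<in> poly_fun"
| "(\<lambda>T. T x) \<in> poly_fun"
| "f \<in> poly_fun \<Longrightarrow> g \<in> poly_fun \<Longrightarrow> (\<lambda>T. f T + g T) \<in> poly_fun"
| "f \<in> poly_fun \<Longrightarrow> g \<in> poly_fun \<Longrightarrow> (\<lambda>T. f T * g T) \<in> poly_fun"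

definition alg_group_hom_E ::
  "('g list \<Rightarrow> 'k::field) set \<Rightarrow> nat \<Rightarrow> (('g, 'k) cochain \<Rightarrow> ('g, 'k) cochain) \<Rightarrow> bool" where
  "alg_group_hom_E A n e \<longleftrightarrow>
     e \<in> hom ((add_monoid (cochain_ring A n))\<lparr>carrier := tensor_power (aug_ideal A) n\<rparr>)
             ((units_of (cochain_ring A n))\<lparr>carrier := one_plus A n\<rparr>)
     \<and> (\<forall>ws. \<exists>q \<in> poly_fun. \<forall>T \<in> tensor_power (aug_ideal A) n. e T ws = q T)
     \<and> (\<forall>as. length as = n \<and> set as \<subseteq> aug_ideal A \<longrightarrow>
          e (pure_tensor as) = (\<lambda>ws. \<Sum>j<CHAR('k).
            (pure_tensor as [^]\<^bsub>cochain_ring A n\<^esub> j) ws / of_nat (fact j)))"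

definition E_map ::
  "('g list \<Rightarrow> 'k::field) set \<Rightarrow> nat \<Rightarrow> ('g, 'k) cochain \<Rightarrow> ('g, 'k) cochain" where
  "E_map A n = (THE e. e \<in> extensional (tensor_power (aug_ideal A) n) \<and> alg_group_hom_E A n e)"

definition L_map ::
  "('g list \<Rightarrow> 'k::field) set \<Rightarrow> nat \<Rightarrow> ('g, 'k) cochain \<Rightarrow> ('g, 'k) cochain" where
  "L_map A n = inv_into (tensor_power (aug_ideal A) n) (E_map A n)"

section \<open>Characters\<close>

text \<open>\<open>\<O>(\<G>\<^sub>m) = k[t, t\<^sup>-\<^sup>1]\<close> is the group algebra \<open>int \<Rightarrow>\<^sub>0 'k\<close>, with \<open>\<Delta>(t\<^sup>m) = t\<^sup>m \<otimes> t\<^sup>m\<close> and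
  \<open>\<epsilon>(t\<^sup>m) = 1\<close>. A homomorphism of group schemes \<open>\<Gamma> \<rightarrow> \<G>\<^sub>m\<close> is a homomorphism of Hopf algebras
  \<open>\<O>(\<G>\<^sub>m) \<rightarrow> \<O>(\<Gamma>)\<close>; compatibility with \<open>\<Delta>\<close> and \<open>\<epsilon>\<close> is stated on the basis \<open>t\<^sup>m\<close>. The product of
  two characters is their convolution, \<open>t\<^sup>m \<mapsto> h(t\<^sup>m) h'(t\<^sup>m)\<close>. Elements of \<open>\<O>(\<Gamma>)\<close> are taken in the
  form of elements of \<open>\<O>(\<Gamma>)\<^sup>\<otimes>\<^sup>1\<close>.\<close>

definition lpow :: "int \<Rightarrow> (int \<Rightarrow>\<^sub>0 'k::field)" where
  "lpow m = Poly_Mapping.single m 1"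

definition hopf_hom_Gm ::
  "('g list \<Rightarrow> 'k::field) set \<Rightarrow> ((int \<Rightarrow>\<^sub>0 'k) \<Rightarrow> ('g, 'k) cochain) \<Rightarrow> bool" where
  "hopf_hom_Gm A h \<longleftrightarrow>
     (\<forall>P. h P \<in> carrier (cochain_ring A 1))
     \<and> h 1 = unit_cochain 1
     \<and> (\<forall>P Q. h (P * Q) = conv (h P) (h Q))
     \<and> (\<forall>P Q ws. h (P + Q) ws = h P ws + h Q ws)
     \<and> (\<forall>c P ws. h (Poly_Mapping.single 0 c * P) ws = c * h P ws)
     \<and> (\<forall>m u v. h (lpow m) [u @ v] = h (lpow m) [u] * h (lpow m) [v])
     \<and> (\<forall>m. h (lpow m) [[]] = 1)"

definition Hom_Gm ::
  "('g list \<Rightarrow> 'k::field) set \<Rightarrow> ((int \<Rightarrow>\<^sub>0 'k) \<Rightarrow> ('g, 'k) cochain) monoid" where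
  "Hom_Gm A = \<lparr>carrier = {h. hopf_hom_Gm A h},
     mult = (\<lambda>h h' P ws. \<Sum>m\<in>Poly_Mapping.keys P.
               Poly_Mapping.lookup P m * conv (h (lpow m)) (h' (lpow m)) ws),
     one = (\<lambda>P ws. \<Sum>m\<in>Poly_Mapping.keys P. Poly_Mapping.lookup P m * unit_cochain 1 ws)\<rparr>"

definition mult_group_of_field :: "'k::field monoid" where
  "mult_group_of_field = \<lparr>carrier = UNIV - {0}, mult = (*), one = 1\<rparr>"

definition group_iso ::
  "('a \<Rightarrow> 'b) \<Rightarrow> ('a, 'c) monoid_scheme \<Rightarrow> ('b, 'd) monoid_scheme \<Rightarrow> bool" where
  "group_iso f G H \<longleftrightarrow> group G \<and> group H \<and> f \<in> iso G H"

end

theory Submission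
  imports Defs
begin

text \<open>All functions on \<open>n\<close>-tuples of words form a commutative algebra under \<^const>\<open>conv\<close> (a shuffle
  algebra), which has divided powers in every characteristic. Its exponential \<open>total_exp\<close> is the
  solution of \<open>\<partial> (total_exp T) = total_exp T \<cdot> \<partial> T\<close>, where \<open>\<partial>\<close> is the derivation that strips a
  first letter. Uniqueness for this equation shows that \<open>total_exp\<close> turns sums into products and
  commutes with all face maps. As \<open>\<partial> (T\<^sup>p) = p T\<^sup>p\<^sup>-\<^sup>1 \<partial> T = 0\<close>, the \<open>p\<close>-th power of an element
  without constant term vanishes, and hence on decomposable tensors with at least two factors
  \<open>total_exp\<close> is the truncated exponential, i.e. it is the map \<open>E\<close>. So \<open>E\<close> intertwines the additive
  with the multiplicative differential. That \<open>E\<close> maps \<open>I\<^sup>\<otimes>\<^sup>n\<close> onto \<open>1 + I\<^sup>\<otimes>\<^sup>n\<close> follows by successive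
  approximation along the filtration of the first tensor factor by word length, which is finite
  because \<open>u(\<gg>)\<close> is spanned by words of bounded length.\<close>

section \<open>Words and tuples of words\<close>

lemma words_induct [case_names Nil Empty Letter]:
  assumes "P []" "\<And>ws. P ws \<Longrightarrow> P ([] # ws)"
    "\<And>x w ws. P (w # ws) \<Longrightarrow> P ((x # w) # ws)"
  shows "P ws"
proof (induction ws)
  case Nil
  show ?case by (rule assms(1))
next
  case (Cons w ws)
  show ?case by (induction w) (use Cons assms in auto)
qed

definition total_length :: "'g list list \<Rightarrow> nat" where
  "total_length ws = sum_list (map length ws)"

lemma words_size_induct [case_names Nil Empty Letter]:
  assumes "P []" "\<And>ws. P ws \<Longrightarrow> P ([] # ws)"
    "\<And>x w ws. (\<And>us. length us = length (w # ws) \<Longrightarrow> total_length us \<le> total_length (w # ws) \<Longrightarrow> P us)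
       \<Longrightarrow> P ((x # w) # ws)"
  shows "P ws"
proof (induction "length ws + total_length ws" arbitrary: ws rule: less_induct)
  case less
  show ?case
  proof (cases ws)
    case (Cons w vs)
    then show ?thesis
      using less by (cases w) (auto simp: total_length_def intro!: assms(2,3))
  qed (simp add: assms(1))
qed

lemma length_splits: "(u, v) \<in> set (splits w) \<Longrightarrow> length u + length v = length w"
  by (induction w arbitrary: u v) force+

lemma length_splits_list:
  assumes "(us, vs) \<in> set (splits_list ws)"
  shows "length us = length ws" "length vs = length ws"
    "total_length us + total_length vs = total_length ws"
  using assms by (induction ws arbitrary: us vs) (force simp: total_length_def dest: length_splits)+

section \<open>The algebra of all functions on tuples of words\<close>

definition fun_scale :: "'k::field \<Rightarrow> ('x \<Rightarrow> 'k) \<Rightarrow> 'x \<Rightarrow> 'k" where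
  "fun_scale c F = (\<lambda>x. c * F x)"

interpretation fun_space: vector_space "fun_scale :: 'k::field \<Rightarrow> ('x \<Rightarrow> 'k) \<Rightarrow> 'x \<Rightarrow> 'k"
  by standard (auto simp: fun_scale_def fun_eq_iff algebra_simps)

lemma fun_scale_apply [simp]: "fun_scale c F x = c * F x"
  by (simp add: fun_scale_def)

lemma sum_fun_apply: "sum f S x = (\<Sum>i\<in>S. f i x)"
  by (induction S rule: infinite_finite_induct) simp_all

definition left_deriv :: "'g \<Rightarrow> ('g, 'k::field) cochain \<Rightarrow> ('g, 'k) cochain" where
  "left_deriv x F ws = (case ws of [] \<Rightarrow> 0 | w # ws \<Rightarrow> F ((x # w) # ws))"

lemma left_deriv_simps [simp]: "left_deriv x F [] = 0" "left_deriv x F (w # ws) = F ((x # w) # ws)"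
  by (simp_all add: left_deriv_def)

lemma counit_at_simps [simp]:
  "counit_at 0 F ws = F ([] # ws)"
  "counit_at i F [] = F [[]]"
  "counit_at (Suc i) F (w # ws) = counit_at i (\<lambda>us. F (w # us)) ws"
  by (simp_all add: counit_at_def)

lemma cochain_eqI:
  fixes F G :: "('g, 'k::field) cochain"
  assumes "F [] = G []" "counit_at 0 F = counit_at 0 G" "\<And>x. left_deriv x F = left_deriv x G"
  shows "F = G"
proof
  fix ws :: "'g list list"
  consider "ws = []" | vs where "ws = [] # vs" | x w vs where "ws = (x # w) # vs"
    by (metis list.exhaust)
  then show "F ws = G ws"
    using assms by cases (metis counit_at_simps(1) left_deriv_simps(2))+
qed

interpretation left_deriv: additive "left_deriv x :: ('g, 'k::field) cochain \<Rightarrow> _" for x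
  by standard (simp add: left_deriv_def fun_eq_iff split: list.split)

interpretation counit_at: additive "counit_at i :: ('g, 'k::field) cochain \<Rightarrow> _" for i
  by standard (simp add: counit_at_def fun_eq_iff)

interpretation conv_left: additive "\<lambda>F :: ('g, 'k::field) cochain. conv F G" for G
  by standard (simp add: conv_def fun_eq_iff case_prod_unfold ring_distribs sum_list_addf)

interpretation conv_right: additive "\<lambda>G :: ('g, 'k::field) cochain. conv F G" for F
  by standard (simp add: conv_def fun_eq_iff case_prod_unfold ring_distribs sum_list_addf)

lemma left_deriv_scale: "left_deriv x (fun_scale c F) = fun_scale c (left_deriv x F)"
  by (simp add: left_deriv_def fun_eq_iff split: list.split)

lemma counit_at_scale: "counit_at i (fun_scale c F) = fun_scale c (counit_at i F)"
  by (simp add: counit_at_def fun_eq_iff)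

lemma conv_scale_left: "conv (fun_scale c F) G = fun_scale c (conv F G)"
  by (simp add: conv_def fun_eq_iff case_prod_unfold sum_list_const_mult mult.assoc)

lemma conv_scale_right: "conv F (fun_scale c G) = fun_scale c (conv F G)"
  by (simp add: conv_def fun_eq_iff case_prod_unfold sum_list_const_mult mult.left_commute)

lemmas [simp] = left_deriv.zero counit_at.zero conv_left.zero conv_right.zero

lemma conv_Nil [simp]: "conv F G [] = F [] * G []"
  by (simp add: conv_def)

lemma conv_Cons:
  fixes F G :: "('g, 'k::field) cochain"
  shows "conv F G (w # ws) = (\<Sum>(u, v)\<leftarrow>splits w. conv (\<lambda>us. F (u # us)) (\<lambda>vs. G (v # vs)) ws)"
proof -
  have "sum_list (concat xss) = (\<Sum>xs\<leftarrow>xss. sum_list xs)" for xss :: "'k list list"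
    by (induction xss) simp_all
  then show ?thesis by (simp add: conv_def map_concat comp_def case_prod_unfold)
qed

lemma conv_Empty [simp]: "conv F G ([] # ws) = conv (counit_at 0 F) (counit_at 0 G) ws"
  by (simp add: conv_Cons) (simp add: counit_at_def[abs_def])

lemma conv_Letter [simp]:
  "conv F G ((x # w) # ws) = conv (left_deriv x F) G (w # ws) + conv F (left_deriv x G) (w # ws)"
  by (simp add: conv_Cons comp_def case_prod_unfold)

lemma left_deriv_conv: "left_deriv x (conv F G) = conv (left_deriv x F) G + conv F (left_deriv x G)"
proof
  fix ws show "left_deriv x (conv F G) ws = (conv (left_deriv x F) G + conv F (left_deriv x G)) ws"
    by (cases ws) simp_all
qed

lemma counit_at_0_conv: "counit_at 0 (conv F G) = conv (counit_at 0 F) (counit_at 0 G)"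
  by (rule ext) simp

lemma counit_at_conv: "counit_at i (conv F G) = conv (counit_at i F) (counit_at i G)"
proof
  fix ws show "counit_at i (conv F G) ws = conv (counit_at i F) (counit_at i G) ws"
  proof (induction i arbitrary: F G ws)
    case (Suc i)
    show ?case
    proof (cases ws)
      case (Cons w vs)
      have "counit_at (Suc i) (conv F G) (w # vs)
          = (\<Sum>(u, v)\<leftarrow>splits w. counit_at i (conv (\<lambda>us. F (u # us)) (\<lambda>us. G (v # us))) vs)"
        by (simp add: counit_at_def conv_Cons)
      also have "\<dots> = conv (counit_at (Suc i) F) (counit_at (Suc i) G) (w # vs)"
        by (simp add: Suc conv_Cons[of "counit_at _ _"])
      finally show ?thesis by (simp add: Cons)
    qed simp
  qed (simp add: counit_at_0_conv)
qed

lemma conv_commute: "conv F G = conv G F"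
proof
  fix ws show "conv F G ws = conv G F ws"
    by (induction ws arbitrary: F G rule: words_induct) (simp_all add: add.commute mult.commute)
qed

lemma conv_assoc: "conv (conv F G) H = conv F (conv G H)"
proof
  fix ws show "conv (conv F G) H ws = conv F (conv G H) ws"
    by (induction ws arbitrary: F G H rule: words_induct)
      (simp_all add: mult.assoc counit_at_0_conv left_deriv_conv conv_left.add conv_right.add)
qed

lemma conv_left_commute: "conv F (conv G H) = conv G (conv F H)"
  by (metis conv_assoc conv_commute)

lemmas conv_ac = conv_assoc conv_commute conv_left_commute

lemma conv_cong:
  assumes "\<And>us. length us = length ws \<Longrightarrow> total_length us \<le> total_length ws \<Longrightarrow> F us = F' us"
    and "\<And>us. length us = length ws \<Longrightarrow> total_length us \<le> total_length ws \<Longrightarrow> G us = G' us"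
  shows "conv F G ws = conv F' G' ws"
  unfolding conv_def
proof (intro arg_cong[where f = sum_list] map_cong refl, clarify)
  fix us vs assume "(us, vs) \<in> set (splits_list ws)"
  then show "F us * G vs = F' us * G' vs"
    using length_splits_list[of us vs ws] assms[of us] assms[of vs] by simp
qed

definition total_unit :: "('g, 'k::field) cochain" where
  "total_unit ws = (if set ws \<subseteq> {[]} then 1 else 0)"

lemma total_unit_Nil [simp]: "total_unit [] = 1"
  by (simp add: total_unit_def)

lemma left_deriv_total_unit [simp]: "left_deriv x total_unit = 0"
  by (simp add: left_deriv_def total_unit_def fun_eq_iff split: list.split)

lemma counit_at_total_unit [simp]: "counit_at i total_unit = total_unit"
proof
  fix ws :: "'a list list"
  have "set ws = set (take i ws) \<union> set (drop i ws)"
    by (metis append_take_drop_id set_append)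
  then show "counit_at i total_unit ws = (total_unit ws :: 'b)"
    by (auto simp: counit_at_def total_unit_def)
qed

lemma conv_total_unit: "conv total_unit F = F"
proof
  fix ws show "conv total_unit F ws = F ws"
    by (induction ws arbitrary: F rule: words_induct) simp_all
qed

definition degree_part :: "nat \<Rightarrow> ('g, 'k::field) cochain \<Rightarrow> ('g, 'k) cochain" where
  "degree_part n F ws = (if length ws = n then F ws else 0)"

interpretation degree_part: additive "degree_part n :: ('g, 'k::field) cochain \<Rightarrow> _" for n
  by standard (simp add: degree_part_def fun_eq_iff)

lemma degree_part_scale: "degree_part n (fun_scale c F) = fun_scale c (degree_part n F)"
  by (simp add: degree_part_def fun_eq_iff)

lemma degree_part_degree_part [simp]: "degree_part n (degree_part n F) = degree_part n F"
  by (simp add: degree_part_def fun_eq_iff)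

lemma degree_part_total_unit: "degree_part n total_unit = unit_cochain n"
  by (auto simp: degree_part_def total_unit_def unit_cochain_def fun_eq_iff replicate_eqI
      subset_iff)

lemma conv_degree_part_left: "conv (degree_part n F) G = degree_part n (conv F G)"
proof
  fix ws :: "'a list list"
  have "conv (degree_part n F) G ws = conv (if length ws = n then F else 0) G ws"
    by (rule conv_cong) (auto simp: degree_part_def)
  then show "conv (degree_part n F) G ws = degree_part n (conv F G) ws"
    by (simp add: degree_part_def)
qed

lemma conv_degree_part_right: "conv F (degree_part n G) = degree_part n (conv F G)"
  by (simp add: conv_commute[of F] conv_degree_part_left)

lemma counit_at_degree_part: "counit_at i (degree_part (Suc n) F) = degree_part n (counit_at i F)"
  by (auto simp: counit_at_def degree_part_def fun_eq_iff min_def)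

lemma left_deriv_degree_part: "left_deriv x (degree_part n F) = degree_part n (left_deriv x F)"
  by (auto simp: left_deriv_def degree_part_def fun_eq_iff split: list.split)

definition homogeneous :: "nat \<Rightarrow> ('g, 'k::field) cochain \<Rightarrow> bool" where
  "homogeneous n F \<longleftrightarrow> degree_part n F = F"

lemma homogeneous_iff: "homogeneous n F \<longleftrightarrow> (\<forall>ws. length ws \<noteq> n \<longrightarrow> F ws = 0)"
  by (auto simp: homogeneous_def degree_part_def fun_eq_iff)

lemma homogeneous_degree_part [simp]: "homogeneous n (degree_part n F)"
  by (simp add: homogeneous_def)

lemma homogeneous_unit [simp]: "homogeneous n (unit_cochain n)"
  by (simp flip: degree_part_total_unit)

lemma conv_unit: "homogeneous n F \<Longrightarrow> conv (unit_cochain n) F = F"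
  by (simp add: homogeneous_def conv_degree_part_left conv_total_unit flip: degree_part_total_unit)

lemma conv_unit_right: "homogeneous n F \<Longrightarrow> conv F (unit_cochain n) = F"
  by (simp add: conv_unit conv_commute[of F])

lemma counit_at_unit: "i < n \<Longrightarrow> counit_at i (unit_cochain n) = unit_cochain (n - 1)"
  by (cases n) (simp_all add: counit_at_degree_part flip: degree_part_total_unit)

section \<open>Powers and the truncated exponential\<close>

primrec conv_power :: "('g, 'k::field) cochain \<Rightarrow> nat \<Rightarrow> ('g, 'k) cochain" where
  "conv_power T 0 = total_unit"
| "conv_power T (Suc j) = conv (conv_power T j) T"

lemma nat_pow_cochain_ring: "T [^]\<^bsub>cochain_ring A n\<^esub> (j::nat) = degree_part n (conv_power T j)"
  by (induction j)
    (simp_all add: cochain_ring_def nat_pow_def conv_degree_part_left degree_part_total_unit)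

lemma counit_at_conv_power: "counit_at i (conv_power T j) = conv_power (counit_at i T) j"
  by (induction j) (simp_all add: counit_at_conv)

lemma left_deriv_conv_power:
  "left_deriv x (conv_power T (Suc j))
      = fun_scale (of_nat (Suc j)) (conv (conv_power T j) (left_deriv x T))"
proof (induction j)
  case 0
  show ?case by (simp add: left_deriv_conv conv_total_unit)
next
  case (Suc j)
  have "left_deriv x (conv_power T (Suc (Suc j)))
      = fun_scale (of_nat (Suc j)) (conv (conv_power T (Suc j)) (left_deriv x T))
        + conv (conv_power T (Suc j)) (left_deriv x T)"
    by (simp only: conv_power.simps(2)[of T "Suc j"] left_deriv_conv Suc conv_scale_left)
      (simp add: conv_ac)
  then show ?case by (simp add: fun_eq_iff ring_distribs)
qed

definition no_constant_term :: "('g, 'k::field) cochain \<Rightarrow> bool" where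
  "no_constant_term T \<longleftrightarrow> (\<forall>n. T (replicate n []) = 0)"

lemma no_constant_term_counit_at_0: "no_constant_term T \<Longrightarrow> no_constant_term (counit_at 0 T)"
  by (simp add: no_constant_term_def flip: replicate_Suc)

theorem conv_power_CHAR:
  fixes T :: "('g, 'k::field) cochain"
  assumes char: "CHAR('k) > 0" and T: "no_constant_term T"
  shows "conv_power T CHAR('k) = 0"
proof
  obtain q where q: "CHAR('k) = Suc q" using char gr0_conv_Suc by blast
  fix ws show "conv_power T CHAR('k) ws = 0 ws"
    using T
  proof (induction ws arbitrary: T rule: words_induct)
    case Nil
    then have "T [] = 0" unfolding no_constant_term_def by (metis replicate_0)
    then show ?case by (simp add: q)
  next
    case (Empty ws)
    have "conv_power T CHAR('k) ([] # ws) = conv_power (counit_at 0 T) CHAR('k) ws"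
      by (simp flip: counit_at_conv_power)
    then show ?case
      using Empty.IH[OF no_constant_term_counit_at_0[OF Empty.prems]] by simp
  next
    case (Letter x w ws)
    have "left_deriv x (conv_power T CHAR('k))
        = fun_scale (of_nat CHAR('k)) (conv (conv_power T q) (left_deriv x T))"
      unfolding q by (rule left_deriv_conv_power)
    then have "left_deriv x (conv_power T CHAR('k)) = 0" by (simp add: fun_eq_iff)
    then show ?case by (metis left_deriv_simps(2) zero_fun_apply)
  qed
qed

definition truncated_exp :: "('g, 'k::field) cochain \<Rightarrow> ('g, 'k) cochain" where
  "truncated_exp T = (\<Sum>j<CHAR('k). fun_scale (1 / of_nat (fact j)) (conv_power T j))"

lemma truncated_exp_zero:
  "CHAR('k) > 0 \<Longrightarrow> truncated_exp (0 :: ('g, 'k::field) cochain) = total_unit"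
  by (cases "CHAR('k)")
    (simp_all add: truncated_exp_def sum.lessThan_Suc_shift del: sum.lessThan_Suc)

lemma counit_at_truncated_exp: "counit_at i (truncated_exp T) = truncated_exp (counit_at i T)"
  by (simp add: truncated_exp_def counit_at.sum counit_at_scale counit_at_conv_power)

lemma inverse_fact_Suc:
  assumes "Suc j < CHAR('k::field)"
  shows "1 / of_nat (fact (Suc j)) * of_nat (Suc j) = (1 / of_nat (fact j) :: 'k)"
proof -
  have "\<not> CHAR('k) dvd Suc j" using assms by (auto dest: dvd_imp_le)
  then have "(of_nat (Suc j) :: 'k) \<noteq> 0"
    by (simp only: of_nat_eq_0_iff_char_dvd not_False_eq_True)
  then show ?thesis by (simp only: fact_Suc of_nat_mult of_nat_id) simp
qed

lemma left_deriv_truncated_exp: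
  fixes T :: "('g, 'k::field) cochain"
  assumes char: "CHAR('k) = Suc q" and top: "conv (conv_power T q) (left_deriv x T) = 0"
  shows "left_deriv x (truncated_exp T) = conv (truncated_exp T) (left_deriv x T)"
proof -
  have "left_deriv x (truncated_exp T)
      = (\<Sum>j<q. fun_scale (1 / of_nat (fact (Suc j))) (left_deriv x (conv_power T (Suc j))))"
    unfolding truncated_exp_def char sum.lessThan_Suc_shift
    by (simp add: left_deriv.add left_deriv.sum left_deriv_scale)
  also have "\<dots> = (\<Sum>j<q. fun_scale (1 / of_nat (fact j)) (conv (conv_power T j) (left_deriv x T)))"
    by (intro sum.cong refl)
      (simp only: left_deriv_conv_power fun_space.scale_scale inverse_fact_Suc char lessThan_iff
          Suc_less_eq)
  also have "\<dots> = conv (truncated_exp T) (left_deriv x T)"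
    by (simp add: truncated_exp_def char conv_left.add conv_left.sum conv_scale_left top)
  finally show ?thesis .
qed

section \<open>The exponential\<close>

function total_exp :: "('g, 'k::field) cochain \<Rightarrow> ('g, 'k) cochain" where
  "total_exp T [] = 1"
| "total_exp T ([] # ws) = total_exp (counit_at 0 T) ws"
| "total_exp T ((x # w) # ws)
     = (\<Sum>(us, vs)\<leftarrow>splits_list (w # ws). total_exp T us * left_deriv x T vs)"
  by pat_completeness auto
termination
proof (relation "measure (\<lambda>(T, ws). length ws + total_length ws)", goal_cases)
  case (3 T x w ws split us vs)
  then show ?case using length_splits_list[of us vs "w # ws"] by (auto simp: total_length_def)
qed (auto simp: total_length_def)

lemma total_exp_Letter: "total_exp T ((x # w) # ws) = conv (total_exp T) (left_deriv x T) (w # ws)"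
  by (simp add: conv_def)

declare total_exp.simps(3) [simp del] total_exp_Letter [simp]

lemma counit_at_0_total_exp: "counit_at 0 (total_exp T) = total_exp (counit_at 0 T)"
  by (rule ext) simp

lemma left_deriv_total_exp: "left_deriv x (total_exp T) = conv (total_exp T) (left_deriv x T)"
proof
  fix ws show "left_deriv x (total_exp T) ws = conv (total_exp T) (left_deriv x T) ws"
    by (cases ws) simp_all
qed

lemma total_exp_coinduct [consumes 1, case_names step]:
  assumes "R F T"
    and step: "\<And>F T. R F T \<Longrightarrow> F [] = 1
      \<and> (R (counit_at 0 F) (counit_at 0 T) \<or> counit_at 0 F = total_exp (counit_at 0 T))
      \<and> (\<forall>x. left_deriv x F = conv F (left_deriv x T))"
  shows "F = total_exp T"
proof
  fix ws show "F ws = total_exp T ws"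
    using \<open>R F T\<close>
  proof (induction ws arbitrary: F T rule: words_size_induct)
    case (Empty ws)
    have "counit_at 0 F ws = total_exp (counit_at 0 T) ws"
      using step[OF Empty.prems] Empty.IH by metis
    then show ?case by simp
  next
    case (Letter x w ws)
    have "F ((x # w) # ws) = conv F (left_deriv x T) (w # ws)"
      using step[OF Letter.prems] by (metis left_deriv_simps(2))
    also have "\<dots> = conv (total_exp T) (left_deriv x T) (w # ws)"
      using Letter by (intro conv_cong) auto
    finally show ?case by simp
  qed (simp add: step)
qed

lemma total_exp_zero: "total_exp 0 = total_unit"
  by (rule sym, rule total_exp_coinduct[where R = "\<lambda>F T. F = total_unit \<and> T = 0"]) auto

lemma total_exp_add: "total_exp (S + T) = conv (total_exp S) (total_exp T)"
proof -
  define R :: "('a, 'b) cochain \<Rightarrow> ('a, 'b) cochain \<Rightarrow> bool"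
    where "R F U \<longleftrightarrow> (\<exists>S T. F = conv (total_exp S) (total_exp T) \<and> U = S + T)" for F U
  have "R (conv (total_exp S) (total_exp T)) (S + T)"
    unfolding R_def by blast
  then show ?thesis
  proof (rule total_exp_coinduct[symmetric])
    fix F U assume "R F U"
    then obtain S T where F: "F = conv (total_exp S) (total_exp T)" and U: "U = S + T"
      unfolding R_def by blast
    have "R (counit_at 0 F) (counit_at 0 U)"
      unfolding R_def F U counit_at_0_conv counit_at_0_total_exp counit_at.add by blast
    moreover have "left_deriv x F = conv F (left_deriv x U)" for x
      by (simp add: F U left_deriv_conv left_deriv_total_exp left_deriv.add conv_right.add conv_ac)
    ultimately show "F [] = 1
        \<and> (R (counit_at 0 F) (counit_at 0 U) \<or> counit_at 0 F = total_exp (counit_at 0 U))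
        \<and> (\<forall>x. left_deriv x F = conv F (left_deriv x U))"
      by (simp add: F)
  qed
qed

lemma total_exp_cong:
  assumes "degree_part n S = degree_part n T"
  shows "degree_part n (total_exp S) = degree_part n (total_exp T)"
proof -
  have "total_exp S ws = total_exp T ws" if "length ws = n" for ws
    using that assms
  proof (induction ws arbitrary: n S T rule: words_size_induct)
    case (Empty ws)
    then have "degree_part (length ws) (counit_at 0 S) = degree_part (length ws) (counit_at 0 T)"
      by (auto simp flip: counit_at_degree_part)
    from Empty.IH[OF refl this] show ?case unfolding total_exp.simps(2) .
  next
    case (Letter x w ws)
    have "left_deriv x S us = left_deriv x T us" if "length us = n" for us
      using Letter.prems(2) that by (metis degree_part_def left_deriv_degree_part)
    moreover have "total_exp S us = total_exp T us"
      if "length us = n" "total_length us \<le> total_length (w # ws)" for us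
      using Letter.IH[OF _ that(2) that(1) Letter.prems(2)] Letter.prems(1) that(1) by simp
    ultimately show ?case
      unfolding total_exp_Letter using Letter.prems(1) by (intro conv_cong) simp_all
  qed simp
  then show ?thesis by (auto simp: degree_part_def fun_eq_iff)
qed

lemma total_exp_eq_unit_imp_zero:
  assumes "degree_part n (total_exp T) = unit_cochain n" "homogeneous n T" "T (replicate n []) = 0"
  shows "T = 0"
  using assms
proof (induction n arbitrary: T)
  case 0
  then have "T ws = 0" for ws by (cases "ws = []") (simp_all add: homogeneous_iff)
  then show ?case by (simp add: fun_eq_iff)
next
  case (Suc n)
  show ?case
  proof (rule cochain_eqI)
    have "counit_at 0 T = 0"
    proof (rule Suc.IH)
      show "degree_part n (total_exp (counit_at 0 T)) = unit_cochain n"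
        using Suc.prems(1) counit_at_unit[of 0 "Suc n"]
        by (simp flip: counit_at_0_total_exp counit_at_degree_part)
      show "homogeneous n (counit_at 0 T)"
        using Suc.prems(2) by (metis homogeneous_def counit_at_degree_part)
    qed (use Suc.prems(3) in simp)
    then show "counit_at 0 T = counit_at 0 0" by simp
    fix x
    have "homogeneous (Suc n) (left_deriv x T)"
      using Suc.prems(2) by (metis homogeneous_def left_deriv_degree_part)
    then have "left_deriv x T = conv (unit_cochain (Suc n)) (left_deriv x T)"
      by (simp add: conv_unit)
    also have "\<dots> = left_deriv x (degree_part (Suc n) (total_exp T))"
      unfolding Suc.prems(1)[symmetric]
      by (simp add: conv_degree_part_left left_deriv_degree_part left_deriv_total_exp)
    also have "\<dots> = 0"
      unfolding Suc.prems(1)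
      by (simp add: left_deriv_degree_part degree_part.zero flip: degree_part_total_unit)
    finally show "left_deriv x T = left_deriv x 0" by simp
  qed (use Suc.prems(2) in \<open>simp add: homogeneous_iff\<close>)
qed

lemma poly_fun_reindex: "q \<in> poly_fun \<Longrightarrow> (\<lambda>T. q (\<lambda>x. T (f x))) \<in> poly_fun"
  by (induction rule: poly_fun.induct) (auto intro: poly_fun.intros)

lemma poly_fun_sum_list:
  "(\<And>x. x \<in> set xs \<Longrightarrow> (\<lambda>T. f x T) \<in> poly_fun) \<Longrightarrow> (\<lambda>T. \<Sum>x\<leftarrow>xs. f x T) \<in> poly_fun"
  by (induction xs) (auto intro: poly_fun.intros)

lemma poly_fun_total_exp: "(\<lambda>T :: ('g, 'k::field) cochain. total_exp T ws) \<in> poly_fun"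
proof (induction ws rule: words_size_induct)
  case (Empty ws)
  show ?case
    using poly_fun_reindex[OF Empty, of "Cons []"] by (simp add: counit_at_def[abs_def])
next
  case (Letter x w ws)
  have "(\<lambda>T :: ('g, 'k) cochain. total_exp T us * left_deriv x T vs) \<in> poly_fun"
    if "(us, vs) \<in> set (splits_list (w # ws))" for us vs
  proof (rule poly_fun.intros(4))
    note split = length_splits_list[OF that]
    show "(\<lambda>T :: ('g, 'k) cochain. total_exp T us) \<in> poly_fun"
      using split by (intro Letter) simp_all
    show "(\<lambda>T :: ('g, 'k) cochain. left_deriv x T vs) \<in> poly_fun"
      using split(2) by (cases vs) (auto intro: poly_fun.intros)
  qed
  then show ?case
    unfolding total_exp.simps(3) by (intro poly_fun_sum_list) (auto simp del: splits_list.simps)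
qed (auto intro: poly_fun.intros)

section \<open>Decomposable tensors\<close>

definition word_unit :: "'g list \<Rightarrow> 'k::field" where
  "word_unit w = (if w = [] then 1 else 0)"

definition word_conv :: "('g list \<Rightarrow> 'k::field) \<Rightarrow> ('g list \<Rightarrow> 'k) \<Rightarrow> 'g list \<Rightarrow> 'k" where
  "word_conv a b w = (\<Sum>(u, v)\<leftarrow>splits w. a u * b v)"

definition tensor_cons :: "('g list \<Rightarrow> 'k::field) \<Rightarrow> ('g, 'k) cochain \<Rightarrow> ('g, 'k) cochain" where
  "tensor_cons a T ws = (case ws of [] \<Rightarrow> 0 | w # ws \<Rightarrow> a w * T ws)"

lemma tensor_cons_simps [simp]: "tensor_cons a T [] = 0" "tensor_cons a T (w # ws) = a w * T ws"
  by (simp_all add: tensor_cons_def)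

interpretation tensor_cons: additive "tensor_cons a :: ('g, 'k::field) cochain \<Rightarrow> _" for a
  by standard (simp add: tensor_cons_def fun_eq_iff distrib_left split: list.split)

lemma tensor_cons_scale: "tensor_cons a (fun_scale c T) = fun_scale c (tensor_cons a T)"
  by (simp add: tensor_cons_def fun_eq_iff split: list.split)

lemma tensor_cons_scale_left: "tensor_cons (fun_scale c a) T = fun_scale c (tensor_cons a T)"
  by (simp add: tensor_cons_def fun_eq_iff split: list.split)

lemma unit_cochain_Suc: "unit_cochain (Suc n) = tensor_cons word_unit (unit_cochain n)"
  by (simp add: unit_cochain_def tensor_cons_def word_unit_def fun_eq_iff split: list.split)

lemma conv_tensor_cons:
  "conv (tensor_cons a S) (tensor_cons b T) = tensor_cons (word_conv a b) (conv S T)"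
proof
  fix ws
  show "conv (tensor_cons a S) (tensor_cons b T) ws = tensor_cons (word_conv a b) (conv S T) ws"
  proof (cases ws)
    case (Cons w vs)
    have "conv (\<lambda>us. a u * S us) (\<lambda>us. b v * T us) vs = a u * b v * conv S T vs" for u v
      using conv_scale_left[of "a u" S "fun_scale (b v) T"] conv_scale_right[of S "b v" T]
      by (simp add: fun_scale_def)
    then show ?thesis
      by (simp add: Cons conv_Cons word_conv_def case_prod_unfold sum_list_mult_const)
  qed simp
qed

lemma conv_power_tensor_cons:
  "\<exists>b. conv_power (tensor_cons a T) (Suc j) = tensor_cons b (conv_power T (Suc j))"
proof (induction j)
  case 0
  show ?case by (auto simp: conv_total_unit)
next
  case (Suc j)
  then show ?case
    by (metis conv_power.simps(2) conv_tensor_cons)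
qed

lemma left_deriv_tensor_cons: "left_deriv x (tensor_cons a T) = tensor_cons (\<lambda>w. a (x # w)) T"
  by (simp add: left_deriv_def tensor_cons_def fun_eq_iff split: list.split)

lemma CHAR_ge_2: "CHAR('k::field) > 0 \<Longrightarrow> CHAR('k) \<ge> 2"
  using CHAR_not_1[where ?'a = 'k] by linarith

theorem total_exp_tensor_cons:
  fixes T :: "('g, 'k::field) cochain"
  assumes char: "CHAR('k) > 0" and a: "a [] = 0" and T: "no_constant_term T"
  shows "total_exp (tensor_cons a T) = truncated_exp (tensor_cons a T)"
proof -
  let ?T = "tensor_cons a T"
  obtain r where r: "CHAR('k) = Suc (Suc r)"
    using CHAR_ge_2[OF char] by (metis add_2_eq_Suc le_Suc_ex)
  obtain b where "conv_power ?T (Suc r) = tensor_cons b (conv_power T (Suc r))"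
    using conv_power_tensor_cons by blast
  moreover have "conv (conv_power T (Suc r)) T = 0"
    using conv_power_CHAR[OF char T] by (simp add: r)
  ultimately have top: "conv (conv_power ?T (Suc r)) (left_deriv x ?T) = 0" for x
    by (simp add: left_deriv_tensor_cons conv_tensor_cons tensor_cons.zero del: conv_power.simps)
  have "counit_at 0 ?T = 0"
    by (simp add: fun_eq_iff a)
  then have counit: "counit_at 0 (truncated_exp ?T) = total_exp (counit_at 0 ?T)"
    by (simp add: counit_at_truncated_exp truncated_exp_zero[OF char] total_exp_zero)
  have "truncated_exp ?T [] = 1"
    by (simp add: truncated_exp_def sum_fun_apply r sum.lessThan_Suc_shift del: sum.lessThan_Suc)
  with counit left_deriv_truncated_exp[OF r top]
  show ?thesis
    by (intro total_exp_coinduct[symmetric, where R = "\<lambda>F U. F = truncated_exp ?T \<and> U = ?T"]) auto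
qed

lemma pure_tensor_Nil: "pure_tensor [] = unit_cochain 0"
  by (simp add: pure_tensor_def unit_cochain_def fun_eq_iff)

lemma pure_tensor_Cons: "pure_tensor (a # as) = tensor_cons a (pure_tensor as)"
  by (simp add: pure_tensor_def tensor_cons_def prod.lessThan_Suc_shift fun_eq_iff
      del: prod.lessThan_Suc split: list.split)

lemma homogeneous_pure_tensor: "homogeneous (length as) (pure_tensor as)"
  by (simp add: homogeneous_iff pure_tensor_def)

lemma no_constant_term_pure_tensor:
  assumes "as \<noteq> []" "\<And>a. a \<in> set as \<Longrightarrow> a [] = 0"
  shows "no_constant_term (pure_tensor as)"
  using assms by (force simp: no_constant_term_def pure_tensor_def)

lemma unit_cochain_eq_pure_tensor: "unit_cochain n = pure_tensor (replicate n word_unit)"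
  by (induction n) (simp_all add: pure_tensor_Nil pure_tensor_Cons unit_cochain_Suc)

lemma scale_pure_tensor: "fun_scale c (pure_tensor (a # as)) = pure_tensor (fun_scale c a # as)"
  by (simp add: pure_tensor_Cons tensor_cons_scale_left)

lemma conv_pure_tensor:
  "length as = length bs \<Longrightarrow>
     conv (pure_tensor as) (pure_tensor bs) = pure_tensor (map2 word_conv as bs)"
  by (induction as bs rule: list_induct2)
    (simp_all add: pure_tensor_Nil pure_tensor_Cons conv_tensor_cons conv_unit)

section \<open>Face maps\<close>

text \<open>For \<open>i > length ws\<close> the value is \<open>F ws\<close>. With this convention \<open>total_face i\<close> is an
  endomorphism of the algebra of all functions.\<close>

fun total_face :: "nat \<Rightarrow> ('g, 'k::field) cochain \<Rightarrow> ('g, 'k) cochain" where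
  "total_face i F [] = F []"
| "total_face 0 F (w # ws) = (if w = [] then F ws else 0)"
| "total_face (Suc 0) F [w] = (if w = [] then F [] else 0)"
| "total_face (Suc 0) F (u # v # ws) = F ((u @ v) # ws)"
| "total_face (Suc (Suc i)) F (w # ws) = total_face (Suc i) (\<lambda>us. F (w # us)) ws"

lemma face_eq_total_face:
  assumes "i \<le> Suc n"
  shows "face i n F = degree_part (Suc n) (total_face i F)"
proof -
  have "face i n F ws = total_face i F ws" if "length ws = Suc n" for ws
    using assms that
  proof (induction i F ws arbitrary: n rule: total_face.induct)
    case (5 i F w ws)
    then obtain m where m: "n = Suc m" by (cases n) auto
    then show ?case
      using 5 by (cases ws) (auto simp: face_def simp flip: "5.IH"[of m])
  qed (auto simp: face_def)
  then show ?thesis by (auto simp: degree_part_def face_def fun_eq_iff)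
qed

interpretation face: additive "face i n :: ('g, 'k::field) cochain \<Rightarrow> _" for i n
  by standard (simp add: face_def fun_eq_iff)

lemma face_scale: "face i n (fun_scale c F) = fun_scale c (face i n F)"
  by (simp add: face_def fun_eq_iff)

lemma homogeneous_face: "homogeneous (Suc n) (face i n F)"
  by (simp add: homogeneous_iff face_def)

lemma face_degree_part: "i \<le> Suc n \<Longrightarrow> face i n (degree_part n F) = face i n F"
  by (auto simp: face_def degree_part_def fun_eq_iff)

lemma total_face_zero [simp]: "total_face i (0 :: ('g, 'k::field) cochain) = 0"
proof
  fix ws show "total_face i (0 :: ('g, 'k) cochain) ws = 0 ws"
    by (induction i "0 :: ('g, 'k) cochain" ws rule: total_face.induct) (simp_all add: zero_fun_def)
qed

lemma total_face_add: "total_face i (F + G) = total_face i F + total_face i G"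
proof
  fix ws show "total_face i (F + G) ws = (total_face i F + total_face i G) ws"
  proof (induction i F ws arbitrary: G rule: total_face.induct)
    case (5 i F w ws)
    then show ?case by (simp add: plus_fun_def)
  qed simp_all
qed

lemma counit_at_0_total_face:
  "counit_at 0 (total_face i F) = (if i \<le> 1 then F else total_face (i - 1) (counit_at 0 F))"
proof
  fix ws
  consider "i = 0" | "i = 1" | j where "i = Suc (Suc j)"
    by (metis One_nat_def old.nat.exhaust)
  then show "counit_at 0 (total_face i F) ws
      = (if i \<le> 1 then F else total_face (i - 1) (counit_at 0 F)) ws"
    by cases (cases ws; simp add: counit_at_def[abs_def])+
qed

lemma left_deriv_total_face:
  "left_deriv x (total_face i F) = (if i = 0 then 0 else total_face i (left_deriv x F))"
proof
  fix ws
  show "left_deriv x (total_face i F) ws = (if i = 0 then 0 else total_face i (left_deriv x F)) ws"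
    by (cases "(i, F, ws)" rule: total_face.cases) auto
qed

lemma total_face_conv: "total_face i (conv F G) = conv (total_face i F) (total_face i G)"
proof
  fix ws show "total_face i (conv F G) ws = conv (total_face i F) (total_face i G) ws"
  proof (induction ws arbitrary: i F G rule: words_induct)
    case (Empty ws)
    then have "counit_at 0 (total_face i (conv F G)) ws
        = conv (counit_at 0 (total_face i F)) (counit_at 0 (total_face i G)) ws"
      by (simp add: counit_at_0_total_face counit_at_0_conv del: counit_at_simps)
    then show ?case by simp
  next
    case (Letter x w ws)
    have "left_deriv x (total_face i (conv F G)) (w # ws)
        = left_deriv x (conv (total_face i F) (total_face i G)) (w # ws)"
      by (simp add: left_deriv_total_face left_deriv_conv total_face_add Letter
          del: left_deriv_simps conv_Letter)
    then show ?case by simp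
  qed simp
qed

lemma total_face_total_face:
  "i < j \<Longrightarrow> total_face j (total_face i F) = total_face i (total_face (j - 1) F)"
proof
  fix ws show "i < j \<Longrightarrow> total_face j (total_face i F) ws = total_face i (total_face (j - 1) F) ws"
  proof (induction ws arbitrary: i j F rule: words_induct)
    case (Empty ws)
    note IH = Empty.IH[of "i - 1" "j - 1" "counit_at 0 F"]
    have "counit_at 0 (total_face j (total_face i F)) ws
        = counit_at 0 (total_face i (total_face (j - 1) F)) ws"
      unfolding counit_at_0_total_face using Empty.prems IH
      by (auto simp: le_Suc_eq simp del: counit_at_simps)
    then show ?case by simp
  next
    case (Letter x w ws)
    have "left_deriv x (total_face j (total_face i F)) (w # ws)
        = left_deriv x (total_face i (total_face (j - 1) F)) (w # ws)"
      unfolding left_deriv_total_face using Letter.prems Letter.IH[of i j "left_deriv x F"] by simp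
    then show ?case by simp
  qed simp
qed

theorem total_exp_total_face: "total_exp (total_face i T) = total_face i (total_exp T)"
proof -
  define R :: "('a, 'b) cochain \<Rightarrow> ('a, 'b) cochain \<Rightarrow> bool"
    where "R F U \<longleftrightarrow> (\<exists>i T. F = total_face i (total_exp T) \<and> U = total_face i T)" for F U
  have "R (total_face i (total_exp T)) (total_face i T)"
    unfolding R_def by blast
  then show ?thesis
  proof (rule total_exp_coinduct[symmetric])
    fix F U assume "R F U"
    then obtain i T where F: "F = total_face i (total_exp T)" and U: "U = total_face i T"
      unfolding R_def by blast
    have "R (counit_at 0 F) (counit_at 0 U) \<or> counit_at 0 F = total_exp (counit_at 0 U)"
      unfolding R_def F U counit_at_0_total_face counit_at_0_total_exp by auto
    moreover have "left_deriv x F = conv F (left_deriv x U)" for x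
      by (simp add: F U left_deriv_total_face left_deriv_total_exp total_face_conv)
    ultimately show "F [] = 1
        \<and> (R (counit_at 0 F) (counit_at 0 U) \<or> counit_at 0 F = total_exp (counit_at 0 U))
        \<and> (\<forall>x. left_deriv x F = conv F (left_deriv x U))"
      by (simp add: F)
  qed
qed

lemma face_conv: "i \<le> Suc n \<Longrightarrow> face i n (conv F G) = conv (face i n F) (face i n G)"
  by (simp add: face_eq_total_face total_face_conv conv_degree_part_left conv_degree_part_right)

lemma face_face:
  assumes "i < j" "j \<le> Suc (Suc n)"
  shows "face j (Suc n) (face i n F) = face i (Suc n) (face (j - 1) n F)"
  using assms by (simp add: face_eq_total_face[of _ n] face_degree_part)
    (simp add: face_eq_total_face total_face_total_face)

lemma total_exp_face: "i \<le> Suc n \<Longrightarrow>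
    degree_part (Suc n) (total_exp (face i n T)) = face i n (total_exp T)"
  using total_exp_cong[of "Suc n" "face i n T" "total_face i T"]
  by (simp add: face_eq_total_face total_exp_total_face)

section \<open>The exponential in a fixed degree\<close>

definition cochain_exp :: "nat \<Rightarrow> ('g, 'k::field) cochain \<Rightarrow> ('g, 'k) cochain" where
  "cochain_exp n T = degree_part n (total_exp T)"

lemma cochain_exp_add: "cochain_exp n (S + T) = conv (cochain_exp n S) (cochain_exp n T)"
  by (simp add: cochain_exp_def total_exp_add conv_degree_part_left conv_degree_part_right)

lemma cochain_exp_zero: "cochain_exp n 0 = unit_cochain n"
  by (simp add: cochain_exp_def total_exp_zero degree_part_total_unit)

lemma cochain_exp_uminus: "conv (cochain_exp n T) (cochain_exp n (- T)) = unit_cochain n"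
  by (simp add: cochain_exp_zero flip: cochain_exp_add)

lemma face_cochain_exp: "i \<le> Suc n \<Longrightarrow> face i n (cochain_exp n T) = cochain_exp (Suc n) (face i n T)"
  by (simp add: cochain_exp_def face_degree_part total_exp_face)

lemma face_unit: "i \<le> Suc n \<Longrightarrow> face i n (unit_cochain n) = unit_cochain (Suc n)"
  using face_cochain_exp[of i n 0] by (simp add: cochain_exp_zero face.zero)

lemma cochain_exp_pure_tensor:
  fixes as :: "('g list \<Rightarrow> 'k::field) list"
  assumes char: "CHAR('k) > 0" and "length as \<ge> 2" and as: "\<And>a. a \<in> set as \<Longrightarrow> a [] = 0"
  shows "cochain_exp (length as) (pure_tensor as)
      = degree_part (length as) (truncated_exp (pure_tensor as))"
proof -
  obtain a bs where "as = a # bs" "bs \<noteq> []"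
    using \<open>length as \<ge> 2\<close> by (cases as; cases "tl as") auto
  then show ?thesis
    using as total_exp_tensor_cons[OF char, of a "pure_tensor bs"]
      no_constant_term_pure_tensor[of bs]
    by (simp add: cochain_exp_def pure_tensor_Cons)
qed

section \<open>The additive differential\<close>

lemma d_add_eq_sum: "d_add n F = (\<Sum>i\<le>Suc n. fun_scale ((- 1) ^ i) (face i n F))"
  by (simp add: d_add_def sum_fun_apply fun_eq_iff del: sum.atMost_Suc)

interpretation d_add: additive "d_add n :: ('g, 'k::field) cochain \<Rightarrow> _" for n
  by standard
    (simp add: d_add_eq_sum face.add fun_space.scale_right_distrib sum.distrib del: sum.atMost_Suc)

lemma alternating_sum_cancel:
  fixes f :: "nat \<Rightarrow> nat \<Rightarrow> 'a::comm_ring_1"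
  assumes f: "\<And>i j. i < j \<Longrightarrow> j \<le> Suc N \<Longrightarrow> f j i = f i (j - 1)"
  shows "(\<Sum>j\<le>Suc N. (- 1) ^ j * (\<Sum>i\<le>N. (- 1) ^ i * f j i)) = 0"
proof -
  define g where "g = (\<lambda>(j, i). (- 1) ^ (j + i) * f j i)"
  define L where "L = {(j, i). i < j \<and> j \<le> Suc N}"
  define U where "U = {(j, i). j \<le> i \<and> i \<le> N}"
  have fin: "finite L" "finite U"
    by (rule finite_subset[of _ "{..Suc N} \<times> {..Suc N}"]; auto simp: L_def U_def)+
  have "(\<Sum>j\<le>Suc N. (- 1) ^ j * (\<Sum>i\<le>N. (- 1) ^ i * f j i)) = sum g ({..Suc N} \<times> {..N})"
    unfolding sum.cartesian_product[symmetric] sum_distrib_left g_def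
    by (simp add: power_add mult.assoc del: sum.atMost_Suc)
  also have "{..Suc N} \<times> {..N} = L \<union> U" by (auto simp: L_def U_def)
  also have "sum g (L \<union> U) = sum g L + sum g U"
    using fin by (rule sum.union_disjoint) (auto simp: L_def U_def)
  also have "sum g L = (\<Sum>x\<in>U. - g x)"
  proof (rule sum.reindex_bij_witness[of _ "\<lambda>(j, i). (Suc i, j)" "\<lambda>(j, i). (i, j - 1)"])
    fix x assume "x \<in> L"
    then obtain j i where x: "x = (Suc j, i)" "i \<le> j" "j \<le> N"
      by (cases x; cases "fst x") (auto simp: L_def)
    then show "- g (case x of (j, i) \<Rightarrow> (i, j - 1)) = g x"
      using f[of i "Suc j"] by (simp add: g_def add.commute)
  qed (auto simp: L_def U_def)
  finally show ?thesis by (simp add: sum_negf)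
qed

theorem d_add_d_add: "d_add (Suc n) (d_add n F) = 0"
proof
  fix ws :: "'a list list"
  have "d_add (Suc n) (d_add n F)
      = (\<Sum>j\<le>Suc (Suc n). fun_scale ((- 1) ^ j)
          (\<Sum>i\<le>Suc n. fun_scale ((- 1) ^ i) (face j (Suc n) (face i n F))))"
    unfolding d_add_eq_sum face.sum face_scale ..
  then have "d_add (Suc n) (d_add n F) ws = (\<Sum>j\<le>Suc (Suc n). (- 1) ^ j
      * (\<Sum>i\<le>Suc n. (- 1) ^ i * face j (Suc n) (face i n F) ws))"
    by (simp only: sum_fun_apply fun_scale_apply)
  also have "\<dots> = 0"
    by (rule alternating_sum_cancel) (simp add: face_face)
  finally show "d_add (Suc n) (d_add n F) ws = 0 ws" by simp
qed

definition normalized :: "('g, 'k::field) cochain \<Rightarrow> bool" where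
  "normalized F \<longleftrightarrow> (\<forall>ws. [] \<in> set ws \<longrightarrow> F ws = 0)"

lemma total_face_normalized:
  assumes "normalized F" "j \<le> Suc (length us + length vs)"
  shows "total_face j F (us @ [] # vs)
      = (if j \<in> {length us, Suc (length us)} then F (us @ vs) else 0)"
  using assms
proof (induction us arbitrary: j F)
  case Nil
  have "(\<lambda>us. F ([] # us)) = 0"
    using Nil.prems(1) by (auto simp: normalized_def)
  then show ?case
    by (cases "(j, F, [] # vs)" rule: total_face.cases) auto
next
  case (Cons w us)
  have F: "F ws = 0" if "[] \<in> set ws" for ws
    using Cons.prems(1) that by (simp add: normalized_def)
  have "normalized (\<lambda>vs. F (w # vs))"
    using Cons.prems(1) by (simp add: normalized_def)
  consider (zero) "j = 0" | (one) "j = 1" | (inner) i where "j = Suc (Suc i)"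
    by (metis One_nat_def old.nat.exhaust)
  then show ?case
  proof cases
    case one
    then show ?thesis by (cases us) (simp_all add: F)
  next
    case inner
    then show ?thesis
      using Cons.IH[OF \<open>normalized (\<lambda>vs. F (w # vs))\<close>, of "Suc i"] Cons.prems(2) by simp
  qed (simp add: F)
qed

lemma normalized_d_add:
  assumes "normalized F"
  shows "normalized (d_add n F)"
  unfolding normalized_def
proof (intro allI impI)
  fix ws :: "'a list list" assume "[] \<in> set ws"
  then obtain us vs where ws: "ws = us @ [] # vs" by (meson split_list)
  show "d_add n F ws = 0"
  proof (cases "length ws = Suc n")
    case True
    have "d_add n F ws
        = (\<Sum>i\<le>Suc n. if i \<in> {length us, Suc (length us)} then (- 1) ^ i * F (us @ vs) else 0)"
      unfolding d_add_def using True total_face_normalized[OF assms, of _ us vs]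
      by (intro sum.cong) (auto simp: face_eq_total_face degree_part_def ws)
    also have "\<dots> = (\<Sum>i\<in>{length us, Suc (length us)}. (- 1) ^ i * F (us @ vs))"
      using True by (intro sum.mono_neutral_cong_right) (auto simp: ws)
    finally show ?thesis by simp
  qed (simp add: d_add_def face_def)
qed

section \<open>Linear functionals on monoid algebras\<close>

lemma poly_mapping_induct [case_names zero add single]:
  fixes P :: "'a \<Rightarrow>\<^sub>0 'b::comm_monoid_add"
  assumes "Q 0" "\<And>a b. Q a \<Longrightarrow> Q b \<Longrightarrow> Q (a + b)" "\<And>m c. Q (Poly_Mapping.single m c)"
  shows "Q P"
proof -
  have "Q (\<Sum>m\<in>S. Poly_Mapping.single m (Poly_Mapping.lookup P m))" for S
    by (induction S rule: infinite_finite_induct) (use assms in auto)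
  moreover have "(\<Sum>m\<in>Poly_Mapping.keys P. Poly_Mapping.single m (Poly_Mapping.lookup P m)) = P"
    by (rule poly_mapping_eqI) (simp add: lookup_sum lookup_single when_def in_keys_iff)
  ultimately show ?thesis by metis
qed

definition linear_extension :: "('a \<Rightarrow> 'k::field) \<Rightarrow> ('a \<Rightarrow>\<^sub>0 'k) \<Rightarrow> 'k" where
  "linear_extension f P = (\<Sum>m\<in>Poly_Mapping.keys P. Poly_Mapping.lookup P m * f m)"

lemma linear_extension_superset:
  assumes "finite S" "Poly_Mapping.keys P \<subseteq> S"
  shows "linear_extension f P = (\<Sum>m\<in>S. Poly_Mapping.lookup P m * f m)"
  unfolding linear_extension_def
  by (rule sum.mono_neutral_left) (use assms in \<open>auto simp: in_keys_iff\<close>)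

interpretation linear_extension: additive "linear_extension f :: _ \<Rightarrow> 'k::field" for f
proof
  fix P Q :: "'a \<Rightarrow>\<^sub>0 'k"
  let ?S = "Poly_Mapping.keys P \<union> Poly_Mapping.keys Q"
  have "linear_extension f (P + Q) = (\<Sum>m\<in>?S. Poly_Mapping.lookup (P + Q) m * f m)"
    by (rule linear_extension_superset) (use Poly_Mapping.keys_add[of P Q] in auto)
  also have "\<dots> = linear_extension f P + linear_extension f Q"
    by (simp add: linear_extension_superset[of ?S] lookup_add ring_distribs sum.distrib)
  finally show "linear_extension f (P + Q) = linear_extension f P + linear_extension f Q" .
qed

lemma linear_extension_single [simp]: "linear_extension f (Poly_Mapping.single m c) = c * f m"
  using linear_extension_superset[of "{m}" "Poly_Mapping.single m c" f] by simp

lemma linear_extension_add_fun: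
  "linear_extension (\<lambda>m. f m + g m) P = linear_extension f P + linear_extension g P"
  by (simp add: linear_extension_def distrib_left sum.distrib)

lemma linear_extension_scale_fun: "linear_extension (\<lambda>m. c * f m) P = c * linear_extension f P"
  by (simp add: linear_extension_def sum_distrib_left mult.left_commute)

lemma linear_extension_single_mult:
  "linear_extension f (Poly_Mapping.single m c * P) = c * linear_extension (\<lambda>l. f (m + l)) P"
  by (induction P rule: poly_mapping_induct)
    (simp_all add: distrib_left mult_single linear_extension.add linear_extension.zero)

lemma linear_extension_mult_single:
  "linear_extension f (P * Poly_Mapping.single m c) = c * linear_extension (\<lambda>l. f (l + m)) P"
  by (induction P rule: poly_mapping_induct)
    (simp_all add: ring_distribs mult_single linear_extension.add linear_extension.zero)

section \<open>The coordinate ring\<close>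

definition word_extension :: "('g list \<Rightarrow> 'k::field) \<Rightarrow> ('g, 'k) free_alg \<Rightarrow> 'k" where
  "word_extension a = linear_extension (\<lambda>m. a (letters m))"

interpretation word_extension: additive "word_extension a :: _ \<Rightarrow> 'k::field" for a
  by standard (simp add: word_extension_def linear_extension.add)

lemma word_extension_add_fun:
  "word_extension (\<lambda>w. a w + b w) P = word_extension a P + word_extension b P"
  by (simp add: word_extension_def linear_extension_add_fun)

lemma word_extension_scale_fun: "word_extension (\<lambda>w. c * a w) P = c * word_extension a P"
  by (simp add: word_extension_def linear_extension_scale_fun)

lemma word_extension_single_mult:
  "word_extension a (Poly_Mapping.single m c * P) = c * word_extension (\<lambda>w. a (letters m @ w)) P"
  by (simp add: word_extension_def linear_extension_single_mult plus_fmon_def)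

lemma word_extension_mult_single:
  "word_extension a (P * Poly_Mapping.single m c) = c * word_extension (\<lambda>w. a (w @ letters m)) P"
  by (simp add: word_extension_def linear_extension_mult_single plus_fmon_def)

lemma word_extension_word_elem: "word_extension a (word_elem w) = a w"
  by (simp add: word_elem_def word_extension_def)

lemma word_extension_scalar_mult: "word_extension a (scalar c * P) = c * word_extension a P"
  by (simp add: scalar_def word_extension_single_mult zero_fmon_def)

lemma word_elem_mult: "word_elem u * word_elem v = word_elem (u @ v)"
  by (simp add: word_elem_def mult_single plus_fmon_def)

lemma gen_power: "gen x ^ m = word_elem (replicate m x)"
proof (induction m)
  case 0
  show ?case by (simp add: word_elem_def flip: zero_fmon_def)
qed (simp add: word_elem_mult)

lemmas word_extension_simps = word_extension.add word_extension.diff word_extension_word_elem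
  word_extension_scalar_mult word_elem_mult gen_power

text \<open>This says that \<open>a\<close>, extended linearly to the free algebra, vanishes on the two-sided ideal
  generated by \<open>S\<close>.\<close>

definition annihilates :: "('g list \<Rightarrow> 'k::field) \<Rightarrow> ('g, 'k) free_alg set \<Rightarrow> bool" where
  "annihilates a S \<longleftrightarrow> (\<forall>s\<in>S. \<forall>u v. word_extension (\<lambda>w. a (u @ w @ v)) s = 0)"

lemma annihilatesD:
  "annihilates a S \<Longrightarrow> s \<in> S \<Longrightarrow> word_extension (\<lambda>w. a (u @ w @ v)) s = 0"
  by (simp add: annihilates_def)

lemma annihilates_two_sided_ideal:
  assumes a: "annihilates a S" and "P \<in> two_sided_ideal S"
  shows "word_extension a P = 0"
  using assms(2)
proof induction
  case (gens s P Q)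
  have right: "word_extension (\<lambda>w. a (u @ w)) (s * Q) = 0" for u
    by (induction Q rule: poly_mapping_induct)
      (use a gens in \<open>simp_all add: distrib_left word_extension.add word_extension.zero
        word_extension_mult_single annihilates_def\<close>)
  have "word_extension a (P * (s * Q)) = 0"
    by (induction P rule: poly_mapping_induct)
      (simp_all add: distrib_right word_extension.add word_extension.zero
        word_extension_single_mult right)
  then show ?case by (simp add: mult.assoc)
qed (simp_all add: word_extension.add word_extension.zero)

lemma two_sided_ideal_uminus: "a \<in> two_sided_ideal S \<Longrightarrow> - a \<in> two_sided_ideal S"
proof (induction rule: two_sided_ideal.induct)
  case (gens s a b)
  then show ?case using two_sided_ideal.gens[of s S "- a" b] by simp
next
  case (add a b)
  then show ?case using two_sided_ideal.add[of "- a" S "- b"] by simp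
qed (simp add: two_sided_ideal.zero)

lemma u_class_ideal_eq:
  assumes "P \<in> two_sided_ideal (u_relations scale br pmap)"
  shows "u_class scale br pmap P = u_class scale br pmap 0"
proof -
  let ?J = "two_sided_ideal (u_relations scale br pmap)"
  have "Q - P \<in> ?J \<longleftrightarrow> Q \<in> ?J" for Q
    using two_sided_ideal.add[OF _ assms, of "Q - P"]
      two_sided_ideal.add[OF _ two_sided_ideal_uminus[OF assms], of Q] by auto
  then show ?thesis by (simp add: u_class_def)
qed

lemma annihilates_if_coord_ring:
  assumes "a \<in> coord_ring scale br pmap"
  shows "annihilates a (u_relations scale br pmap)"
proof -
  obtain f where f: "f \<in> u_dual scale br pmap"
    and a: "a = (\<lambda>w. f (u_class scale br pmap (word_elem w)))"
    using assms by (auto simp: coord_ring_def)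
  define g where "g P = f (u_class scale br pmap P)" for P
  have g_add: "g (P + Q) = g P + g Q" and g_scalar: "g (scalar c * P) = c * g P" for P Q c
    using f by (simp_all add: g_def u_dual_def)
  have g_zero: "g 0 = 0" using g_scalar[of 0 0] by simp
  have g: "g P = word_extension a P" for P
  proof (induction P rule: poly_mapping_induct)
    case (single m c)
    have "Poly_Mapping.single m c = scalar c * word_elem (letters m)"
      by (simp add: word_elem_def scalar_def mult_single)
    then show ?case
      by (simp add: g_scalar word_extension_scalar_mult word_extension_word_elem)
        (simp add: g_def a)
  qed (simp_all add: g_zero g_add word_extension.add word_extension.zero)
  have "g (word_elem u * s * word_elem v) = 0" if "s \<in> u_relations scale br pmap" for u v s
    using u_class_ideal_eq[OF two_sided_ideal.gens[OF that]] g_zero by (simp add: g_def)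
  then show ?thesis
    by (simp add: annihilates_def g mult.assoc)
      (simp add: word_elem_def word_extension_single_mult word_extension_mult_single)
qed

lemma coord_ring_if_annihilates:
  assumes "annihilates a (u_relations scale br pmap)"
  shows "a \<in> coord_ring scale br pmap"
proof -
  let ?cl = "u_class scale br pmap"
  define f where "f C = word_extension a (SOME P. P \<in> C)" for C
  have f: "f (?cl P) = word_extension a P" for P
  proof -
    have "P \<in> ?cl P" by (simp add: u_class_def two_sided_ideal.zero)
    then have "(SOME Q. Q \<in> ?cl P) \<in> ?cl P" by (rule someI)
    then have "(SOME Q. Q \<in> ?cl P) - P \<in> two_sided_ideal (u_relations scale br pmap)"
      by (subst (asm) (2) u_class_def) (rule CollectD)
    with assms have "word_extension a ((SOME Q. Q \<in> ?cl P) - P) = 0"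
      by (rule annihilates_two_sided_ideal)
    then show ?thesis by (simp add: f_def word_extension.diff)
  qed
  have "f \<in> u_dual scale br pmap"
    by (simp add: u_dual_def f word_extension.add word_extension_scalar_mult)
  moreover have "a = (\<lambda>w. f (?cl (word_elem w)))"
    by (simp add: f word_extension_word_elem)
  ultimately show ?thesis by (auto simp: coord_ring_def)
qed

lemma coord_ring_iff: "a \<in> coord_ring scale br pmap \<longleftrightarrow> annihilates a (u_relations scale br pmap)"
  using annihilates_if_coord_ring coord_ring_if_annihilates by blast

lemma u_relations_cases [consumes 1, case_names additive homogeneous commutator p_power]:
  fixes scale :: "'k::field \<Rightarrow> 'g::ab_group_add \<Rightarrow> 'g"
  assumes "s \<in> u_relations scale br pmap"
  obtains x y where "s = gen (x + y) - gen x - gen y"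
    | c x where "s = gen (scale c x) - scalar c * gen x"
    | x y where "s = gen x * gen y - gen y * gen x - gen (br x y)"
    | x where "s = gen x ^ CHAR('k) - gen (pmap x)"
  using assms unfolding u_relations_def by blast

lemma
  fixes scale :: "'k::field \<Rightarrow> 'g::ab_group_add \<Rightarrow> 'g"
  assumes "a \<in> coord_ring scale br pmap"
  shows coord_ring_additive: "a (u @ [x + y] @ v) = a (u @ [x] @ v) + a (u @ [y] @ v)"
    and coord_ring_homogeneous: "a (u @ [scale c x] @ v) = c * a (u @ [x] @ v)"
    and coord_ring_commutator: "a (u @ [x, y] @ v) = a (u @ [y, x] @ v) + a (u @ [br x y] @ v)"
    and coord_ring_p_power: "a (u @ replicate CHAR('k) x @ v) = a (u @ [pmap x] @ v)"
proof -
  have relation: "word_extension (\<lambda>w. a (u @ w @ v)) s = 0" if "s \<in> u_relations scale br pmap" for s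
    using assms that by (simp add: coord_ring_iff annihilatesD)
  have "gen (x + y) - gen x - gen y \<in> u_relations scale br pmap"
    "gen (scale c x) - scalar c * gen x \<in> u_relations scale br pmap"
    "gen x * gen y - gen y * gen x - gen (br x y) \<in> u_relations scale br pmap"
    "gen x ^ CHAR('k) - gen (pmap x) \<in> u_relations scale br pmap"
    by (auto simp: u_relations_def)
  from this[THEN relation]
  show "a (u @ [x + y] @ v) = a (u @ [x] @ v) + a (u @ [y] @ v)"
    "a (u @ [scale c x] @ v) = c * a (u @ [x] @ v)"
    "a (u @ [x, y] @ v) = a (u @ [y, x] @ v) + a (u @ [br x y] @ v)"
    "a (u @ replicate CHAR('k) x @ v) = a (u @ [pmap x] @ v)"
    by (simp_all add: word_extension_simps algebra_simps)
qed

section \<open>The coordinate ring is closed under multiplication\<close>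

lemma word_conv_Cons:
  "word_conv a b (x # w) = word_conv (\<lambda>w. a (x # w)) b w + word_conv a (\<lambda>w. b (x # w)) w"
  by (simp add: word_conv_def comp_def case_prod_unfold)

lemma word_conv_Nil [simp]: "word_conv a b [] = a [] * b []"
  by (simp add: word_conv_def)

lemma word_conv_snoc:
  "word_conv a b (w @ [x]) = word_conv (\<lambda>w. a (w @ [x])) b w + word_conv a (\<lambda>w. b (w @ [x])) w"
  by (induction w arbitrary: a b) (simp_all add: word_conv_Cons)

lemma word_conv_replicate:
  "word_conv a b (replicate m x)
     = (\<Sum>i\<le>m. of_nat (m choose i) * a (replicate i x) * b (replicate (m - i) x))"
proof (induction m arbitrary: a b)
  case (Suc m)
  define A where "A i = a (replicate i x)" for i
  define B where "B i = b (replicate i x)" for i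
  have "word_conv a b (replicate (Suc m) x)
      = (\<Sum>i\<le>m. of_nat (m choose i) * A (Suc i) * B (m - i))
        + (\<Sum>i\<le>m. of_nat (m choose i) * A i * B (Suc (m - i)))"
    by (simp add: word_conv_Cons Suc A_def B_def)
  also have "(\<Sum>i\<le>m. of_nat (m choose i) * A i * B (Suc (m - i)))
      = (\<Sum>i\<le>Suc m. of_nat (m choose i) * A i * B (Suc m - i))"
    by (simp add: Suc_diff_le binomial_eq_0)
  also have "\<dots> = A 0 * B (Suc m) + (\<Sum>i\<le>m. of_nat (m choose Suc i) * A (Suc i) * B (m - i))"
    by (subst sum.atMost_Suc_shift) simp
  also have "(\<Sum>i\<le>m. of_nat (m choose i) * A (Suc i) * B (m - i)) + \<dots>
      = A 0 * B (Suc m) + (\<Sum>i\<le>m. of_nat (Suc m choose Suc i) * A (Suc i) * B (m - i))"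
    by (simp add: sum.distrib ring_distribs)
  also have "\<dots> = (\<Sum>i\<le>Suc m. of_nat (Suc m choose i) * A i * B (Suc m - i))"
    by (subst sum.atMost_Suc_shift) simp
  finally show ?case unfolding A_def B_def .
qed simp

lemma word_conv_replicate_CHAR:
  fixes a b :: "'g list \<Rightarrow> 'k::field"
  assumes "CHAR('k) > 0"
  shows "word_conv a b (replicate CHAR('k) x)
    = a (replicate CHAR('k) x) * b [] + a [] * b (replicate CHAR('k) x)"
proof -
  let ?p = "CHAR('k)"
  define c where "c i = of_nat (?p choose i) * a (replicate i x) * b (replicate (?p - i) x)" for i
  have "Factorial_Ring.prime ?p" using assms by (rule prime_CHAR_semidom)
  then have "of_nat (?p choose i) = (0 :: 'k)" if "0 < i" "i < ?p" for i
    using that dvd_choose_prime[of i ?p] by (simp add: of_nat_eq_0_iff_char_dvd)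
  then have "sum c {..?p} = sum c {0, ?p}"
    by (intro sum.mono_neutral_right) (auto simp: c_def)
  then show ?thesis
    using assms by (simp add: word_conv_replicate c_def)
qed

text \<open>The defining relations of \<open>u(\<gg>)\<close> are primitive, so that the ideal they generate is a coideal.\<close>

lemma word_extension_word_conv_relation:
  fixes scale :: "'k::field \<Rightarrow> 'g::ab_group_add \<Rightarrow> 'g"
  assumes "CHAR('k) > 0" "s \<in> u_relations scale br pmap"
  shows "word_extension (word_conv a b) s = word_extension a s * b [] + a [] * word_extension b s"
  using assms(2)
  by (cases rule: u_relations_cases; hypsubst)
    (simp_all add: word_extension_simps word_conv_Cons word_conv_replicate_CHAR[OF assms(1)]
      algebra_simps)

lemma annihilates_translate:
  assumes "annihilates a S"
  shows "annihilates (\<lambda>w. a (u @ w @ v)) S"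
  unfolding annihilates_def
proof (intro ballI allI)
  fix s u' v' assume "s \<in> S"
  with assms have "word_extension (\<lambda>w. a ((u @ u') @ w @ (v' @ v))) s = 0"
    by (rule annihilatesD)
  then show "word_extension (\<lambda>w. a (u @ (u' @ w @ v') @ v)) s = 0" by simp
qed

lemma annihilates_add: "annihilates a S \<Longrightarrow> annihilates b S \<Longrightarrow> annihilates (a + b) S"
  by (simp add: annihilates_def word_extension_add_fun)

lemma annihilates_scale: "annihilates a S \<Longrightarrow> annihilates (fun_scale c a) S"
  by (simp add: annihilates_def word_extension_scale_fun)

lemma annihilates_word_unit:
  fixes scale :: "'k::field \<Rightarrow> 'g::ab_group_add \<Rightarrow> 'g"
  assumes "CHAR('k) > 0"
  shows "annihilates word_unit (u_relations scale br pmap)"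
  unfolding annihilates_def
proof (intro ballI allI)
  fix s u v assume "s \<in> u_relations scale br pmap"
  then show "word_extension (\<lambda>w. word_unit (u @ w @ v)) s = 0"
    by (cases rule: u_relations_cases)
      (use assms in \<open>simp_all add: word_extension_simps word_unit_def\<close>)
qed

lemma annihilates_word_conv:
  fixes scale :: "'k::field \<Rightarrow> 'g::ab_group_add \<Rightarrow> 'g"
  assumes char: "CHAR('k) > 0"
    and a: "annihilates a (u_relations scale br pmap)"
    and b: "annihilates b (u_relations scale br pmap)"
  shows "annihilates (word_conv a b) (u_relations scale br pmap)"
proof -
  let ?S = "u_relations scale br pmap"
  have "word_extension (\<lambda>w. word_conv a b (u @ w @ v)) s = 0" if s: "s \<in> ?S" for s u v
    using a b
  proof (induction u arbitrary: a b)
    case Nil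
    then show ?case
    proof (induction v arbitrary: a b rule: rev_induct)
      case Nil
      then have "word_extension a s = 0" "word_extension b s = 0"
        using annihilatesD[OF _ s, of _ "[]" "[]"] by simp_all
      then show ?case by (simp add: word_extension_word_conv_relation[OF char s])
    next
      case (snoc x v)
      then have "annihilates (\<lambda>w. a (w @ [x])) ?S" "annihilates (\<lambda>w. b (w @ [x])) ?S"
        using annihilates_translate[of _ ?S "[]" "[x]"] by simp_all
      then show ?case
        using snoc by (simp add: word_conv_snoc word_extension_add_fun flip: append_assoc)
    qed
  next
    case (Cons x u)
    then have "annihilates (\<lambda>w. a (x # w)) ?S" "annihilates (\<lambda>w. b (x # w)) ?S"
      using annihilates_translate[of _ ?S "[x]" "[]"] by simp_all
    then show ?case
      using Cons by (simp add: word_conv_Cons word_extension_add_fun)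
  qed
  then show ?thesis by (simp add: annihilates_def)
qed

section \<open>The coordinate ring is finite dimensional\<close>

lemma coord_ring_eq_zero_if_zero_on_spanning_words:
  fixes scale :: "'k::field \<Rightarrow> 'g::ab_group_add \<Rightarrow> 'g"
  assumes "vector_space scale" and a: "a \<in> coord_ring scale br pmap"
    and span: "module.span scale B = UNIV"
    and B: "\<And>w. set w \<subseteq> B \<Longrightarrow> length w = m \<Longrightarrow> a w = 0"
    and "length w = m"
  shows "a w = 0"
proof -
  interpret vector_space scale by fact
  have "a (u @ v) = 0" if "set v \<subseteq> B" "length u + length v = m" for u v
    using that
  proof (induction u arbitrary: v rule: rev_induct)
    case (snoc x u)
    have "x \<in> span B" using span by simp
    then have "a (u @ [x] @ v) = 0"
    proof (induction rule: span_induct_alt)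
      case base
      show ?case using coord_ring_homogeneous[OF a, of u 0 0 v] by simp
    next
      case (step c x y)
      have "a (u @ [x] @ v) = 0"
        using snoc.IH[of "x # v"] snoc.prems step by simp
      then show ?case
        using step by (simp only: coord_ring_additive[OF a] coord_ring_homogeneous[OF a]) simp
    qed
    then show ?case by simp
  qed (simp add: B)
  from this[of "[]" w] show ?thesis using \<open>length w = m\<close> by simp
qed

lemma adjacent_swaps_imp_mset_invariant:
  assumes swap: "\<And>u x y v. length u + length v + 2 = m \<Longrightarrow> a (u @ [x, y] @ v) = a (u @ [y, x] @ v)"
    and "length w = m" "mset w = mset w'"
  shows "a w = a w'"
proof -
  have front: "a (u @ s @ x # t) = a (u @ x # s @ t)"
    if "length u + length s + length t + 1 = m" for u s x t
    using that
  proof (induction s arbitrary: t rule: rev_induct)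
    case (snoc y s)
    have "a (u @ (s @ [y]) @ x # t) = a ((u @ s) @ [y, x] @ t)" by simp
    also have "\<dots> = a ((u @ s) @ [x, y] @ t)" by (rule swap) (use snoc.prems in simp)
    also have "\<dots> = a (u @ x # s @ y # t)" using snoc.IH[of "y # t"] snoc.prems by simp
    finally show ?case by simp
  qed simp
  have "a (u @ w) = a (u @ w')" if "length u + length w = m" "mset w = mset w'" for u
    using that
  proof (induction w arbitrary: u w')
    case (Cons x w)
    obtain s t where st: "w' = s @ x # t"
      using Cons.prems(2)
      by (metis in_multiset_in_set split_list union_single_eq_member mset.simps(2))
    then have "mset w = mset (s @ t)" using Cons.prems(2) by simp
    then have "a ((u @ [x]) @ w) = a ((u @ [x]) @ s @ t)"
      using Cons.prems(1) by (intro Cons.IH) auto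
    also have "\<dots> = a (u @ s @ x # t)"
      using front[of u s t x] Cons.prems(1) \<open>mset w = mset (s @ t)\<close>[THEN mset_eq_length] by simp
    finally show ?case by (simp add: st)
  qed simp
  from this[of "[]"] show ?thesis using assms(2,3) by simp
qed

lemma ex_count_list_ge:
  assumes "finite B" "set w \<subseteq> B" "length w > card B * (p - 1)" "p > 0"
  shows "\<exists>b. p \<le> count_list w b"
proof (rule ccontr)
  assume "\<nexists>b. p \<le> count_list w b"
  then have "count_list w b \<le> p - 1" for b
    by (metis Suc_pred' linorder_not_less not_less_eq_eq \<open>p > 0\<close>)
  then have "sum (count_list w) B \<le> card B * (p - 1)"
    using sum_bounded_above[of B "count_list w" "p - 1"] by simp
  then show False using sum_count_set[OF assms(2,1)] assms(3) by simp
qed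

text \<open>If \<open>a\<close> vanishes on the words shorter than \<open>w\<close>, its value at \<open>w\<close> depends only on the multiset
  of letters; so \<open>p\<close> equal letters can be brought together and replaced by a single one.\<close>

lemma coord_ring_eq_zero_if_count_ge_CHAR:
  fixes scale :: "'k::field \<Rightarrow> 'g::ab_group_add \<Rightarrow> 'g"
  assumes char: "CHAR('k) > 0" and a: "a \<in> coord_ring scale br pmap"
    and short: "\<And>v. length v < length w \<Longrightarrow> a v = 0"
    and count: "CHAR('k) \<le> count_list w b"
  shows "a w = 0"
proof -
  have "replicate_mset CHAR('k) b \<subseteq># mset w"
    using count by (simp add: count_mset flip: count_le_replicate_mset_subset_eq)
  then obtain r where r: "mset w = mset (replicate CHAR('k) b @ r)"
    by (metis ex_mset mset_append mset_replicate subset_mset.add_diff_inverse)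
  have "a w = a (replicate CHAR('k) b @ r)"
  proof (rule adjacent_swaps_imp_mset_invariant[where m = "length w"])
    fix u v :: "'g list" and x y assume "length u + length v + 2 = length w"
    then show "a (u @ [x, y] @ v) = a (u @ [y, x] @ v)"
      using coord_ring_commutator[OF a, of u x y v] short[of "u @ [br x y] @ v"] by simp
  qed (use r in simp_all)
  also have "\<dots> = a ([pmap b] @ r)"
    using coord_ring_p_power[OF a, of "[]" b r] by simp
  also have "\<dots> = 0"
    using mset_eq_length[OF r] CHAR_ge_2[OF char] by (intro short) simp
  finally show ?thesis .
qed

theorem coord_ring_finitely_determined:
  fixes scale :: "'k::field \<Rightarrow> 'g::ab_group_add \<Rightarrow> 'g"
  assumes char: "CHAR('k) > 0" and vs: "vector_space scale" and fin: "fin_dim scale"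
  shows "\<exists>W. finite W \<and> (\<forall>a\<in>coord_ring scale br pmap. (\<forall>w\<in>W. a w = 0) \<longrightarrow> a = 0)"
proof -
  obtain B where B: "finite B" "module.span scale B = UNIV"
    using fin by (auto simp: fin_dim_def)
  define W where "W = {w. set w \<subseteq> B \<and> length w \<le> card B * (CHAR('k) - 1)}"
  have "a w = 0" if a: "a \<in> coord_ring scale br pmap" and W: "\<forall>w\<in>W. a w = 0" for a w
  proof (induction "length w" arbitrary: w rule: less_induct)
    case less
    have "a v = 0" if v: "set v \<subseteq> B" "length v = length w" for v
    proof (cases "v \<in> W")
      case False
      then obtain b where "CHAR('k) \<le> count_list v b"
        using ex_count_list_ge[OF B(1) v(1) _ char] v(1) by (auto simp: W_def)
      then show ?thesis
        using coord_ring_eq_zero_if_count_ge_CHAR[OF char a] less v(2) by metis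
    qed (use W in blast)
    then show ?case using coord_ring_eq_zero_if_zero_on_spanning_words[OF vs a B(2)] by blast
  qed
  moreover have "finite W" unfolding W_def using B(1) by (rule finite_lists_length_le)
  ultimately show ?thesis by (intro exI[of _ W]) (auto simp: fun_eq_iff)
qed

lemma finitely_determined_dual_family:
  fixes V :: "('x \<Rightarrow> 'k::field) set"
  assumes "finite W" and V: "fun_space.subspace V" and det: "\<forall>a\<in>V. (\<forall>w\<in>W. a w = 0) \<longrightarrow> a = 0"
  shows "\<exists>e. (\<forall>w. e w \<in> V) \<and> (\<forall>a\<in>V. \<forall>x. a x = (\<Sum>w\<in>W. a w * e w x))"
proof -
  define r where "r a w = (if w \<in> W then a w else 0)" for a :: "'x \<Rightarrow> 'k" and w
  interpret pair: vector_space_pair "fun_scale :: 'k \<Rightarrow> ('x \<Rightarrow> 'k) \<Rightarrow> _"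
    "fun_scale :: 'k \<Rightarrow> ('x \<Rightarrow> 'k) \<Rightarrow> _"
    by unfold_locales
  have r: "Vector_Spaces.linear fun_scale fun_scale r"
    by unfold_locales (auto simp: r_def fun_eq_iff)
  have "inj_on r V"
  proof (rule inj_onI)
    fix a b assume "a \<in> V" "b \<in> V" "r a = r b"
    then have "a - b \<in> V" "\<forall>w\<in>W. (a - b) w = 0"
      using V by (auto simp: r_def fun_eq_iff fun_space.subspace_diff) meson
    then show "a = b" using det by fastforce
  qed
  then obtain g where g: "range g \<subseteq> V" "Vector_Spaces.linear fun_scale fun_scale g"
    "\<And>a. a \<in> V \<Longrightarrow> g (r a) = a"
    using pair.linear_exists_left_inverse_on[OF r V] by auto
  interpret g: Vector_Spaces.linear fun_scale fun_scale g by fact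
  define \<delta> where "\<delta> w x = (if x = w then 1 else 0 :: 'k)" for w x :: 'x
  have "a x = (\<Sum>w\<in>W. a w * g (\<delta> w) x)" if "a \<in> V" for a x
  proof -
    have "r a = (\<Sum>w\<in>W. fun_scale (a w) (\<delta> w))"
      using \<open>finite W\<close> by (auto simp: r_def \<delta>_def sum_fun_apply fun_eq_iff if_distrib cong: if_cong)
    then have "a = (\<Sum>w\<in>W. fun_scale (a w) (g (\<delta> w)))"
      using g(3)[OF that] by (simp add: g.sum g.scale)
    then show ?thesis by (metis (mono_tags, lifting) fun_scale_apply sum.cong sum_fun_apply)
  qed
  then show ?thesis using g(1) by (intro exI[of _ "\<lambda>w. g (\<delta> w)"]) blast
qed

locale coord_algebra =
  fixes A :: "('g list \<Rightarrow> 'k::field) set"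
  assumes char_pos: "CHAR('k) > 0"
    and add_closed: "a \<in> A \<Longrightarrow> b \<in> A \<Longrightarrow> a + b \<in> A"
    and scale_closed: "a \<in> A \<Longrightarrow> fun_scale c a \<in> A"
    and unit_closed: "word_unit \<in> A"
    and conv_closed: "a \<in> A \<Longrightarrow> b \<in> A \<Longrightarrow> word_conv a b \<in> A"
    and translate_closed: "a \<in> A \<Longrightarrow> (\<lambda>w. a (u @ w @ v)) \<in> A"
    and finitely_determined: "\<exists>W. finite W \<and> (\<forall>a\<in>A. (\<forall>w\<in>W. a w = 0) \<longrightarrow> a = 0)"
begin

lemma subspace_A: "fun_space.subspace A"
  using add_closed scale_closed scale_closed[OF unit_closed, of 0]
  by (simp add: fun_space.subspace_def)

lemma comultiplication:
  obtains W e where "finite W" "\<And>w. e w \<in> A" "\<And>a u v. a \<in> A \<Longrightarrow> a (u @ v) = (\<Sum>w\<in>W. a (u @ w) * e w v)"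
proof -
  obtain W where W: "finite W" "\<forall>a\<in>A. (\<forall>w\<in>W. a w = 0) \<longrightarrow> a = 0"
    using finitely_determined by blast
  obtain e where e: "\<forall>w. e w \<in> A" "\<forall>a\<in>A. \<forall>x. a x = (\<Sum>w\<in>W. a w * e w x)"
    using finitely_determined_dual_family[OF W(1) subspace_A W(2)] by blast
  show thesis
  proof (rule that[OF W(1)])
    show "e w \<in> A" for w using e(1) by blast
    show "a (u @ v) = (\<Sum>w\<in>W. a (u @ w) * e w v)" if "a \<in> A" for a u v
      using e(2)[rule_format, OF translate_closed[OF that, of u "[]"], of v] unfolding append_Nil2 .
  qed
qed

lemma eq_zero_if_zero_on_short_words: "\<exists>N. \<forall>a\<in>A. (\<forall>w. length w < N \<longrightarrow> a w = 0) \<longrightarrow> a = 0"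
proof -
  obtain W where W: "finite W" "\<And>a. a \<in> A \<Longrightarrow> \<forall>w\<in>W. a w = 0 \<Longrightarrow> a = 0"
    using finitely_determined by blast
  then show ?thesis
    by (intro exI[of _ "Suc (Max (length ` W))"]) (auto simp: less_Suc_eq_le)
qed

end

theorem coord_algebra_coord_ring:
  fixes scale :: "'k::field \<Rightarrow> 'g::ab_group_add \<Rightarrow> 'g"
  assumes "CHAR('k) > 0" "vector_space scale" "fin_dim scale"
  shows "coord_algebra (coord_ring scale br pmap)"
proof
  show "\<exists>W. finite W \<and> (\<forall>a\<in>coord_ring scale br pmap. (\<forall>w\<in>W. a w = 0) \<longrightarrow> a = 0)"
    by (rule coord_ring_finitely_determined[OF assms])
qed (use assms(1) in \<open>auto simp: coord_ring_iff
    intro: annihilates_add annihilates_scale annihilates_word_unit annihilates_word_conv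
      annihilates_translate\<close>)

section \<open>Tensor powers\<close>

lemma fun_span_induct [consumes 1, case_names zero add]:
  assumes "x \<in> fun_space.span B" "P 0"
    and "\<And>c b y. b \<in> B \<Longrightarrow> y \<in> fun_space.span B \<Longrightarrow> P y \<Longrightarrow> P (fun_scale c b + y)"
  shows "P x"
proof -
  have "x \<in> fun_space.span B \<and> P x"
    using assms(1)
  proof (induction rule: fun_space.span_induct_alt)
    case base
    show ?case using assms(2) fun_space.span_zero by blast
  next
    case (step c b y)
    then show ?case
      using assms(3)[of b y c] fun_space.span_add[OF fun_space.span_scale[OF fun_space.span_base]]
      by blast
  qed
  then show ?thesis ..
qed

lemma span_linear_image:
  assumes "x \<in> fun_space.span B" "fun_space.subspace S"
    and "\<And>F G. f (F + G) = f F + f G" "\<And>c F. f (fun_scale c F) = fun_scale c (f F)"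
    and "\<And>b. b \<in> B \<Longrightarrow> f b \<in> S"
  shows "f x \<in> S"
  using assms(1)
proof (induction rule: fun_span_induct)
  case zero
  have "f 0 = 0" using assms(4)[of 0 0] by simp
  then show ?case using fun_space.subspace_0[OF assms(2)] by metis
next
  case (add c b y)
  then show ?case
    unfolding assms(3,4) using assms(5)
    by (intro fun_space.subspace_add[OF assms(2)] fun_space.subspace_scale[OF assms(2)])
qed

lemma conv_span:
  assumes "x \<in> fun_space.span B" "y \<in> fun_space.span C" and "fun_space.subspace S"
    and "\<And>b c. b \<in> B \<Longrightarrow> c \<in> C \<Longrightarrow> conv b c \<in> S"
  shows "conv x y \<in> S"
  using assms(1,3) conv_left.add conv_scale_left
proof (rule span_linear_image[where f = "\<lambda>x. conv x y"])
  show "conv b y \<in> S" if "b \<in> B" for b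
    using assms(2,3) conv_right.add conv_scale_right assms(4)[OF that]
    by (rule span_linear_image[where f = "conv b"])
qed

lemma tensor_power_eq_span:
  "tensor_power V n = fun_space.span {pure_tensor as | as. length as = n \<and> set as \<subseteq> V}"
  unfolding tensor_power_def fun_scale_def[abs_def] by (rule refl)

lemma subspace_tensor_power: "fun_space.subspace (tensor_power V n)"
  by (simp add: tensor_power_eq_span)

lemmas tensor_power_zero = fun_space.subspace_0[OF subspace_tensor_power]
lemmas tensor_power_add = fun_space.subspace_add[OF subspace_tensor_power]
lemmas tensor_power_diff = fun_space.subspace_diff[OF subspace_tensor_power]
lemmas tensor_power_neg = fun_space.subspace_neg[OF subspace_tensor_power]
lemmas tensor_power_scale = fun_space.subspace_scale[OF subspace_tensor_power]
lemmas tensor_power_sum = fun_space.subspace_sum[OF subspace_tensor_power]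

lemma pure_tensor_in_tensor_power:
  "length as = n \<Longrightarrow> set as \<subseteq> V \<Longrightarrow> pure_tensor as \<in> tensor_power V n"
  unfolding tensor_power_eq_span by (intro fun_space.span_base) blast

lemma tensor_power_linear_image:
  assumes "x \<in> tensor_power V n" "fun_space.subspace S"
    and "\<And>F G. f (F + G) = f F + f G" "\<And>c F. f (fun_scale c F) = fun_scale c (f F)"
    and "\<And>as. length as = n \<Longrightarrow> set as \<subseteq> V \<Longrightarrow> f (pure_tensor as) \<in> S"
  shows "f x \<in> S"
  using assms(1)[unfolded tensor_power_eq_span] assms(2-4)
  by (rule span_linear_image) (use assms(5) in auto)

lemma homogeneous_tensor_power:
  assumes "x \<in> tensor_power V n"
  shows "homogeneous n x"
proof -
  have "x \<in> {x. homogeneous n x}"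
    using assms
  proof (rule tensor_power_linear_image[where f = "\<lambda>x. x"])
    show "fun_space.subspace {x :: ('a, 'b) cochain. homogeneous n x}"
      by (auto simp: fun_space.subspace_def homogeneous_iff)
  qed (use homogeneous_pure_tensor in auto)
  then show ?thesis by simp
qed

lemma tensor_power_mono: "V \<subseteq> V' \<Longrightarrow> tensor_power V n \<subseteq> tensor_power V' n"
  unfolding tensor_power_eq_span by (intro fun_space.span_mono) auto

lemma conv_in_tensor_power:
  assumes V: "\<And>a b. a \<in> V \<Longrightarrow> b \<in> V \<Longrightarrow> word_conv a b \<in> V"
    and "x \<in> tensor_power V n" "y \<in> tensor_power V n"
  shows "conv x y \<in> tensor_power V n"
  using assms(2,3)[unfolded tensor_power_eq_span] subspace_tensor_power
proof (rule conv_span)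
  fix s t
  assume "s \<in> {pure_tensor as |as. length as = n \<and> set as \<subseteq> V}"
    "t \<in> {pure_tensor as |as. length as = n \<and> set as \<subseteq> V}"
  then obtain as bs where st: "s = pure_tensor as" "t = pure_tensor bs"
    and len: "length as = n" "length bs = n" and sub: "set as \<subseteq> V" "set bs \<subseteq> V"
    by blast
  have "set (map2 word_conv as bs) \<subseteq> V"
    using sub by (auto elim!: in_set_zipE intro!: V)
  then show "conv s t \<in> tensor_power V n"
    by (simp add: st conv_pure_tensor len pure_tensor_in_tensor_power)
qed

lemma tensor_cons_in_tensor_power:
  assumes "a \<in> V" "T \<in> tensor_power V n"
  shows "tensor_cons a T \<in> tensor_power V (Suc n)"
  using assms(2) subspace_tensor_power tensor_cons.add tensor_cons_scale
proof (rule tensor_power_linear_image[where f = "tensor_cons a"])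
  show "tensor_cons a (pure_tensor as) \<in> tensor_power V (Suc n)"
    if "length as = n" "set as \<subseteq> V" for as
    using that assms(1) by (simp add: pure_tensor_in_tensor_power flip: pure_tensor_Cons)
qed

definition remove_constant :: "('g list \<Rightarrow> 'k::field) \<Rightarrow> 'g list \<Rightarrow> 'k" where
  "remove_constant a w = (if w = [] then 0 else a w)"

definition normalized_part :: "('g, 'k::field) cochain \<Rightarrow> ('g, 'k) cochain" where
  "normalized_part F ws = (if [] \<in> set ws then 0 else F ws)"

lemma normalized_part_eq: "normalized F \<Longrightarrow> normalized_part F = F"
  by (auto simp: normalized_part_def normalized_def)

lemma normalized_part_pure_tensor:
  "normalized_part (pure_tensor as) = pure_tensor (map remove_constant as)"
proof
  fix ws
  show "normalized_part (pure_tensor as) ws = pure_tensor (map remove_constant as) ws"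
  proof (induction as arbitrary: ws)
    case Nil
    then show ?case by (simp add: normalized_part_def pure_tensor_def)
  next
    case (Cons a as)
    show ?case
      using Cons[of "tl ws"]
      by (cases ws) (auto simp: normalized_part_def pure_tensor_Cons remove_constant_def)
  qed
qed

lemma normalized_iff_counit_at:
  assumes "homogeneous n x"
  shows "normalized x \<longleftrightarrow> (\<forall>i<n. counit_at i x = (\<lambda>_. 0))"
proof (intro iffI allI impI)
  show "counit_at i x = (\<lambda>_. 0)" if "normalized x" for i
    using that by (simp add: normalized_def counit_at_def fun_eq_iff)
next
  assume counit: "\<forall>i<n. counit_at i x = (\<lambda>_. 0)"
  have "x ws = 0" if "[] \<in> set ws" for ws
  proof (cases "length ws = n")
    case True
    obtain us vs where ws: "ws = us @ [] # vs" using \<open>[] \<in> set ws\<close> by (meson split_list)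
    have "counit_at (length us) x (us @ vs) = 0"
      using counit True by (simp add: ws)
    then show ?thesis by (simp add: counit_at_def ws)
  qed (use assms in \<open>simp add: homogeneous_iff\<close>)
  then show "normalized x" by (simp add: normalized_def)
qed

lemma one_plus_eq: "one_plus A n = (+) (unit_cochain n) ` tensor_power (aug_ideal A) n"
  by (auto simp: one_plus_def plus_fun_def)

context coord_algebra
begin

abbreviation "I \<equiv> aug_ideal A"

lemma I_subset: "I \<subseteq> A"
  by (auto simp: aug_ideal_def)

lemma zero_in_I: "0 \<in> I"
  using fun_space.subspace_0[OF subspace_A] by (simp add: aug_ideal_def)

lemma scale_in_I: "a \<in> I \<Longrightarrow> fun_scale c a \<in> I"
  using scale_closed by (simp add: aug_ideal_def)

lemma word_conv_in_I: "a \<in> I \<Longrightarrow> b \<in> I \<Longrightarrow> word_conv a b \<in> I"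
  using conv_closed by (simp add: aug_ideal_def)

lemma remove_constant_in_I:
  assumes "a \<in> A"
  shows "remove_constant a \<in> I"
proof -
  have "a + fun_scale (- a []) word_unit = remove_constant a"
    by (simp add: word_unit_def remove_constant_def fun_eq_iff)
  then show ?thesis
    using add_closed[OF assms scale_closed[OF unit_closed, of "- a []"]]
    by (simp add: aug_ideal_def remove_constant_def)
qed

lemma unit_in_tensor_power: "unit_cochain n \<in> tensor_power A n"
  unfolding unit_cochain_eq_pure_tensor using unit_closed
  by (intro pure_tensor_in_tensor_power) auto

lemma tensor_power_I_subset: "tensor_power I n \<subseteq> tensor_power A n"
  by (rule tensor_power_mono[OF I_subset])

lemma normalized_tensor_power_I:
  assumes "x \<in> tensor_power I n"
  shows "normalized x"
proof -
  have "x \<in> {x. normalized x}"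
    using assms
  proof (rule tensor_power_linear_image[where f = "\<lambda>x. x"])
    show "fun_space.subspace {x :: ('g, 'k) cochain. normalized x}"
      by (auto simp: fun_space.subspace_def normalized_def)
    show "pure_tensor as \<in> {x. normalized x}" if "set as \<subseteq> I" for as
    proof -
      have "map remove_constant as = as"
        using that by (intro map_idI ext) (auto simp: aug_ideal_def remove_constant_def)
      then have "pure_tensor as = normalized_part (pure_tensor as)"
        by (simp add: normalized_part_pure_tensor)
      then show ?thesis by (metis mem_Collect_eq normalized_def normalized_part_def)
    qed
  qed simp_all
  then show ?thesis by simp
qed

lemma normalized_part_in_tensor_power:
  assumes "x \<in> tensor_power A n"
  shows "normalized_part x \<in> tensor_power I n"
  using assms subspace_tensor_power
proof (rule tensor_power_linear_image)
  show "normalized_part (pure_tensor as) \<in> tensor_power I n" if "length as = n" "set as \<subseteq> A" for as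
    unfolding normalized_part_pure_tensor
    using that remove_constant_in_I by (intro pure_tensor_in_tensor_power) auto
qed (simp_all add: normalized_part_def fun_eq_iff)

lemma tensor_power_I_eq: "tensor_power I n = {x \<in> tensor_power A n. normalized x}"
proof (intro equalityI subsetI)
  show "x \<in> tensor_power I n" if "x \<in> {x \<in> tensor_power A n. normalized x}" for x
    using that normalized_part_in_tensor_power[of x n] by (simp add: normalized_part_eq)
qed (use tensor_power_I_subset normalized_tensor_power_I in blast)

lemma C_add_eq: "C_add A n = tensor_power I n"
  unfolding C_add_def tensor_power_I_eq
  using normalized_iff_counit_at[OF homogeneous_tensor_power] by blast

lemma one_plus_subset: "one_plus A n \<subseteq> tensor_power A n"
  unfolding one_plus_eq
  using unit_in_tensor_power tensor_power_I_subset tensor_power_add by blast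

end

section \<open>The filtration by word length in the first factor\<close>

definition word_filtration :: "('g list \<Rightarrow> 'k::field) set \<Rightarrow> nat \<Rightarrow> ('g list \<Rightarrow> 'k) set" where
  "word_filtration A m = {a \<in> A. \<forall>w. length w < m \<longrightarrow> a w = 0}"

definition filtration_generators ::
  "('g list \<Rightarrow> 'k::field) set \<Rightarrow> nat \<Rightarrow> nat \<Rightarrow> ('g, 'k) cochain set" where
  "filtration_generators A n m = {pure_tensor (a # as) | a as.
     a \<in> word_filtration A m \<and> length as = n \<and> set as \<subseteq> aug_ideal A}"

definition tensor_filtration :: "('g list \<Rightarrow> 'k::field) set \<Rightarrow> nat \<Rightarrow> nat \<Rightarrow> ('g, 'k) cochain set" where
  "tensor_filtration A n m = fun_space.span (filtration_generators A n m)"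

lemma subspace_tensor_filtration: "fun_space.subspace (tensor_filtration A n m)"
  by (simp add: tensor_filtration_def)

lemmas tensor_filtration_zero = fun_space.subspace_0[OF subspace_tensor_filtration]
lemmas tensor_filtration_add = fun_space.subspace_add[OF subspace_tensor_filtration]
lemmas tensor_filtration_neg = fun_space.subspace_neg[OF subspace_tensor_filtration]
lemmas tensor_filtration_scale = fun_space.subspace_scale[OF subspace_tensor_filtration]
lemmas tensor_filtration_sum = fun_space.subspace_sum[OF subspace_tensor_filtration]

lemma tensor_filtration_base: "s \<in> filtration_generators A n m \<Longrightarrow> s \<in> tensor_filtration A n m"
  unfolding tensor_filtration_def by (rule fun_space.span_base)

lemma tensor_filtration_antimono:
  assumes "m \<le> l"
  shows "tensor_filtration A n l \<subseteq> tensor_filtration A n m"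
proof -
  have "word_filtration A l \<subseteq> word_filtration A m"
    using assms by (auto simp: word_filtration_def)
  then show ?thesis
    unfolding tensor_filtration_def
    by (intro fun_space.span_mono) (auto simp: filtration_generators_def)
qed

lemma word_filtration_1: "word_filtration A (Suc 0) = aug_ideal A"
  by (auto simp: aug_ideal_def word_filtration_def)

lemma tensor_filtration_1: "tensor_filtration A n 1 = tensor_power (aug_ideal A) (Suc n)"
proof -
  have "filtration_generators A n 1
      = {pure_tensor as | as. length as = Suc n \<and> set as \<subseteq> aug_ideal A}"
    (is "_ = ?R")
  proof (intro equalityI subsetI)
    show "x \<in> ?R" if x: "x \<in> filtration_generators A n 1" for x
    proof -
      obtain a as where "x = pure_tensor (a # as)" "a \<in> aug_ideal A" "length as = n"
        "set as \<subseteq> aug_ideal A"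
        using x by (auto simp: filtration_generators_def word_filtration_1)
      then show ?thesis by (intro CollectI exI[of _ "a # as"]) simp
    qed
    show "x \<in> filtration_generators A n 1" if "x \<in> ?R" for x
      using that by (auto simp: filtration_generators_def length_Suc_conv word_filtration_1) blast
  qed
  then show ?thesis by (simp only: tensor_filtration_def tensor_power_eq_span)
qed

lemma tensor_filtration_subset:
  "1 \<le> m \<Longrightarrow> tensor_filtration A n m \<subseteq> tensor_power (aug_ideal A) (Suc n)"
  using tensor_filtration_antimono tensor_filtration_1 by metis

lemma homogeneous_tensor_filtration: "1 \<le> m \<Longrightarrow> x \<in> tensor_filtration A n m \<Longrightarrow> homogeneous (Suc n) x"
  using tensor_filtration_subset homogeneous_tensor_power by blast

lemma conv_one_plus:
  assumes "homogeneous n x" "homogeneous n y"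
  shows "conv (unit_cochain n + x) (unit_cochain n + y) = unit_cochain n + (x + y + conv x y)"
  using assms by (simp add: conv_left.add conv_right.add conv_unit conv_unit_right add.assoc)

context coord_algebra
begin

lemma word_conv_in_word_filtration:
  assumes "a \<in> word_filtration A m" "b \<in> word_filtration A l"
  shows "word_conv a b \<in> word_filtration A (m + l)"
proof -
  have "word_conv a b w = 0" if w: "length w < m + l" for w
  proof -
    have "a u * b v = 0" if "(u, v) \<in> set (splits w)" for u v
      using length_splits[OF that] w assms
      by (cases "length u < m") (auto simp: word_filtration_def)
    then have "map (\<lambda>(u, v). a u * b v) (splits w) = map (\<lambda>_. 0) (splits w)"
      by (intro map_cong) auto
    then show ?thesis by (simp only: word_conv_def sum_list_0)
  qed
  then show ?thesis using assms conv_closed by (simp add: word_filtration_def)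
qed

lemma conv_in_tensor_filtration:
  assumes "x \<in> tensor_filtration A n m" "y \<in> tensor_filtration A n l"
  shows "conv x y \<in> tensor_filtration A n (m + l)"
  using assms(1)[unfolded tensor_filtration_def] assms(2)[unfolded tensor_filtration_def]
    subspace_tensor_filtration
proof (rule conv_span)
  fix s t assume "s \<in> filtration_generators A n m" "t \<in> filtration_generators A n l"
  then obtain a as b bs where st: "s = pure_tensor (a # as)" "t = pure_tensor (b # bs)"
    and ab: "a \<in> word_filtration A m" "b \<in> word_filtration A l"
    and len: "length as = n" "length bs = n" and sub: "set as \<subseteq> I" "set bs \<subseteq> I"
    unfolding filtration_generators_def by blast
  have "conv s t = pure_tensor (word_conv a b # map2 word_conv as bs)"
    by (simp add: st conv_pure_tensor len)
  moreover have "set (map2 word_conv as bs) \<subseteq> I"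
    using sub by (auto elim!: in_set_zipE intro!: word_conv_in_I)
  moreover have "length (map2 word_conv as bs) = n"
    by (simp add: len)
  ultimately have "conv s t \<in> filtration_generators A n (m + l)"
    unfolding filtration_generators_def using word_conv_in_word_filtration[OF ab] by blast
  then show "conv s t \<in> tensor_filtration A n (m + l)" by (rule tensor_filtration_base)
qed

lemma conv_in_tensor_filtration_Suc:
  assumes "1 \<le> m" "x \<in> tensor_filtration A n m" "y \<in> tensor_filtration A n m"
  shows "conv x y \<in> tensor_filtration A n (Suc m)"
  using conv_in_tensor_filtration[OF assms(2,3)]
    tensor_filtration_antimono[of "Suc m" "m + m"] assms(1)
  by auto

lemma scale_in_filtration_generators:
  assumes "s \<in> filtration_generators A n m"
  shows "fun_scale c s \<in> filtration_generators A n m"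
proof -
  obtain a as where s: "s = pure_tensor (a # as)" "a \<in> word_filtration A m" "length as = n"
    "set as \<subseteq> I"
    using assms unfolding filtration_generators_def by blast
  have "fun_scale c a \<in> word_filtration A m"
    using s(2) scale_closed by (auto simp: word_filtration_def)
  then show ?thesis
    unfolding filtration_generators_def s(1) scale_pure_tensor using s by blast
qed

lemma tensor_filtration_eventually_zero: "\<exists>N. tensor_filtration A n N = {0}"
proof -
  obtain N where N: "\<forall>a\<in>A. (\<forall>w. length w < N \<longrightarrow> a w = 0) \<longrightarrow> a = 0"
    using eq_zero_if_zero_on_short_words by blast
  have "s = 0" if s: "s \<in> filtration_generators A n N" for s
  proof -
    obtain a as where "s = pure_tensor (a # as)" "a \<in> word_filtration A N"
      using s unfolding filtration_generators_def by blast
    moreover from this have "a = 0" using N by (simp add: word_filtration_def)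
    ultimately show ?thesis
      using tensor_cons_scale_left[of 0 0 "pure_tensor as"] by (simp add: pure_tensor_Cons)
  qed
  then have "tensor_filtration A n N \<subseteq> fun_space.span {0}"
    unfolding tensor_filtration_def by (intro fun_space.span_mono) blast
  then show ?thesis
    using tensor_filtration_zero[of A n N] by (auto simp: fun_space.span_singleton)
qed

lemma conv_power_in_tensor_filtration:
  assumes "1 \<le> m" "s \<in> tensor_filtration A n m"
  shows "conv_power s (Suc j) \<in> tensor_filtration A n m"
proof (induction j)
  case (Suc j)
  then show ?case
    using conv_in_tensor_filtration_Suc[OF assms(1) Suc assms(2)]
      tensor_filtration_antimono[of m "Suc m"]
    by auto
qed (simp add: conv_total_unit assms(2))

lemma cochain_exp_generator_approx:
  assumes "1 \<le> n" "1 \<le> m" and s: "s \<in> filtration_generators A n m"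
  shows "\<exists>r\<in>tensor_filtration A n (Suc m). cochain_exp (Suc n) s = unit_cochain (Suc n) + (s + r)"
proof -
  obtain a as where as: "s = pure_tensor (a # as)" "a \<in> word_filtration A m" "length as = n"
    "set as \<subseteq> I"
    using s unfolding filtration_generators_def by blast
  obtain q where q: "CHAR('k) = Suc (Suc q)"
    using CHAR_ge_2[OF char_pos] by (metis add_2_eq_Suc le_Suc_ex)
  note s' = tensor_filtration_base[OF s]
  define r where
    "r = (\<Sum>j<q. fun_scale (1 / of_nat (fact (Suc (Suc j)))) (conv_power s (Suc (Suc j))))"
  have r: "r \<in> tensor_filtration A n (Suc m)"
    unfolding r_def conv_power.simps(2)[of s "Suc _"] using assms(2) s'
    by (intro tensor_filtration_sum tensor_filtration_scale conv_in_tensor_filtration_Suc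
        conv_power_in_tensor_filtration)
  have "b [] = 0" if "b \<in> set (a # as)" for b
    using that as(2,4) assms(2) by (auto simp: word_filtration_def aug_ideal_def)
  then have "cochain_exp (Suc n) s = degree_part (Suc n) (truncated_exp s)"
    unfolding as(1) using cochain_exp_pure_tensor[OF char_pos, of "a # as"] as(3) assms(1) by simp
  also have "truncated_exp s = total_unit + s + r"
    unfolding truncated_exp_def q sum.lessThan_Suc_shift r_def
    by (simp add: conv_total_unit comp_def add.assoc del: fact_Suc)
  also have "degree_part (Suc n) \<dots> = unit_cochain (Suc n) + (s + r)"
    using homogeneous_tensor_filtration[OF assms(2) s'] homogeneous_tensor_filtration[OF _ r]
    by (simp add: degree_part.add degree_part_total_unit homogeneous_def add.assoc)
  finally show ?thesis using r by blast
qed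

lemma cochain_exp_approx:
  assumes n: "1 \<le> n" and m: "1 \<le> m" and x: "x \<in> tensor_filtration A n m"
  shows "\<exists>r\<in>tensor_filtration A n (Suc m). cochain_exp (Suc n) x = unit_cochain (Suc n) + (x + r)"
  using x unfolding tensor_filtration_def[of A n m]
proof (induction rule: fun_span_induct)
  case zero
  show ?case
    using tensor_filtration_zero
    by (intro bexI[of _ 0]) (simp_all only: cochain_exp_zero add_0_right)
next
  case (add c s y)
  let ?u = "unit_cochain (Suc n)" and ?s = "fun_scale c s"
  have s: "?s \<in> filtration_generators A n m" by (rule scale_in_filtration_generators[OF add(1)])
  have y: "y \<in> tensor_filtration A n m" unfolding tensor_filtration_def by (rule add(2))
  obtain r where r: "r \<in> tensor_filtration A n (Suc m)" "cochain_exp (Suc n) ?s = ?u + (?s + r)"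
    using cochain_exp_generator_approx[OF n m s] by blast
  obtain t where t: "t \<in> tensor_filtration A n (Suc m)" "cochain_exp (Suc n) y = ?u + (y + t)"
    using add(3) by blast
  have sr: "?s + r \<in> tensor_filtration A n m" and yt: "y + t \<in> tensor_filtration A n m"
    using r(1) t(1) y tensor_filtration_base[OF s] tensor_filtration_antimono[of m "Suc m"]
    by (auto intro: tensor_filtration_add)
  have "cochain_exp (Suc n) (?s + y) = ?u + (?s + r + (y + t) + conv (?s + r) (y + t))"
    unfolding cochain_exp_add r(2) t(2)
    using m sr yt by (intro conv_one_plus homogeneous_tensor_filtration)
  also have "\<dots> = ?u + (?s + y + (r + t + conv (?s + r) (y + t)))"
    by (simp add: algebra_simps)
  finally show ?case
    using r(1) t(1) conv_in_tensor_filtration_Suc[OF m sr yt]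
    by (blast intro: tensor_filtration_add)
qed

lemma one_plus_eq_deeper_conv_cochain_exp:
  assumes n: "1 \<le> n" and m: "1 \<le> m" and x: "x \<in> tensor_filtration A n m"
  shows "\<exists>y\<in>tensor_filtration A n (Suc m).
    unit_cochain (Suc n) + x = conv (unit_cochain (Suc n) + y) (cochain_exp (Suc n) x)"
proof -
  let ?u = "unit_cochain (Suc n)"
  note hom = homogeneous_tensor_filtration[OF m]
  obtain r where r: "r \<in> tensor_filtration A n (Suc m)"
    "cochain_exp (Suc n) (- x) = ?u + (- x + r)"
    using cochain_exp_approx[OF n m tensor_filtration_neg[OF x]] by blast
  have xr: "- x + r \<in> tensor_filtration A n m"
    using r(1) tensor_filtration_antimono[of m "Suc m"]
    by (intro tensor_filtration_add tensor_filtration_neg x) auto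
  define y where "y = r + conv x (- x + r)"
  have y: "y \<in> tensor_filtration A n (Suc m)"
    unfolding y_def by (intro tensor_filtration_add r(1) conv_in_tensor_filtration_Suc m x xr)
  have "conv (?u + x) (cochain_exp (Suc n) (- x)) = ?u + y"
    unfolding r(2) conv_one_plus[OF hom[OF x] hom[OF xr]] y_def by (simp add: add.assoc)
  then have "conv (?u + y) (cochain_exp (Suc n) x)
      = conv (?u + x) (conv (cochain_exp (Suc n) x) (cochain_exp (Suc n) (- x)))"
    by (metis conv_assoc conv_commute)
  also have "\<dots> = ?u + x"
    unfolding cochain_exp_uminus using hom[OF x]
    by (simp add: conv_left.add conv_unit conv_unit_right)
  finally show ?thesis using y by metis
qed

lemma cochain_exp_surj_filtration:
  assumes n: "1 \<le> n" and "1 \<le> m" "x \<in> tensor_filtration A n m"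
  shows "\<exists>T \<in> tensor_power I (Suc n). cochain_exp (Suc n) T = unit_cochain (Suc n) + x"
proof -
  obtain N where N: "tensor_filtration A n N = {0}"
    using tensor_filtration_eventually_zero by blast
  show ?thesis
    using assms(2,3)
  proof (induction "N - m" arbitrary: m x)
    case 0
    then have "x = 0" using N tensor_filtration_antimono[of N m A n] by auto
    then show ?case
      using tensor_power_zero
      by (intro bexI[of _ 0]) (simp_all only: cochain_exp_zero add_0_right)
  next
    case (Suc d)
    obtain y where y: "y \<in> tensor_filtration A n (Suc m)"
      "unit_cochain (Suc n) + x = conv (unit_cochain (Suc n) + y) (cochain_exp (Suc n) x)"
      using one_plus_eq_deeper_conv_cochain_exp[OF n Suc.prems] by blast
    have "d = N - Suc m" "1 \<le> Suc m" using Suc.hyps(2) by simp_all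
    then obtain T where T: "T \<in> tensor_power I (Suc n)"
      "cochain_exp (Suc n) T = unit_cochain (Suc n) + y"
      using Suc.hyps(1) y(1) by blast
    have "cochain_exp (Suc n) (T + x) = unit_cochain (Suc n) + x"
      by (simp only: cochain_exp_add T(2) y(2))
    moreover have "T + x \<in> tensor_power I (Suc n)"
      using T(1) Suc.prems tensor_filtration_subset tensor_power_add by blast
    ultimately show ?case by blast
  qed
qed

theorem cochain_exp_image:
  assumes "n \<ge> 2"
  shows "cochain_exp n ` tensor_power I n = one_plus A n"
proof -
  obtain l where l: "n = Suc l" "1 \<le> l" using assms by (cases n) auto
  have filt: "tensor_power I n = tensor_filtration A l 1"
    by (simp only: l(1) tensor_filtration_1)
  show ?thesis
    unfolding one_plus_eq
  proof (intro equalityI image_subsetI)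
    fix x assume x: "x \<in> tensor_power I n"
    then have x': "x \<in> tensor_filtration A l 1" by (simp only: filt)
    obtain r where r: "r \<in> tensor_filtration A l (Suc 1)"
      "cochain_exp n x = unit_cochain n + (x + r)"
      using cochain_exp_approx[OF l(2) order_refl x'] l(1) by blast
    then have "x + r \<in> tensor_power I n"
      using x tensor_filtration_antimono[of 1 "Suc 1" A l] unfolding filt[symmetric]
      by (auto intro: tensor_power_add)
    then show "cochain_exp n x \<in> (+) (unit_cochain n) ` tensor_power I n"
      unfolding r(2) by (rule imageI)
    show "unit_cochain n + x \<in> cochain_exp n ` tensor_power I n"
      using cochain_exp_surj_filtration[OF l(2) order_refl x'] l(1) by (metis imageI)
  qed
qed

lemma cochain_exp_inj:
  assumes "n \<ge> 1"
  shows "inj_on (cochain_exp n) (tensor_power I n)"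
proof (rule inj_onI)
  fix x y assume x: "x \<in> tensor_power I n" and y: "y \<in> tensor_power I n"
    and eq: "cochain_exp n x = cochain_exp n y"
  have d: "x - y \<in> tensor_power I n" by (rule tensor_power_diff[OF x y])
  have "cochain_exp n (x + - y) = conv (cochain_exp n y) (cochain_exp n (- y))"
    by (simp only: cochain_exp_add eq)
  then have "degree_part n (total_exp (x - y)) = unit_cochain n"
    by (simp add: cochain_exp_uminus) (simp add: cochain_exp_def)
  moreover have "(x - y) (replicate n []) = 0"
    using normalized_tensor_power_I[OF d] assms by (simp add: normalized_def)
  ultimately have "x - y = 0"
    using total_exp_eq_unit_imp_zero homogeneous_tensor_power[OF d] by blast
  then show "x = y" by simp
qed

end

section \<open>Identification of the map \<open>E\<close>\<close>

lemma cochain_ring_simps [simp]: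
  "carrier (cochain_ring A n) = tensor_power A n" "monoid.mult (cochain_ring A n) = conv"
  "monoid.one (cochain_ring A n) = unit_cochain n" "ring.add (cochain_ring A n) = (+)"
  "ring.zero (cochain_ring A n) = 0"
  by (simp_all add: cochain_ring_def fun_eq_iff)

context coord_algebra
begin

lemma comm_monoid_cochain_ring: "comm_monoid (cochain_ring A n)"
  by (rule comm_monoidI)
    (auto simp: unit_in_tensor_power conv_assoc conv_unit homogeneous_tensor_power
      intro: conv_in_tensor_power[OF conv_closed] conv_commute)

lemma
  assumes "x \<in> tensor_power A n" "y \<in> tensor_power A n" "conv x y = unit_cochain n"
  shows cochain_unitI: "x \<in> Units (cochain_ring A n)"
    and cochain_inv_eq: "inv\<^bsub>cochain_ring A n\<^esub> x = y"
proof -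
  show "x \<in> Units (cochain_ring A n)"
    using assms conv_commute[of x y] by (auto simp: Units_def)
  show "inv\<^bsub>cochain_ring A n\<^esub> x = y"
    by (rule comm_monoid.comm_inv_char[OF comm_monoid_cochain_ring]) (use assms in auto)
qed

lemma cochain_exp_in_one_plus: "n \<ge> 2 \<Longrightarrow> x \<in> tensor_power I n \<Longrightarrow> cochain_exp n x \<in> one_plus A n"
  using cochain_exp_image by blast

lemma cochain_exp_in_Units:
  assumes "n \<ge> 2" "x \<in> tensor_power I n"
  shows "cochain_exp n x \<in> Units (cochain_ring A n)"
  using assms cochain_exp_in_one_plus one_plus_subset tensor_power_neg
  by (blast intro: cochain_unitI[OF _ _ cochain_exp_uminus])

theorem alg_group_hom_cochain_exp:
  assumes "n \<ge> 2"
  shows "alg_group_hom_E A n (restrict (cochain_exp n) (tensor_power I n))"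
  unfolding alg_group_hom_E_def
proof (intro conjI allI impI)
  show "restrict (cochain_exp n) (tensor_power I n)
      \<in> hom (add_monoid (cochain_ring A n)\<lparr>carrier := tensor_power I n\<rparr>)
          (units_of (cochain_ring A n)\<lparr>carrier := one_plus A n\<rparr>)"
    using assms
    by (auto simp: hom_def units_of_def cochain_exp_add tensor_power_add
        intro: cochain_exp_in_one_plus)
  fix ws :: "'g list list"
  show "\<exists>q\<in>poly_fun. \<forall>T\<in>tensor_power I n. restrict (cochain_exp n) (tensor_power I n) T ws = q T"
  proof (cases "length ws = n")
    case True
    then show ?thesis
      by (intro bexI[OF _ poly_fun_total_exp[of ws]]) (simp add: cochain_exp_def degree_part_def)
  next
    case False
    then show ?thesis
      by (intro bexI[of _ "\<lambda>_. 0"])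
        (auto simp: cochain_exp_def degree_part_def intro: poly_fun.intros)
  qed
next
  fix as :: "('g list \<Rightarrow> 'k) list" assume as: "length as = n \<and> set as \<subseteq> I"
  then have "cochain_exp n (pure_tensor as) = degree_part n (truncated_exp (pure_tensor as))"
    using cochain_exp_pure_tensor[OF char_pos, of as] assms by (auto simp: aug_ideal_def)
  then show "restrict (cochain_exp n) (tensor_power I n) (pure_tensor as)
      = (\<lambda>ws. \<Sum>j<CHAR('k). (pure_tensor as [^]\<^bsub>cochain_ring A n\<^esub> j) ws / of_nat (fact j))"
    using as pure_tensor_in_tensor_power[of as n I]
    by (simp add: nat_pow_cochain_ring truncated_exp_def degree_part.sum degree_part_scale
        sum_fun_apply fun_eq_iff)
qed

text \<open>Scalars can be absorbed into a factor, so decomposable tensors generate the additive group.\<close>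

lemma alg_group_hom_E_unique:
  assumes n: "n \<ge> 1" and e: "alg_group_hom_E A n e" and f: "alg_group_hom_E A n f"
    and x: "x \<in> tensor_power I n"
  shows "e x = f x"
proof -
  have hom: "h (x + y) = conv (h x) (h y)"
    if "alg_group_hom_E A n h" "x \<in> tensor_power I n" "y \<in> tensor_power I n" for h x y
    using that by (auto simp: alg_group_hom_E_def hom_def units_of_def)
  have pure: "e (pure_tensor as) = f (pure_tensor as)" if "length as = n" "set as \<subseteq> I" for as
    using that e f by (simp add: alg_group_hom_E_def)
  have scaled: "e (fun_scale c (pure_tensor as)) = f (fun_scale c (pure_tensor as))"
    and scaled_mem: "fun_scale c (pure_tensor as) \<in> tensor_power I n"
    if "length as = n" "set as \<subseteq> I" for c as
  proof -
    obtain a bs where "as = a # bs" using n \<open>length as = n\<close> by (cases as) auto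
    then show "e (fun_scale c (pure_tensor as)) = f (fun_scale c (pure_tensor as))"
      using pure[of "fun_scale c a # bs"] that scale_in_I by (simp add: scale_pure_tensor)
    show "fun_scale c (pure_tensor as) \<in> tensor_power I n"
      using that by (intro tensor_power_scale pure_tensor_in_tensor_power)
  qed
  show ?thesis
    using x[unfolded tensor_power_eq_span]
  proof (induction rule: fun_span_induct)
    case zero
    have "e (fun_scale 0 (pure_tensor (replicate n 0)))
        = f (fun_scale 0 (pure_tensor (replicate n 0)))"
      using zero_in_I by (intro scaled) auto
    then show ?case by (metis fun_space.scale_zero_left)
  next
    case (add c s y)
    then obtain as where as: "s = pure_tensor as" "length as = n" "set as \<subseteq> I" by blast
    have y: "y \<in> tensor_power I n" using add(2) by (simp only: tensor_power_eq_span)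
    note s = scaled_mem[OF as(2,3), of c, folded as(1)]
    show ?case
      unfolding hom[OF e s y] hom[OF f s y] using scaled[OF as(2,3)] add(3) as(1) by metis
  qed
qed

theorem E_map_eq:
  assumes "n \<ge> 2"
  shows "E_map A n = restrict (cochain_exp n) (tensor_power I n)"
  unfolding E_map_def
proof (rule the_equality)
  show "restrict (cochain_exp n) (tensor_power I n) \<in> extensional (tensor_power I n)
      \<and> alg_group_hom_E A n (restrict (cochain_exp n) (tensor_power I n))"
    using alg_group_hom_cochain_exp[OF assms] by simp
  fix e assume "e \<in> extensional (tensor_power I n) \<and> alg_group_hom_E A n e"
  then show "e = restrict (cochain_exp n) (tensor_power I n)"
    using alg_group_hom_E_unique[OF _ _ alg_group_hom_cochain_exp[OF assms], of e] assms
    by (intro extensionalityI[of _ "tensor_power I n"]) auto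
qed

lemma E_map_eq_cochain_exp: "n \<ge> 2 \<Longrightarrow> x \<in> tensor_power I n \<Longrightarrow> E_map A n x = cochain_exp n x"
  by (simp add: E_map_eq)

lemma L_map_cochain_exp: "n \<ge> 2 \<Longrightarrow> x \<in> tensor_power I n \<Longrightarrow> L_map A n (cochain_exp n x) = x"
  using cochain_exp_inj[of n] inv_into_f_f[of "E_map A n" "tensor_power I n" x]
  by (simp add: L_map_def E_map_eq inj_on_def)

end

section \<open>Unit groups and quotient groups\<close>

lemma (in monoid) units_of_int_pow:
  assumes "x \<in> Units G"
  shows "x [^]\<^bsub>units_of G\<^esub> (k::int) = x [^] k"
  using assms by (simp only: int_pow_def2 units_of_pow units_of_inv Units_pow_closed)

lemma (in comm_monoid) finprod_units_of:
  assumes "f \<in> S \<rightarrow> Units G"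
  shows "finprod (units_of G) f S = finprod G f S"
proof -
  interpret U: comm_group "units_of G" by (rule units_comm_group)
  show ?thesis
    using assms
  proof (induction S rule: infinite_finite_induct)
    case (insert i S)
    then have "f \<in> S \<rightarrow> carrier G" "f i \<in> carrier G" by (auto intro: Units_closed)
    with insert show ?case by (simp add: units_of_carrier units_of_mult Pi_iff)
  qed (simp_all add: units_of_one)
qed

lemma (in group) int_pow_minus_one_power:
  "x \<in> carrier G \<Longrightarrow> x [^] ((- 1) ^ i :: int) = (if even i then x else inv x)"
  by (simp add: int_pow_neg[of _ 1, simplified])

lemma (in comm_group) subgroup_imp_comm_group: "subgroup H G \<Longrightarrow> comm_group (G\<lparr>carrier := H\<rparr>)"
  by (rule group.group_comm_groupI[OF subgroup_imp_group])
    (auto intro: m_comm dest: subgroup.mem_carrier)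

lemma (in monoid) group_isomorphismsI:
  assumes f: "f \<in> hom G H" "f ` carrier G = carrier H" and g: "\<And>x. x \<in> carrier G \<Longrightarrow> g (f x) = x"
  shows "group_isomorphisms G H f g"
  unfolding group_isomorphisms_def
proof (intro conjI ballI)
  have preimage: "\<exists>x\<in>carrier G. y = f x" if "y \<in> carrier H" for y
    using that unfolding f(2)[symmetric] by blast
  then show "f (g y) = y" if "y \<in> carrier H" for y
    using that g by metis
  show "g \<in> hom H G"
  proof (rule homI)
    show "g y \<in> carrier G" if "y \<in> carrier H" for y
      using preimage[OF that] g by auto
    show "g (y \<otimes>\<^bsub>H\<^esub> z) = g y \<otimes> g z" if "y \<in> carrier H" "z \<in> carrier H" for y z
    proof -
      obtain a b where "a \<in> carrier G" "b \<in> carrier G" "y = f a" "z = f b"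
        using preimage \<open>y \<in> carrier H\<close> \<open>z \<in> carrier H\<close> by blast
      then show ?thesis
        by (simp add: g flip: hom_mult[OF f(1)])
    qed
  qed
qed (use f g in simp_all)

lemma group_isomorphisms_imp_group_iso:
  assumes "group G" "group H" "group_isomorphisms G H f g"
  shows "group_iso f G H" "group_iso g H G"
  using assms group_isomorphisms_imp_iso[of G H f g] group_isomorphisms_imp_iso[of H G g f]
  by (simp_all add: group_iso_def group_isomorphisms_sym)

lemma image_r_coset:
  assumes "f \<in> hom G H" "N \<subseteq> carrier G" "x \<in> carrier G"
  shows "f ` (N #>\<^bsub>G\<^esub> x) = (f ` N) #>\<^bsub>H\<^esub> f x"
proof -
  have "f (n \<otimes>\<^bsub>G\<^esub> x) = f n \<otimes>\<^bsub>H\<^esub> f x" if "n \<in> N" for n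
    using assms that by (intro hom_mult[OF assms(1)]) auto
  then show ?thesis unfolding r_coset_def image_UN by simp
qed

lemma hom_FactGroup:
  assumes f: "f \<in> hom G H" and N: "N \<lhd> G" and M: "M \<lhd> H" and "f ` N = M"
  obtains F where "F \<in> hom (G Mod N) (H Mod M)" "\<And>x. x \<in> carrier G \<Longrightarrow> F (N #>\<^bsub>G\<^esub> x) = M #>\<^bsub>H\<^esub> f x"
proof (rule FactGroup_universal[where h = "\<lambda>x. M #>\<^bsub>H\<^esub> f x"])
  show "(\<lambda>x. M #>\<^bsub>H\<^esub> f x) \<in> hom G (H Mod M)"
    using hom_compose[OF f normal.r_coset_hom_Mod[OF M]] by (simp add: comp_def)
  show "M #>\<^bsub>H\<^esub> f x = M #>\<^bsub>H\<^esub> f y"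
    if "x \<in> carrier G" "y \<in> carrier G" "N #>\<^bsub>G\<^esub> x = N #>\<^bsub>G\<^esub> y" for x y
    using that image_r_coset[OF f normal_imp_subgroup[OF N, THEN subgroup.subset]] \<open>f ` N = M\<close>
    by metis
qed (use N that in auto)

lemma group_isomorphisms_FactGroup:
  assumes fg: "group_isomorphisms G H f g" and N: "N \<lhd> G" and M: "M \<lhd> H" and "f ` N = M"
  obtains F K where "group_isomorphisms (G Mod N) (H Mod M) F K"
    "\<And>x. x \<in> carrier G \<Longrightarrow> F (N #>\<^bsub>G\<^esub> x) = M #>\<^bsub>H\<^esub> f x"
    "\<And>y. y \<in> carrier H \<Longrightarrow> K (M #>\<^bsub>H\<^esub> y) = N #>\<^bsub>G\<^esub> g y"
proof -
  have f: "f \<in> hom G H" and g: "g \<in> hom H G" and gf: "\<And>x. x \<in> carrier G \<Longrightarrow> g (f x) = x"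
    and fg': "\<And>y. y \<in> carrier H \<Longrightarrow> f (g y) = y"
    using fg by (auto simp: group_isomorphisms_def)
  have "N \<subseteq> carrier G" using N by (simp add: normal_imp_subgroup subgroup.subset)
  then have "g ` f ` N = (\<lambda>x. x) ` N"
    unfolding image_image using gf by (intro image_cong) auto
  then have "g ` M = N" by (simp add: \<open>f ` N = M\<close>)
  obtain F where F: "F \<in> hom (G Mod N) (H Mod M)"
    "\<And>x. x \<in> carrier G \<Longrightarrow> F (N #>\<^bsub>G\<^esub> x) = M #>\<^bsub>H\<^esub> f x"
    using hom_FactGroup[OF f N M \<open>f ` N = M\<close>] by blast
  obtain K where K: "K \<in> hom (H Mod M) (G Mod N)"
    "\<And>y. y \<in> carrier H \<Longrightarrow> K (M #>\<^bsub>H\<^esub> y) = N #>\<^bsub>G\<^esub> g y"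
    using hom_FactGroup[OF g M N \<open>g ` M = N\<close>] by blast
  have "group_isomorphisms (G Mod N) (H Mod M) F K"
    unfolding group_isomorphisms_def carrier_FactGroup
    using F K gf fg' hom_in_carrier[OF f] hom_in_carrier[OF g] by auto
  then show thesis using F(2) K(2) that by blast
qed

lemma group_iso_trivial_quotient:
  assumes "group F" "group G" and f: "f \<in> iso F G" and B: "B = {\<one>\<^bsub>G\<^esub>}"
  shows "group_iso (\<lambda>x. B #>\<^bsub>G\<^esub> f x) F (G Mod B)"
proof -
  interpret G: group G by fact
  interpret B: normal B G unfolding B by (rule G.one_is_normal)
  have "B #>\<^bsub>G\<^esub> x = {x}" if "x \<in> carrier G" for x
    using that by (simp add: r_coset_def B)
  then have "inj_on (\<lambda>x. B #>\<^bsub>G\<^esub> x) (carrier G)" by (auto intro!: inj_onI)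
  then have "(\<lambda>x. B #>\<^bsub>G\<^esub> x) \<in> iso G (G Mod B)"
    using B.r_coset_hom_Mod by (auto simp: iso_def bij_betw_def carrier_FactGroup)
  from iso_set_trans[OF f this] show ?thesis
    using assms(1) B.factorgroup_is_group by (simp add: group_iso_def comp_def)
qed

section \<open>The multiplicative differential\<close>

lemma face_0: "homogeneous n T \<Longrightarrow> face 0 n T = tensor_cons word_unit T"
  by (auto simp: face_def tensor_cons_def word_unit_def homogeneous_iff fun_eq_iff
      split: list.split)

lemma face_Suc_Suc_tensor_cons:
  "i \<le> n \<Longrightarrow> face (Suc (Suc i)) (Suc n) (tensor_cons a T) = tensor_cons a (face (Suc i) n T)"
  by (auto simp: face_def tensor_cons_def fun_eq_iff split: list.split)

context coord_algebra
begin

lemma face_1_tensor_cons_in_tensor_power: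
  assumes "a \<in> A" "T \<in> tensor_power A n"
  shows "face 1 (Suc n) (tensor_cons a T) \<in> tensor_power A (Suc (Suc n))"
proof -
  obtain W e where W: "finite W" "\<And>w. e w \<in> A"
    "\<And>a u v. a \<in> A \<Longrightarrow> a (u @ v) = (\<Sum>w\<in>W. a (u @ w) * e w v)"
    using comultiplication by blast
  have "face 1 (Suc n) (tensor_cons a T)
      = (\<Sum>w\<in>W. tensor_cons (\<lambda>u. a (u @ w)) (tensor_cons (e w) T))"
    (is "_ = ?sum")
  proof
    fix ws :: "'g list list"
    show "face 1 (Suc n) (tensor_cons a T) ws = ?sum ws"
    proof (cases "length ws = Suc (Suc n)")
      case True
      then obtain u v vs where "ws = u # v # vs" by (auto simp: length_Suc_conv)
      then show ?thesis
        using True unfolding face_def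
        by (simp add: W(3)[OF assms(1), of u v] sum_fun_apply sum_distrib_right mult.assoc)
    next
      case False
      then have "tensor_cons b (tensor_cons c T) ws = 0" for b c
        using homogeneous_tensor_power[OF assms(2)]
        by (auto simp: tensor_cons_def homogeneous_iff split: list.split)
      with False show ?thesis by (simp add: face_def sum_fun_apply)
    qed
  qed
  moreover have "(\<lambda>u. a (u @ w)) \<in> A" for w
    using translate_closed[OF assms(1), of "[]"] by simp
  ultimately show ?thesis
    using W(2) assms(2) by (simp add: tensor_power_sum tensor_cons_in_tensor_power)
qed

lemma face_pure_tensor_in_tensor_power:
  assumes "i \<le> Suc (length as)" "set as \<subseteq> A"
  shows "face i (length as) (pure_tensor as) \<in> tensor_power A (Suc (length as))"
  using assms
proof (induction as arbitrary: i)
  case Nil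
  then show ?case
    using unit_in_tensor_power by (simp add: pure_tensor_Nil face_unit)
next
  case (Cons a as)
  have as: "pure_tensor as \<in> tensor_power A (length as)"
    using Cons.prems by (intro pure_tensor_in_tensor_power) auto
  consider (zero) "i = 0" | (one) "i = 1" | (inner) j where "i = Suc (Suc j)"
    by (metis One_nat_def old.nat.exhaust)
  then show ?case
  proof cases
    case zero
    have "pure_tensor (a # as) \<in> tensor_power A (Suc (length as))"
      using Cons.prems by (intro pure_tensor_in_tensor_power) auto
    then show ?thesis
      using zero homogeneous_pure_tensor[of "a # as"] tensor_cons_in_tensor_power[OF unit_closed]
      by (simp add: face_0)
  next
    case one
    then show ?thesis
      using Cons.prems face_1_tensor_cons_in_tensor_power[OF _ as, of a]
      by (simp add: pure_tensor_Cons)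
  next
    case inner
    then show ?thesis
      using Cons
      by (auto simp: pure_tensor_Cons face_Suc_Suc_tensor_cons intro!: tensor_cons_in_tensor_power)
  qed
qed

lemma face_in_tensor_power:
  assumes "i \<le> Suc n" "x \<in> tensor_power A n"
  shows "face i n x \<in> tensor_power A (Suc n)"
  using assms(2) subspace_tensor_power face.add face_scale
  by (rule tensor_power_linear_image) (use assms(1) face_pure_tensor_in_tensor_power in blast)

lemma d_add_in_tensor_power:
  assumes "x \<in> tensor_power I n"
  shows "d_add n x \<in> tensor_power I (Suc n)"
proof -
  have "x \<in> tensor_power A n" "normalized x"
    using assms by (simp_all add: tensor_power_I_eq)
  moreover from this have "d_add n x \<in> tensor_power A (Suc n)"
    unfolding d_add_eq_sum
    by (intro tensor_power_sum tensor_power_scale face_in_tensor_power) simp_all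
  ultimately show ?thesis by (simp add: tensor_power_I_eq normalized_d_add)
qed

abbreviation "cochain_units n \<equiv> units_of (cochain_ring A n)"

lemma comm_group_cochain_units: "comm_group (cochain_units n)"
  by (rule comm_monoid.units_comm_group[OF comm_monoid_cochain_ring])

lemma cochain_units_simps [simp]:
  "carrier (cochain_units n) = Units (cochain_ring A n)" "monoid.mult (cochain_units n) = conv"
  "monoid.one (cochain_units n) = unit_cochain n"
  by (simp_all add: units_of_def)

lemma cochain_Units_in_tensor_power: "x \<in> Units (cochain_ring A n) \<Longrightarrow> x \<in> tensor_power A n"
  by (simp add: Units_def)

lemma face_hom:
  assumes i: "i \<le> Suc n"
  shows "face i n \<in> hom (cochain_units n) (cochain_units (Suc n))"
proof (rule homI)
  fix x assume x: "x \<in> carrier (cochain_units n)"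
  then obtain y where y: "x \<in> tensor_power A n" "y \<in> tensor_power A n" "conv x y = unit_cochain n"
    by (auto simp: Units_def)
  then have "conv (face i n x) (face i n y) = unit_cochain (Suc n)"
    by (simp add: face_unit i flip: face_conv[OF i])
  then show "face i n x \<in> carrier (cochain_units (Suc n))"
    using cochain_unitI[OF face_in_tensor_power[OF i y(1)] face_in_tensor_power[OF i y(2)]] by simp
qed (simp add: face_conv[OF i])

lemma face_in_Units:
  "i \<le> Suc n \<Longrightarrow> x \<in> Units (cochain_ring A n) \<Longrightarrow> face i n x \<in> Units (cochain_ring A (Suc n))"
  using hom_in_carrier[OF face_hom[of i n]] by simp

lemma d_mult_eq:
  assumes "x \<in> Units (cochain_ring A n)"
  shows "d_mult A n x = finprod (cochain_units (Suc n))
    (\<lambda>i. face i n x [^]\<^bsub>cochain_units (Suc n)\<^esub> ((- 1) ^ i :: int)) {..Suc n}"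
proof -
  interpret R: comm_monoid "cochain_ring A (Suc n)" by (rule comm_monoid_cochain_ring)
  interpret U: comm_group "cochain_units (Suc n)" by (rule comm_group_cochain_units)
  define f where "f i = face i n x [^]\<^bsub>cochain_units (Suc n)\<^esub> ((- 1) ^ i :: int)" for i
  have unit: "f i \<in> Units (cochain_ring A (Suc n))" if "i \<le> Suc n" for i
    using U.int_pow_closed[of "face i n x"] face_in_Units[OF that assms] by (simp add: f_def)
  have "d_mult A n x = finprod (cochain_ring A (Suc n)) f {..Suc n}"
    unfolding d_mult_def f_def using unit face_in_Units[OF _ assms]
    by (intro R.finprod_cong' refl)
      (auto simp: R.units_of_int_pow f_def intro!: R.Units_closed simp del: cochain_ring_simps)
  also have "\<dots> = finprod (cochain_units (Suc n)) f {..Suc n}"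
    by (rule R.finprod_units_of[symmetric]) (use unit in auto)
  finally show ?thesis by (simp only: f_def[abs_def])
qed

lemma d_mult_hom: "d_mult A n \<in> hom (cochain_units n) (cochain_units (Suc n))"
proof -
  interpret U: comm_group "cochain_units (Suc n)" by (rule comm_group_cochain_units)
  let ?f = "\<lambda>x i. face i n x [^]\<^bsub>cochain_units (Suc n)\<^esub> ((- 1) ^ i :: int)"
  have f: "?f x \<in> {..Suc n} \<rightarrow> carrier (cochain_units (Suc n))"
    if "x \<in> Units (cochain_ring A n)" for x
    using face_in_Units[OF _ that] by (intro Pi_I U.int_pow_closed) simp
  show ?thesis
  proof (rule homI)
    fix x assume "x \<in> carrier (cochain_units n)"
    then show "d_mult A n x \<in> carrier (cochain_units (Suc n))"
      using U.finprod_closed[OF f] by (simp add: d_mult_eq)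
  next
    fix x y assume x: "x \<in> carrier (cochain_units n)" and y: "y \<in> carrier (cochain_units n)"
    interpret V: comm_group "cochain_units n" by (rule comm_group_cochain_units)
    have xy: "conv x y \<in> Units (cochain_ring A n)"
      using V.m_closed[OF x y] by simp
    have "?f (conv x y) i = conv (?f x i) (?f y i)" if "i \<le> Suc n" for i
      using U.int_pow_distrib[of "face i n x" "face i n y"] face_in_Units[OF that] x y
      by (simp add: face_conv[OF that])
    then have "d_mult A n (conv x y)
        = finprod (cochain_units (Suc n)) (\<lambda>i. ?f x i \<otimes>\<^bsub>cochain_units (Suc n)\<^esub> ?f y i) {..Suc n}"
      unfolding d_mult_eq[OF xy] using f x y
      by (intro U.finprod_cong' refl Pi_I U.m_closed) auto
    also have "\<dots> = d_mult A n x \<otimes>\<^bsub>cochain_units (Suc n)\<^esub> d_mult A n y"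
      using x y f by (subst U.finprod_multf) (simp_all only: d_mult_eq cochain_units_simps)
    finally show "d_mult A n (x \<otimes>\<^bsub>cochain_units n\<^esub> y)
        = d_mult A n x \<otimes>\<^bsub>cochain_units (Suc n)\<^esub> d_mult A n y"
      by (simp only: cochain_units_simps)
  qed
qed

lemma cochain_exp_sign_pow:
  assumes T: "cochain_exp n T \<in> tensor_power A n" "cochain_exp n (- T) \<in> tensor_power A n"
  shows "cochain_exp n T [^]\<^bsub>cochain_units n\<^esub> ((- 1) ^ i :: int)
      = cochain_exp n (fun_scale ((- 1) ^ i) T)"
proof -
  interpret R: comm_monoid "cochain_ring A n" by (rule comm_monoid_cochain_ring)
  interpret U: comm_group "cochain_units n" by (rule comm_group_cochain_units)
  have unit: "cochain_exp n T \<in> Units (cochain_ring A n)"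
    using T cochain_exp_uminus by (rule cochain_unitI)
  have inv: "inv\<^bsub>cochain_units n\<^esub> cochain_exp n T = cochain_exp n (- T)"
    unfolding R.units_of_inv[OF unit] using T cochain_exp_uminus by (rule cochain_inv_eq)
  show ?thesis
    using unit inv by (simp add: U.int_pow_minus_one_power)
qed

lemma cochain_exp_finprod:
  assumes "\<And>i. i \<in> S \<Longrightarrow> cochain_exp n (f i) \<in> Units (cochain_ring A n)"
  shows "finprod (cochain_units n) (\<lambda>i. cochain_exp n (f i)) S = cochain_exp n (sum f S)"
proof -
  interpret U: comm_group "cochain_units n" by (rule comm_group_cochain_units)
  show ?thesis
    using assms
  proof (induction S rule: infinite_finite_induct)
    case (insert i S)
    then have "finprod (cochain_units n) (\<lambda>i. cochain_exp n (f i)) (insert i S)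
        = conv (cochain_exp n (f i)) (cochain_exp n (sum f S))"
      by (simp add: Pi_iff)
    then show ?case by (simp only: sum.insert[OF insert.hyps] cochain_exp_add)
  next
    case empty
    show ?case by (simp only: U.finprod_empty sum.empty cochain_exp_zero cochain_units_simps)
  next
    case (infinite S)
    then show ?case
      by (simp only: U.finprod_infinite sum.infinite cochain_exp_zero cochain_units_simps
          not_False_eq_True)
  qed
qed

theorem d_mult_cochain_exp:
  assumes n: "n \<ge> 2" and x: "x \<in> tensor_power I n"
  shows "d_mult A n (cochain_exp n x) = cochain_exp (Suc n) (d_add n x)"
proof -
  let ?U = "cochain_units (Suc n)"
  interpret U: comm_group ?U by (rule comm_group_cochain_units)
  have face_exp: "cochain_exp (Suc n) (face i n y) \<in> Units (cochain_ring A (Suc n))"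
    if "i \<le> Suc n" "y \<in> tensor_power I n" for i y
    using face_in_Units[OF that(1) cochain_exp_in_Units[OF n that(2)]]
    by (simp add: face_cochain_exp that(1))
  have sign: "face i n (cochain_exp n x) [^]\<^bsub>?U\<^esub> ((- 1) ^ i :: int)
      = cochain_exp (Suc n) (fun_scale ((- 1) ^ i) (face i n x))" if i: "i \<le> Suc n" for i
    unfolding face_cochain_exp[OF i]
    using face_exp[OF i x] face_exp[OF i tensor_power_neg[OF x]]
    by (intro cochain_exp_sign_pow) (simp_all add: face.minus cochain_Units_in_tensor_power)
  have unit: "cochain_exp (Suc n) (fun_scale ((- 1) ^ i) (face i n x))
      \<in> Units (cochain_ring A (Suc n))"
    if "i \<le> Suc n" for i
    using U.int_pow_closed[of "face i n (cochain_exp n x)"] face_exp[OF that x]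
    by (simp add: face_cochain_exp that flip: sign[OF that])
  have "d_mult A n (cochain_exp n x)
      = finprod ?U (\<lambda>i. cochain_exp (Suc n) (fun_scale ((- 1) ^ i) (face i n x))) {..Suc n}"
    unfolding d_mult_eq[OF cochain_exp_in_Units[OF n x]]
    using sign unit by (intro U.finprod_cong' refl Pi_I) auto
  also have "\<dots> = cochain_exp (Suc n) (d_add n x)"
    unfolding d_add_eq_sum using unit by (intro cochain_exp_finprod) simp
  finally show ?thesis .
qed

end

section \<open>Cocycles and coboundaries\<close>

lemma Z_mult_simps [simp]:
  "carrier (Z_mult A n) = {\<Phi> \<in> C_mult A n. d_mult A n \<Phi> = unit_cochain (Suc n)}"
  "monoid.mult (Z_mult A n) = conv" "monoid.one (Z_mult A n) = unit_cochain n"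
  by (simp_all add: Z_mult_def units_of_def)

context coord_algebra
begin

lemma Z_add_simps [simp]:
  "carrier (Z_add A n) = {\<phi> \<in> tensor_power I n. d_add n \<phi> = 0}"
  "monoid.mult (Z_add A n) = (+)" "monoid.one (Z_add A n) = 0"
  by (simp_all add: Z_add_def C_add_eq zero_fun_def)

lemma comm_group_Z_add: "comm_group (Z_add A n)"
proof (rule comm_groupI)
  fix x assume "x \<in> carrier (Z_add A n)"
  then have "- x \<in> carrier (Z_add A n)" "- x + x = 0"
    by (simp_all add: tensor_power_neg d_add.minus)
  then show "\<exists>y\<in>carrier (Z_add A n). y \<otimes>\<^bsub>Z_add A n\<^esub> x = \<one>\<^bsub>Z_add A n\<^esub>"
    by (metis Z_add_simps(2,3))
qed (simp_all add: tensor_power_add tensor_power_zero d_add.add d_add.zero ac_simps)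

lemma subgroup_B_add:
  assumes "n \<ge> 1"
  shows "subgroup (B_add A n) (Z_add A n)"
proof -
  interpret Z: comm_group "Z_add A n" by (rule comm_group_Z_add)
  obtain m where m: "n = Suc m" using assms by (cases n) auto
  have B: "B_add A n = d_add m ` tensor_power I m" by (simp add: B_add_def m C_add_eq)
  have sub: "B_add A n \<subseteq> carrier (Z_add A n)"
    unfolding B using d_add_in_tensor_power[of _ m] by (auto simp: m d_add_d_add)
  have inv: "inv\<^bsub>Z_add A n\<^esub> d_add m x = d_add m (- x)" if "x \<in> tensor_power I m" for x
    using that sub tensor_power_neg[OF that]
    by (intro Z.comm_inv_char) (auto simp: B d_add.minus)
  show ?thesis
  proof (rule Z.subgroupI[OF sub])
    show "B_add A n \<noteq> {}" using tensor_power_zero by (auto simp: B)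
    show "inv\<^bsub>Z_add A n\<^esub> x \<in> B_add A n" if x: "x \<in> B_add A n" for x
    proof -
      obtain z where z: "z \<in> tensor_power I m" "x = d_add m z" using x unfolding B by blast
      show ?thesis unfolding B z(2) inv[OF z(1)] by (rule imageI[OF tensor_power_neg[OF z(1)]])
    qed
    show "x \<otimes>\<^bsub>Z_add A n\<^esub> y \<in> B_add A n" if "x \<in> B_add A n" "y \<in> B_add A n" for x y
      using that unfolding B Z_add_simps
      by (elim imageE) (simp only: d_add.add[symmetric] imageI tensor_power_add)
  qed
qed

lemma subgroup_C_mult: "subgroup (C_mult A n) (cochain_units n)"
proof -
  interpret U: comm_group "cochain_units n" by (rule comm_group_cochain_units)
  have counit_homogeneous: "homogeneous (n - 1) (counit_at i x)"
    if "i < n" "x \<in> Units (cochain_ring A n)" for i x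
    using homogeneous_tensor_power[OF cochain_Units_in_tensor_power[OF that(2)]] that(1)
    by (cases n) (simp_all add: homogeneous_def flip: counit_at_degree_part)
  show ?thesis
  proof (rule U.subgroupI)
    have "unit_cochain n \<in> C_mult A n"
      using U.one_closed by (simp add: C_mult_def counit_at_unit)
    then show "C_mult A n \<noteq> {}" by blast
    show "x \<otimes>\<^bsub>cochain_units n\<^esub> y \<in> C_mult A n" if "x \<in> C_mult A n" "y \<in> C_mult A n" for x y
      using that U.m_closed[of x y] by (simp add: C_mult_def counit_at_conv conv_unit)
    show "inv\<^bsub>cochain_units n\<^esub> x \<in> C_mult A n" if x: "x \<in> C_mult A n" for x
    proof -
      let ?y = "inv\<^bsub>cochain_units n\<^esub> x"
      have xU: "x \<in> carrier (cochain_units n)" using x by (simp add: C_mult_def)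
      have y: "?y \<in> Units (cochain_ring A n)" using U.inv_closed[OF xU] by simp
      have "counit_at i ?y = unit_cochain (n - 1)" if "i < n" for i
      proof -
        have "counit_at i ?y = counit_at i (conv x ?y)"
          using x that counit_homogeneous[OF that y]
          by (simp add: C_mult_def counit_at_conv conv_unit)
        also have "conv x ?y = unit_cochain n" using U.r_inv[OF xU] by simp
        finally show ?thesis by (simp only: counit_at_unit[OF that])
      qed
      then show ?thesis using y by (simp add: C_mult_def)
    qed
  qed (simp add: C_mult_def)
qed

lemma comm_group_Z_mult: "comm_group (Z_mult A n)"
proof -
  interpret U: comm_group "cochain_units n" by (rule comm_group_cochain_units)
  interpret d: group_hom "cochain_units n" "cochain_units (Suc n)" "d_mult A n"
    using comm_group_cochain_units d_mult_hom
    by (simp add: group_hom_def group_hom_axioms_def comm_group.axioms(2))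
  have "{\<Phi> \<in> C_mult A n. d_mult A n \<Phi> = unit_cochain (Suc n)}
      = C_mult A n \<inter> kernel (cochain_units n) (cochain_units (Suc n)) (d_mult A n)"
    by (auto simp: kernel_def C_mult_def)
  then show ?thesis
    unfolding Z_mult_def
    using U.subgroup_imp_comm_group[OF U.subgroups_Inter_pair[OF subgroup_C_mult d.subgroup_kernel]]
    by simp
qed

lemma C_mult_eq:
  assumes "n \<ge> 2"
  shows "C_mult A n = one_plus A n"
proof (intro equalityI subsetI)
  have counit_iff: "counit_at i x = unit_cochain (n - 1)
      \<longleftrightarrow> counit_at i (x - unit_cochain n) = (\<lambda>_. 0)"
    if "i < n" for i x
    by (simp add: counit_at.diff counit_at_unit[OF that] fun_eq_iff)
  fix x
  show "x \<in> one_plus A n" if x: "x \<in> C_mult A n"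
  proof -
    have "x - unit_cochain n \<in> C_add A n"
      using x tensor_power_diff[OF cochain_Units_in_tensor_power unit_in_tensor_power]
      by (simp add: C_mult_def C_add_def flip: counit_iff)
    then show ?thesis
      unfolding one_plus_eq C_add_eq by (rule rev_image_eqI) simp
  qed
  show "x \<in> C_mult A n" if x: "x \<in> one_plus A n"
  proof -
    have "x \<in> Units (cochain_ring A n)"
      using x cochain_exp_in_Units[OF assms]
      unfolding cochain_exp_image[OF assms, symmetric] by blast
    moreover have "x - unit_cochain n \<in> C_add A n"
      using x by (auto simp: one_plus_eq C_add_eq)
    ultimately show ?thesis by (simp add: C_mult_def C_add_def flip: counit_iff)
  qed
qed

lemma Z_mult_eq_image:
  assumes "n \<ge> 2"
  shows "carrier (Z_mult A n) = cochain_exp n ` carrier (Z_add A n)"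
proof -
  have "d_mult A n (cochain_exp n x) = unit_cochain (Suc n) \<longleftrightarrow> d_add n x = 0"
    if x: "x \<in> tensor_power I n" for x
    using inj_on_eq_iff[OF cochain_exp_inj[of "Suc n"] d_add_in_tensor_power[OF x]
        tensor_power_zero]
    by (simp only: d_mult_cochain_exp[OF assms x] cochain_exp_zero le_add1 plus_1_eq_Suc)
  then show ?thesis
    unfolding Z_mult_simps Z_add_simps C_mult_eq[OF assms] cochain_exp_image[OF assms, symmetric]
    by blast
qed

theorem group_isomorphisms_E_L:
  assumes n: "n \<ge> 2"
  shows "group_isomorphisms (Z_add A n) (Z_mult A n) (E_map A n) (L_map A n)"
proof -
  interpret Z: comm_group "Z_add A n" by (rule comm_group_Z_add)
  note E = E_map_eq_cochain_exp[OF n]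
  show ?thesis
  proof (rule Z.group_isomorphismsI)
    show image: "E_map A n ` carrier (Z_add A n) = carrier (Z_mult A n)"
      unfolding Z_mult_eq_image[OF n] by (rule image_cong) (simp_all add: E)
    show "E_map A n \<in> hom (Z_add A n) (Z_mult A n)"
    proof (rule homI)
      show "E_map A n x \<in> carrier (Z_mult A n)" if "x \<in> carrier (Z_add A n)" for x
        using that image by blast
    qed (simp add: E tensor_power_add cochain_exp_add)
    show "L_map A n (E_map A n x) = x" if "x \<in> carrier (Z_add A n)" for x
      using that by (simp add: E L_map_cochain_exp[OF n])
  qed
qed

corollary E_L_cocycle_isos:
  assumes n: "n \<ge> 2"
  shows "group_iso (E_map A n) (Z_add A n) (Z_mult A n)
    \<and> group_iso (L_map A n) (Z_mult A n) (Z_add A n)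
    \<and> (\<forall>\<phi>\<in>carrier (Z_add A n). L_map A n (E_map A n \<phi>) = \<phi>)
    \<and> (\<forall>\<Phi>\<in>carrier (Z_mult A n). E_map A n (L_map A n \<Phi>) = \<Phi>)"
  using group_isomorphisms_E_L[OF n] group_isomorphisms_imp_group_iso comm_group.axioms(2)
    comm_group_Z_add comm_group_Z_mult
  unfolding group_isomorphisms_def by metis

lemma B_mult_eq_image:
  assumes "n \<ge> 3"
  shows "E_map A n ` B_add A n = B_mult A n"
proof -
  obtain m where m: "n = Suc m" "m \<ge> 2" using assms by (cases n) auto
  have "B_mult A n = d_mult A m ` cochain_exp m ` tensor_power I m"
    by (simp add: B_mult_def m(1) C_mult_eq[OF m(2)] cochain_exp_image[OF m(2)])
  also have "\<dots> = E_map A n ` d_add m ` tensor_power I m"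
    unfolding image_image m(1)
    using d_add_in_tensor_power m(2)
    by (intro image_cong refl) (simp add: d_mult_cochain_exp E_map_eq_cochain_exp)
  finally show ?thesis by (simp add: B_add_def m(1) C_add_eq)
qed

theorem cohomology_isomorphisms:
  assumes n: "n \<ge> 3"
  shows "group (H_add A n)" "group (H_mult A n)"
    and "\<exists>F K. group_isomorphisms (H_add A n) (H_mult A n) F K
      \<and> (\<forall>\<phi>\<in>carrier (Z_add A n). F (cls_add A n \<phi>) = cls_mult A n (E_map A n \<phi>))
      \<and> (\<forall>\<Phi>\<in>carrier (Z_mult A n). K (cls_mult A n \<Phi>) = cls_add A n (L_map A n \<Phi>))"
proof -
  interpret Z: comm_group "Z_add A n" by (rule comm_group_Z_add)
  interpret Z': comm_group "Z_mult A n" by (rule comm_group_Z_mult)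
  have E: "group_isomorphisms (Z_add A n) (Z_mult A n) (E_map A n) (L_map A n)"
    using n by (intro group_isomorphisms_E_L) simp
  interpret E: group_hom "Z_add A n" "Z_mult A n" "E_map A n"
    by unfold_locales (use E in \<open>simp add: group_isomorphisms_def\<close>)
  have B: "subgroup (B_add A n) (Z_add A n)" using n by (intro subgroup_B_add) simp
  then have "subgroup (B_mult A n) (Z_mult A n)"
    using E.subgroup_img_is_subgroup B_mult_eq_image[OF n] by metis
  then have normal: "B_add A n \<lhd> Z_add A n" "B_mult A n \<lhd> Z_mult A n"
    using B by (simp_all add: Z.subgroup_imp_normal Z'.subgroup_imp_normal)
  then show "group (H_add A n)" "group (H_mult A n)"
    by (simp_all add: H_add_def H_mult_def normal.factorgroup_is_group)
  show "\<exists>F K. group_isomorphisms (H_add A n) (H_mult A n) F K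
      \<and> (\<forall>\<phi>\<in>carrier (Z_add A n). F (cls_add A n \<phi>) = cls_mult A n (E_map A n \<phi>))
      \<and> (\<forall>\<Phi>\<in>carrier (Z_mult A n). K (cls_mult A n \<Phi>) = cls_add A n (L_map A n \<Phi>))"
    using group_isomorphisms_FactGroup[OF E normal B_mult_eq_image[OF n]]
    unfolding H_add_def H_mult_def cls_add_def cls_mult_def by metis
qed

corollary E_L_cohomology_isos:
  assumes n: "n \<ge> 3"
  shows "\<exists>EE LL.
           (\<forall>\<phi>\<in>carrier (Z_add A n). EE (cls_add A n \<phi>) = cls_mult A n (E_map A n \<phi>))
           \<and> (\<forall>\<Phi>\<in>carrier (Z_mult A n). LL (cls_mult A n \<Phi>) = cls_add A n (L_map A n \<Phi>))
           \<and> group_iso EE (H_add A n) (H_mult A n)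
           \<and> group_iso LL (H_mult A n) (H_add A n)
           \<and> (\<forall>x\<in>carrier (H_add A n). LL (EE x) = x)
           \<and> (\<forall>y\<in>carrier (H_mult A n). EE (LL y) = y)"
  using cohomology_isomorphisms[OF n] group_isomorphisms_imp_group_iso
  unfolding group_isomorphisms_def by metis

end

section \<open>Degree zero\<close>

lemma comm_group_mult_group_of_field: "comm_group (mult_group_of_field :: 'k::field monoid)"
  by (rule comm_groupI)
    (auto simp: mult_group_of_field_def ac_simps intro!: bexI[of _ "inverse _"])

context coord_algebra
begin

lemma d_mult_0:
  assumes "x \<in> Units (cochain_ring A 0)"
  shows "d_mult A 0 x = unit_cochain 1"
proof -
  interpret U: comm_group "cochain_units (Suc 0)" by (rule comm_group_cochain_units)
  have faces: "face (Suc 0) 0 x = face 0 0 x"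
    by (rule ext) (auto simp: face_def length_Suc_conv)
  have unit: "face 0 0 x \<in> carrier (cochain_units (Suc 0))"
    using face_in_Units[OF _ assms, of 0] by simp
  define f where "f i = face i 0 x [^]\<^bsub>cochain_units (Suc 0)\<^esub> ((- 1) ^ i :: int)" for i
  have f: "f (Suc 0) = inv\<^bsub>cochain_units (Suc 0)\<^esub> face 0 0 x" "f 0 = face 0 0 x"
    unfolding f_def faces U.int_pow_minus_one_power[OF unit] by simp_all
  have "f \<in> {..Suc 0} \<rightarrow> carrier (cochain_units (Suc 0))"
    using unit U.inv_closed[OF unit] by (auto simp: le_Suc_eq f)
  then have "d_mult A 0 x = f (Suc 0) \<otimes>\<^bsub>cochain_units (Suc 0)\<^esub> f 0"
    unfolding d_mult_eq[OF assms] f_def[symmetric]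
    by (subst U.finprod_Suc) (simp_all add: Pi_iff del: cochain_units_simps)
  also have "\<dots> = unit_cochain 1" using U.l_inv[OF unit] by (simp add: f)
  finally show ?thesis .
qed

lemma d_mult_1_eq_unit_iff:
  assumes "x \<in> Units (cochain_ring A 1)"
  shows "d_mult A 1 x = unit_cochain 2 \<longleftrightarrow> face 1 1 x = conv (face 0 1 x) (face 2 1 x)"
proof -
  let ?U = "cochain_units (Suc (Suc 0))"
  interpret U: comm_group ?U by (rule comm_group_cochain_units)
  have unit: "face i 1 x \<in> carrier ?U" if "i \<le> 2" for i
    using face_in_Units[OF _ assms, of i] that by simp
  define f where "f i = face i 1 x [^]\<^bsub>?U\<^esub> ((- 1) ^ i :: int)" for i
  have f: "f \<in> {..2} \<rightarrow> carrier ?U" using unit U.int_pow_closed by (simp add: f_def Pi_iff)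
  have "d_mult A 1 x = finprod ?U f {..2}"
    using d_mult_eq[OF assms] by (simp add: numeral_2_eq_2 f_def[abs_def])
  also have "\<dots> = f 2 \<otimes>\<^bsub>?U\<^esub> (f 1 \<otimes>\<^bsub>?U\<^esub> f 0)"
    using f by (simp add: numeral_2_eq_2 U.finprod_Suc Pi_iff del: cochain_units_simps)
  also have "\<dots> = face 2 1 x \<otimes>\<^bsub>?U\<^esub> (inv\<^bsub>?U\<^esub> face 1 1 x \<otimes>\<^bsub>?U\<^esub> face 0 1 x)"
    unfolding f_def using unit by (simp only: U.int_pow_minus_one_power) simp
  also have "\<dots> = inv\<^bsub>?U\<^esub> face 1 1 x \<otimes>\<^bsub>?U\<^esub> (face 0 1 x \<otimes>\<^bsub>?U\<^esub> face 2 1 x)"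
    using unit by (simp add: U.m_ac del: cochain_units_simps)
  finally have "d_mult A 1 x = \<one>\<^bsub>?U\<^esub> \<longleftrightarrow> face 0 1 x \<otimes>\<^bsub>?U\<^esub> face 2 1 x = face 1 1 x \<otimes>\<^bsub>?U\<^esub> \<one>\<^bsub>?U\<^esub>"
    using unit
    by (simp only: U.inv_solve_left' U.one_closed U.m_closed zero_le one_le_numeral order_refl)
  then show ?thesis
    unfolding U.r_one[OF unit[OF one_le_numeral]] by (auto simp: numeral_2_eq_2)
qed

lemma tensor_power_0: "tensor_power A 0 = {fun_scale c (unit_cochain 0) | c. True}"
proof -
  have "{pure_tensor as | as. length as = 0 \<and> set as \<subseteq> A} = {unit_cochain 0}"
    by (auto simp: pure_tensor_Nil)
  then show ?thesis
    unfolding tensor_power_eq_span by (auto simp: fun_space.span_singleton)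
qed

lemma C_mult_0: "C_mult A 0 = {fun_scale c (unit_cochain 0) | c. c \<noteq> 0}"
proof -
  have "fun_scale c (unit_cochain 0) \<in> Units (cochain_ring A 0)" if "c \<noteq> 0" for c
    using that by (intro cochain_unitI[of _ _ "fun_scale (inverse c) (unit_cochain 0)"])
      (auto simp: tensor_power_0 conv_scale_left conv_scale_right conv_unit)
  moreover have "c \<noteq> 0" if c: "fun_scale c (unit_cochain 0) \<in> Units (cochain_ring A 0)" for c
  proof -
    obtain y where y: "y \<in> tensor_power A 0"
      "conv (fun_scale c (unit_cochain 0)) y = unit_cochain 0"
      using c by (auto simp: Units_def)
    from fun_cong[OF y(2), of "[]"] show ?thesis
      by (auto simp: unit_cochain_def)
  qed
  moreover have "Units (cochain_ring A 0) \<subseteq> tensor_power A 0"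
    using cochain_Units_in_tensor_power by blast
  moreover have "C_mult A 0 = Units (cochain_ring A 0)" by (simp add: C_mult_def)
  ultimately show ?thesis unfolding tensor_power_0 by blast
qed

theorem H_mult_0_iso:
  "group_iso (\<lambda>c. cls_mult A 0 (\<lambda>ws. c * unit_cochain 0 ws)) mult_group_of_field (H_mult A 0)"
proof -
  have carrier: "carrier (Z_mult A 0) = {fun_scale c (unit_cochain 0) | c. c \<noteq> 0}"
    using d_mult_0 by (auto simp: C_mult_0[symmetric]) (auto simp: C_mult_def)
  have inj: "c = d"
    if "fun_scale c (unit_cochain 0) = fun_scale d (unit_cochain 0 :: ('g, 'k) cochain)" for c d
    using fun_cong[OF that, of "[]"] by (simp add: unit_cochain_def)
  have iso: "(\<lambda>c. fun_scale c (unit_cochain 0)) \<in> iso mult_group_of_field (Z_mult A 0)"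
    unfolding iso_def hom_def bij_betw_def carrier
    by (auto simp: mult_group_of_field_def conv_scale_left conv_scale_right conv_unit
        intro!: inj_onI dest: inj)
  have "B_mult A 0 = {\<one>\<^bsub>Z_mult A 0\<^esub>}" by (simp add: B_mult_def)
  with comm_group.axioms(2)[OF comm_group_mult_group_of_field]
    comm_group.axioms(2)[OF comm_group_Z_mult] iso
  show ?thesis
    unfolding cls_mult_def H_mult_def fun_scale_def by (rule group_iso_trivial_quotient)
qed

end

section \<open>Degree one\<close>

lemma word_conv_word_unit: "word_conv word_unit a = a" "word_conv a word_unit = a"
proof -
  have "word_conv word_unit a w = a w \<and> word_conv a word_unit w = a w" for w
  proof (induction w arbitrary: a)
    case (Cons x w)
    have "word_conv 0 b w = 0" "word_conv b 0 w = 0" for b :: "'a list \<Rightarrow> 'b"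
      by (simp_all add: word_conv_def case_prod_unfold)
    then show ?case
      using Cons by (simp add: word_conv_Cons word_unit_def[of "x # _"] zero_fun_def)
  qed (simp add: word_unit_def)
  then show "word_conv word_unit a = a" "word_conv a word_unit = a" by auto
qed

lemma conv_outer_faces:
  assumes "homogeneous 1 x"
  shows "conv (face 0 1 x) (face 2 1 x) [u, v] = x [u] * x [v]"
proof -
  define a where "a w = x [w]" for w
  have x: "x = tensor_cons a (unit_cochain 0)"
    using assms by (auto simp: a_def tensor_cons_def unit_cochain_def homogeneous_iff fun_eq_iff
        split: list.split)
  have "face 0 1 x = tensor_cons word_unit (tensor_cons a (unit_cochain 0))"
    using face_0[OF assms] by (simp only: x)
  moreover have "face 2 1 x = tensor_cons a (tensor_cons word_unit (unit_cochain 0))"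
    using face_Suc_Suc_tensor_cons[of 0 0 a "unit_cochain 0"]
    by (simp add: x numeral_2_eq_2 face_unit unit_cochain_Suc)
  ultimately have "conv (face 0 1 x) (face 2 1 x) = tensor_cons a (tensor_cons a (unit_cochain 0))"
    by (simp add: conv_tensor_cons word_conv_word_unit conv_unit)
  then show ?thesis by (simp add: a_def unit_cochain_def)
qed

lemma homogeneous_2_eq_iff:
  assumes F: "homogeneous 2 F" and G: "homogeneous 2 G"
  shows "F = G \<longleftrightarrow> (\<forall>u v. F [u, v] = G [u, v])"
proof (intro iffI ext)
  fix ws assume eq: "\<forall>u v. F [u, v] = G [u, v]"
  show "F ws = G ws"
  proof (cases "length ws = 2")
    case True
    then obtain u v where "ws = [u, v]" by (auto simp: length_Suc_conv numeral_2_eq_2)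
    then show ?thesis using eq by simp
  qed (use F G in \<open>simp add: homogeneous_iff\<close>)
qed simp

lemma degree_1_cocycle_iff:
  assumes x: "homogeneous 1 x"
  shows "face 1 1 x = conv (face 0 1 x) (face 2 1 x) \<longleftrightarrow> (\<forall>u v. x [u @ v] = x [u] * x [v])"
proof -
  have "homogeneous 2 (conv (face 0 1 x) (face 2 1 x))"
    using homogeneous_face[of 1 0 x]
    by (simp add: homogeneous_def numeral_2_eq_2 flip: conv_degree_part_left)
  moreover have "homogeneous 2 (face 1 1 x)"
    using homogeneous_face[of 1 1 x] by (simp add: numeral_2_eq_2)
  ultimately have "face 1 1 x = conv (face 0 1 x) (face 2 1 x)
      \<longleftrightarrow> (\<forall>u v. face 1 1 x [u, v] = conv (face 0 1 x) (face 2 1 x) [u, v])"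
    by (intro homogeneous_2_eq_iff)
  also have "\<dots> \<longleftrightarrow> (\<forall>u v. x [u @ v] = x [u] * x [v])"
    unfolding conv_outer_faces[OF x] by (simp add: face_def)
  finally show ?thesis .
qed

definition character_hom :: "('g, 'k::field) cochain monoid \<Rightarrow> ('g, 'k) cochain
    \<Rightarrow> (int \<Rightarrow>\<^sub>0 'k) \<Rightarrow> ('g, 'k) cochain" where
  "character_hom G x P ws = linear_extension (\<lambda>m. (x [^]\<^bsub>G\<^esub> m) ws) P"

interpretation character_hom: additive "character_hom G x :: _ \<Rightarrow> ('g, 'k::field) cochain" for G x
  by standard (simp add: character_hom_def linear_extension.add fun_eq_iff)

lemma character_hom_single: "character_hom G x (Poly_Mapping.single m c) = fun_scale c (x [^]\<^bsub>G\<^esub> m)"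
  by (simp add: character_hom_def fun_eq_iff)

lemma character_hom_lpow: "character_hom G x (lpow m) = x [^]\<^bsub>G\<^esub> m"
  by (simp add: lpow_def character_hom_single)

context coord_algebra
begin

lemma B_mult_1: "B_mult A 1 = {unit_cochain 1}"
proof -
  have "d_mult A 0 ` C_mult A 0 = (\<lambda>_. unit_cochain 1) ` C_mult A 0"
    by (intro image_cong refl d_mult_0) (simp add: C_mult_def)
  moreover have "C_mult A 0 \<noteq> {}"
    using subgroup.one_closed[OF subgroup_C_mult] by blast
  ultimately show ?thesis by (simp add: B_mult_def image_constant_conv)
qed

lemma Z_mult_1_iff:
  "x \<in> carrier (Z_mult A 1)
    \<longleftrightarrow> x \<in> Units (cochain_ring A 1) \<and> x [[]] = 1 \<and> (\<forall>u v. x [u @ v] = x [u] * x [v])"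
proof (cases "x \<in> Units (cochain_ring A 1)")
  case True
  then have x: "homogeneous 1 x"
    using cochain_Units_in_tensor_power homogeneous_tensor_power by blast
  then have "counit_at 0 x = unit_cochain 0 \<longleftrightarrow> x [[]] = 1"
    by (auto simp: unit_cochain_def homogeneous_iff fun_eq_iff)
  then show ?thesis
    using True d_mult_1_eq_unit_iff[OF True] degree_1_cocycle_iff[OF x]
    by (simp add: C_mult_def numeral_2_eq_2)
qed (simp add: C_mult_def)

lemma Z_mult_1_in_tensor_power: "x \<in> carrier (Z_mult A 1) \<Longrightarrow> x \<in> tensor_power A 1"
  unfolding Z_mult_1_iff using cochain_Units_in_tensor_power by blast

lemma hopf_hom_Gm_lpow_add:
  assumes "hopf_hom_Gm A h"
  shows "h (lpow (m + l)) = conv (h (lpow m)) (h (lpow l))"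
proof -
  have "lpow (m + l) = (lpow m * lpow l :: int \<Rightarrow>\<^sub>0 'k)"
    by (simp add: lpow_def mult_single)
  then show ?thesis using assms by (simp add: hopf_hom_Gm_def)
qed

lemma hopf_hom_Gm_lpow_0: "hopf_hom_Gm A h \<Longrightarrow> h (lpow 0) = unit_cochain 1"
  by (simp add: hopf_hom_Gm_def lpow_def)

lemma hopf_hom_Gm_lpow_in_Z_mult:
  assumes "hopf_hom_Gm A h"
  shows "h (lpow m) \<in> carrier (Z_mult A 1)"
proof -
  have mem: "h P \<in> tensor_power A 1" for P
    using assms by (simp add: hopf_hom_Gm_def)
  have "conv (h (lpow m)) (h (lpow (- m))) = unit_cochain 1"
    by (simp add: hopf_hom_Gm_lpow_0[OF assms] flip: hopf_hom_Gm_lpow_add[OF assms])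
  then have "h (lpow m) \<in> Units (cochain_ring A 1)"
    by (rule cochain_unitI[OF mem mem])
  then show ?thesis
    using assms unfolding Z_mult_1_iff hopf_hom_Gm_def by blast
qed

lemma hopf_hom_Gm_lpow_eq_pow:
  assumes "hopf_hom_Gm A h"
  shows "h (lpow m) = h (lpow 1) [^]\<^bsub>Z_mult A 1\<^esub> m"
proof -
  interpret Z: comm_group "Z_mult A 1" by (rule comm_group_Z_mult)
  note mem = hopf_hom_Gm_lpow_in_Z_mult[OF assms] and add = hopf_hom_Gm_lpow_add[OF assms]
  have "h (lpow 1) [^]\<^bsub>Z_mult A 1\<^esub> (- 1 :: int) = inv\<^bsub>Z_mult A 1\<^esub> h (lpow 1)"
    using Z.int_pow_neg[OF mem[of 1], of 1] Z.int_pow_1[OF mem[of 1]] by simp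
  also have "\<dots> = h (lpow (- 1))"
    using mem add[of 1 "- 1"] hopf_hom_Gm_lpow_0[OF assms] by (intro Z.comm_inv_char) auto
  finally have neg: "h (lpow (- 1)) = h (lpow 1) [^]\<^bsub>Z_mult A 1\<^esub> (- 1 :: int)" ..
  show ?thesis
  proof (induction m rule: int_induct[of _ 0])
    case base
    show ?case using hopf_hom_Gm_lpow_0[OF assms] by simp
  next
    case (step1 i)
    then show ?case
      using add[of i 1] Z.int_pow_mult[OF mem, of 1 i 1] Z.int_pow_1[OF mem[of 1]] by simp
  next
    case (step2 i)
    then show ?case
      using add[of i "- 1"] Z.int_pow_mult[OF mem, of 1 i "- 1"] neg by simp
  qed
qed

lemma hopf_hom_Gm_eq_character_hom:
  assumes h: "hopf_hom_Gm A h"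
  shows "h = character_hom (Z_mult A 1) (h (lpow 1))"
proof
  have h_add: "h (P + Q) = h P + h Q" for P Q
    using h by (simp add: hopf_hom_Gm_def fun_eq_iff)
  have h_single: "h (Poly_Mapping.single m c) = fun_scale c (h (lpow m))" for m c
  proof -
    have "Poly_Mapping.single m c = Poly_Mapping.single 0 c * lpow m"
      by (simp add: lpow_def mult_single)
    moreover have "h (Poly_Mapping.single 0 c * P) ws = c * h P ws" for P ws
      using h unfolding hopf_hom_Gm_def by blast
    ultimately show ?thesis by (intro ext) (simp only: fun_scale_apply)
  qed
  fix P show "h P = character_hom (Z_mult A 1) (h (lpow 1)) P"
  proof (induction P rule: poly_mapping_induct)
    case zero
    show ?case using h_single[of 0 0] by (simp add: character_hom.zero)
  next
    case (add P Q)
    then show ?case by (simp only: h_add character_hom.add)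
  next
    case (single m c)
    show ?case by (simp only: h_single character_hom_single hopf_hom_Gm_lpow_eq_pow[OF h, of m])
  qed
qed

lemma character_hom_mult:
  assumes "x \<in> carrier (Z_mult A 1)"
  shows "character_hom (Z_mult A 1) x (P * Q)
    = conv (character_hom (Z_mult A 1) x P) (character_hom (Z_mult A 1) x Q)"
proof (induction P rule: poly_mapping_induct)
  case zero
  show ?case by (simp only: mult_zero_left character_hom.zero conv_left.zero)
next
  case (add P P')
  then show ?case by (simp only: distrib_right character_hom.add conv_left.add)
next
  case (single m c)
  show ?case
  proof (induction Q rule: poly_mapping_induct)
    case zero
    show ?case by (simp only: mult_zero_right character_hom.zero conv_right.zero)
  next
    case (add Q Q')
    then show ?case by (simp only: distrib_left character_hom.add conv_right.add)
  next
    case (single l d)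
    interpret Z: comm_group "Z_mult A 1" by (rule comm_group_Z_mult)
    show ?case
      unfolding mult_single character_hom_single conv_scale_left conv_scale_right
        Z.int_pow_mult[OF assms] Z_mult_simps(2) fun_space.scale_scale by (simp only: mult.commute)
  qed
qed

lemma hopf_hom_Gm_character_hom:
  assumes x: "x \<in> carrier (Z_mult A 1)"
  shows "hopf_hom_Gm A (character_hom (Z_mult A 1) x)"
proof -
  interpret Z: comm_group "Z_mult A 1" by (rule comm_group_Z_mult)
  let ?\<theta> = "character_hom (Z_mult A 1) x"
  have pow: "x [^]\<^bsub>Z_mult A 1\<^esub> m \<in> carrier (Z_mult A 1)" for m :: int
    using x by (rule Z.int_pow_closed)
  have mem: "?\<theta> P \<in> tensor_power A 1" for P
  proof (induction P rule: poly_mapping_induct)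
    case (single m c)
    show ?case
      unfolding character_hom_single
      by (intro tensor_power_scale Z_mult_1_in_tensor_power pow)
  qed (simp_all only: character_hom.zero character_hom.add tensor_power_zero tensor_power_add)
  have scalar: "?\<theta> (Poly_Mapping.single 0 c) = fun_scale c (unit_cochain 1)" for c
    by (simp add: character_hom_single)
  show ?thesis
    unfolding hopf_hom_Gm_def
  proof (intro conjI allI)
    show "?\<theta> 1 = unit_cochain 1"
      using scalar[of 1] by simp
    show "?\<theta> (Poly_Mapping.single 0 c * P) ws = c * ?\<theta> P ws" for c P ws
      unfolding character_hom_mult[OF x] scalar conv_scale_left
        conv_unit[OF homogeneous_tensor_power[OF mem]]
      by simp
    show "?\<theta> (lpow m) [u @ v] = ?\<theta> (lpow m) [u] * ?\<theta> (lpow m) [v]" "?\<theta> (lpow m) [[]] = 1" for m u v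
      using pow[of m] unfolding Z_mult_1_iff character_hom_lpow by blast+
  qed (use mem character_hom_mult[OF x] in \<open>simp_all add: character_hom.add\<close>)
qed

lemma character_hom_in_hom: "character_hom (Z_mult A 1) \<in> hom (Z_mult A 1) (Hom_Gm A)"
proof (rule homI)
  interpret Z: comm_group "Z_mult A 1" by (rule comm_group_Z_mult)
  fix x y assume x: "x \<in> carrier (Z_mult A 1)" and y: "y \<in> carrier (Z_mult A 1)"
  have "conv x y [^]\<^bsub>Z_mult A 1\<^esub> m = conv (x [^]\<^bsub>Z_mult A 1\<^esub> m) (y [^]\<^bsub>Z_mult A 1\<^esub> m)" for m :: int
    using Z.int_pow_distrib[OF x y, of m] unfolding Z_mult_simps(2) .
  then show "character_hom (Z_mult A 1) (x \<otimes>\<^bsub>Z_mult A 1\<^esub> y)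
      = character_hom (Z_mult A 1) x \<otimes>\<^bsub>Hom_Gm A\<^esub> character_hom (Z_mult A 1) y"
    by (intro ext) (simp add: Hom_Gm_def character_hom_lpow,
        simp add: character_hom_def linear_extension_def)
qed (simp add: Hom_Gm_def hopf_hom_Gm_character_hom del: Z_mult_simps One_nat_def)

theorem H_mult_1_iso: "group_iso (\<lambda>h. cls_mult A 1 (h (lpow 1))) (Hom_Gm A) (H_mult A 1)"
proof -
  let ?\<theta> = "character_hom (Z_mult A 1)"
  interpret Z: comm_group "Z_mult A 1" by (rule comm_group_Z_mult)
  have lpow_1: "?\<theta> x (lpow 1) = x" if "x \<in> carrier (Z_mult A 1)" for x
    using that by (simp only: character_hom_lpow Z.int_pow_1)
  have image: "?\<theta> ` carrier (Z_mult A 1) = carrier (Hom_Gm A)"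
  proof (intro equalityI subsetI)
    fix h assume "h \<in> carrier (Hom_Gm A)"
    then have h: "hopf_hom_Gm A h" by (simp add: Hom_Gm_def)
    from hopf_hom_Gm_eq_character_hom[OF h] hopf_hom_Gm_lpow_in_Z_mult[OF h]
    show "h \<in> ?\<theta> ` carrier (Z_mult A 1)" by (rule image_eqI)
  qed (use hom_in_carrier[OF character_hom_in_hom] in blast)
  have isos: "group_isomorphisms (Z_mult A 1) (Hom_Gm A) ?\<theta> (\<lambda>h. h (lpow 1))"
    by (intro Z.group_isomorphismsI character_hom_in_hom image lpow_1)
  have "?\<theta> \<one>\<^bsub>Z_mult A 1\<^esub> = \<one>\<^bsub>Hom_Gm A\<^esub>"
  proof (intro ext)
    fix P ws
    have "\<one>\<^bsub>Z_mult A 1\<^esub> [^]\<^bsub>Z_mult A 1\<^esub> m = unit_cochain 1" for m :: int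
      using Z.int_pow_one by simp
    then show "?\<theta> \<one>\<^bsub>Z_mult A 1\<^esub> P ws = \<one>\<^bsub>Hom_Gm A\<^esub> P ws"
      unfolding character_hom_def by (simp add: Hom_Gm_def linear_extension_def)
  qed
  then have "group (Hom_Gm A)"
    using Z.iso_imp_img_group[OF group_isomorphisms_imp_iso[OF isos]] by (simp add: Hom_Gm_def)
  moreover have "(\<lambda>h. h (lpow 1)) \<in> iso (Hom_Gm A) (Z_mult A 1)"
    by (rule group_isomorphisms_imp_iso[OF group_isomorphisms_sym[OF isos]])
  moreover have "B_mult A 1 = {\<one>\<^bsub>Z_mult A 1\<^esub>}"
    by (simp only: B_mult_1 Z_mult_simps(3))
  ultimately show ?thesis
    unfolding cls_mult_def H_mult_def by (intro group_iso_trivial_quotient Z.group_axioms)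
qed

end

theorem theorem5p4:
  fixes scale :: "'k::alg_closed_field \<Rightarrow> 'g::ab_group_add \<Rightarrow> 'g"
    and br :: "'g \<Rightarrow> 'g \<Rightarrow> 'g"
    and pmap :: "'g \<Rightarrow> 'g"
    and A :: "('g list \<Rightarrow> 'k) set"
  assumes char_pos: "CHAR('k) > 0"
    and lie: "restricted_lie_algebra scale br pmap"
    and fin: "fin_dim scale"
    and A: "A = coord_ring scale br pmap"
  shows "group_iso (\<lambda>c. cls_mult A 0 (\<lambda>ws. c * unit_cochain 0 ws))
           mult_group_of_field (H_mult A 0)
    \<and> group_iso (\<lambda>h. cls_mult A 1 (h (lpow 1))) (Hom_Gm A) (H_mult A 1)
    \<and> (\<forall>n\<ge>2.
           group_iso (E_map A n) (Z_add A n) (Z_mult A n)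
           \<and> group_iso (L_map A n) (Z_mult A n) (Z_add A n)
           \<and> (\<forall>\<phi>\<in>carrier (Z_add A n). L_map A n (E_map A n \<phi>) = \<phi>)
           \<and> (\<forall>\<Phi>\<in>carrier (Z_mult A n). E_map A n (L_map A n \<Phi>) = \<Phi>))
    \<and> (\<forall>n\<ge>3. \<exists>EE LL.
           (\<forall>\<phi>\<in>carrier (Z_add A n). EE (cls_add A n \<phi>) = cls_mult A n (E_map A n \<phi>))
           \<and> (\<forall>\<Phi>\<in>carrier (Z_mult A n). LL (cls_mult A n \<Phi>) = cls_add A n (L_map A n \<Phi>))
           \<and> group_iso EE (H_add A n) (H_mult A n)
           \<and> group_iso LL (H_mult A n) (H_add A n)
           \<and> (\<forall>x\<in>carrier (H_add A n). LL (EE x) = x)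
           \<and> (\<forall>y\<in>carrier (H_mult A n). EE (LL y) = y))"
proof -
  interpret restricted_lie_algebra scale br pmap by (rule lie)
  interpret coord_algebra A
    unfolding A by (rule coord_algebra_coord_ring[OF char_pos vector_space_axioms fin])
  show ?thesis
    using H_mult_0_iso H_mult_1_iso E_L_cocycle_isos E_L_cohomology_isos by blast
qed

end
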